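(* Let $\rho_1\in\mathcal P_2(\mathbb R^n)$ be a target law and let $(\rho_t)_{t\in[0,1)}$, $\rho_t(\mathrm dx)=\rho(t,x)\,\mathrm dx$, be a narrowly continuous curve of absolutely continuous measures in $\mathcal P_2(\mathbb R^n)$. Let $v:(0,1)\times\mathbb R^n\to\mathbb R^n$ be a Borel velocity field such that $\partial_t\rho+\nabla_x\cdot(\rho v)=0$ holds weakly on $(0,1)\times\mathbb R^n$, and such that for every $\bar t\in(0,1)$ $$\int_0^{\bar t}\int_{\mathbb R^n}\|v(t,x)\|^2\,\rho_t(\mathrm dx)\,\mathrm dt<\infty .$$ Then the function $r(t):=SW_2(\rho_t,\rho_1)$ is locally absolutely continuous on $[0,1)$. Moreover, for almost every $t\in(0,1)$, $$\frac{\mathrm d}{\mathrm dt}SW_2^2(\rho_t,\rho_1)=2\int_{\mathbb R^n}g_t(x)^\top v(t,x)\,\rho_t(\mathrm dx),$$ where $g_t$ is the sliced discrepancy field between $\rho_t$ and $\rho_1$.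
   Context: $\mathcal P_2(\mathbb R^n)$ is the set of Borel probability measures on $\mathbb R^n$ with finite second moment and $W_2$ is the Wasserstein-2 distance (quadratic cost). $\mathcal S^{n-1}$ is the unit sphere of $\mathbb R^n$ and $\sigma$ its uniform probability measure. For $\theta\in\mathcal S^{n-1}$, $\mu_\theta$ denotes the pushforward of $\mu$ under $x\mapsto\theta^\top x$. The sliced Wasserstein distance is $SW_2^2(\mu,\nu)=\int_{\mathcal S^{n-1}}W_2^2(\mu_\theta,\nu_\theta)\,\sigma(\mathrm d\theta)$. The target $\rho_1$ is a fixed measure, not assumed to be the limit of $\rho_t$ as $t\nearrow1$. Write $\rho_{t,\theta}=(\rho_t)_\theta$, $\rho_{1,\theta}=(\rho_1)_\theta$. $\mathcal T_t^\theta=F_{\rho_{1,\theta}}^{-1}\circ F_{\rho_{t,\theta}}$ is the monotone (one-dimensional optimal transport) map from $\rho_{t,\theta}$ to $\rho_{1,\theta}$, defined $\rho_{t,\theta}$-a.e., where $F_\mu$ is the cumulative distribution function and $F_\mu^{-1}(z)=\inf\{s: F_\mu(s)\ge z\}$. The sliced discrepancy field is $$g_t(x)=\int_{\mathcal S^{n-1}}\bigl(\theta^\top x-\mathcal T_t^\theta(\theta^\top x)\bigr)\theta\,\sigma(\mathrm d\theta),$$ defined for $\rho_t$-a.e. $x$. The weak continuity equation means: for every $\zeta\in C_c^\infty((0,1)\times\mathbb R^n)$, $\int_0^1\int_{\mathbb R^n}(\partial_t\zeta+\nabla_x\zeta^\top v)\,\rho(t,x)\,\mathrm dx\,\mathrm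 dt=0$. *)

theory Defs
  imports "HOL-Probability.Probability"
begin

definition P2 :: "'a::euclidean_space measure set" where
  "P2 = {\<mu>. prob_space \<mu> \<and> sets \<mu> = sets borel \<and> integrable \<mu> (\<lambda>x. (norm x)\<^sup>2)}"

definition couplings ::
  "'a::euclidean_space measure \<Rightarrow> 'a measure \<Rightarrow> ('a \<times> 'a) measure set" where
  "couplings \<mu> \<nu> = {\<gamma>. prob_space \<gamma> \<and> sets \<gamma> = sets borel \<and>
     distr \<gamma> borel fst = \<mu> \<and> distr \<gamma> borel snd = \<nu>}"

text \<open>On \<^const>\<open>P2\<close> the infimum is finite (the product coupling has finite cost), so
  \<^const>\<open>enn2real\<close> does not collapse an infinite value there.\<close>

definition W2 :: "'a::euclidean_space measure \<Rightarrow> 'a measure \<Rightarrow> real" where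
  "W2 \<mu> \<nu> = sqrt (enn2real
     (INF \<gamma>\<in>couplings \<mu> \<nu>. \<integral>\<^sup>+z. ennreal ((dist (fst z) (snd z))\<^sup>2) \<partial>\<gamma>))"

text \<open>The uniform probability measure on the unit sphere, as a Borel measure on the ambient space:
  the image of the uniform distribution on the unit ball under radial projection. The origin,
  which has no radial projection, is a null set. The lemmas below show that
  this is a probability measure carried by the sphere and invariant under orthogonal maps
  (the index type is well-ordered in the last one only because the library's
  \<open>measure_orthogonal_image\<close> needs it).\<close>

definition sphere_measure :: "'a::euclidean_space measure" where
  "sphere_measure = distr (uniform_measure lborel (ball 0 1)) borel (\<lambda>x. x /\<^sub>R norm x)"

definition proj_measure :: "'a::euclidean_space \<Rightarrow> 'a measure \<Rightarrow> real measure" where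
  "proj_measure \<theta> \<mu> = distr \<mu> borel (\<lambda>x. \<theta> \<bullet> x)"

definition SW2 :: "'a::euclidean_space measure \<Rightarrow> 'a measure \<Rightarrow> real" where
  "SW2 \<mu> \<nu> = sqrt (LINT \<theta>|sphere_measure. (W2 (proj_measure \<theta> \<mu>) (proj_measure \<theta> \<nu>))\<^sup>2)"

text \<open>Only arguments in \<open>{0<..<1}\<close> are meaningful for the quantile function; at \<open>0\<close> and \<open>1\<close>
  the infimum need not exist as a real number. In \<open>monotone_map \<mu> \<nu>\<close> this concerns
  only a \<open>\<mu>\<close>-null set when \<open>\<mu>\<close> has no atoms.\<close>

definition quantile :: "real measure \<Rightarrow> real \<Rightarrow> real" where
  "quantile \<mu> z = Inf {s. z \<le> cdf \<mu> s}"

definition monotone_map :: "real measure \<Rightarrow> real measure \<Rightarrow> real \<Rightarrow> real" where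
  "monotone_map \<mu> \<nu> = quantile \<nu> \<circ> cdf \<mu>"

definition sliced_discrepancy ::
  "'a::euclidean_space measure \<Rightarrow> 'a measure \<Rightarrow> 'a \<Rightarrow> 'a" where
  "sliced_discrepancy \<mu> \<nu> x = (LINT \<theta>|sphere_measure.
     (\<theta> \<bullet> x - monotone_map (proj_measure \<theta> \<mu>) (proj_measure \<theta> \<nu>) (\<theta> \<bullet> x)) *\<^sub>R \<theta>)"

definition narrowly_continuous_on ::
  "'t::topological_space set \<Rightarrow> ('t \<Rightarrow> 'a::topological_space measure) \<Rightarrow> bool" where
  "narrowly_continuous_on I \<mu> \<longleftrightarrow>
     (\<forall>f::'a \<Rightarrow> real. continuous_on UNIV f \<longrightarrow> bounded (range f) \<longrightarrow>
        continuous_on I (\<lambda>t. LINT x|\<mu> t. f x))"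

primrec C_k :: "nat \<Rightarrow> ('a::real_normed_vector \<Rightarrow> real) \<Rightarrow> bool" where
  "C_k 0 f \<longleftrightarrow> continuous_on UNIV f"
| "C_k (Suc k) f \<longleftrightarrow> (\<forall>x. f differentiable (at x)) \<and>
     (\<forall>h. C_k k (\<lambda>x. frechet_derivative f (at x) h))"

text \<open>Smooth compactly supported functions on an open set \<open>U\<close>, represented by their extension by
  zero to the whole space.\<close>

definition test_functions :: "'a::real_normed_vector set \<Rightarrow> ('a \<Rightarrow> real) set" where
  "test_functions U = {\<zeta>. (\<forall>k. C_k k \<zeta>) \<and>
     compact (closure {z. \<zeta> z \<noteq> 0}) \<and> closure {z. \<zeta> z \<noteq> 0} \<subseteq> U}"

definition gradient :: "('a::euclidean_space \<Rightarrow> real) \<Rightarrow> 'a \<Rightarrow> 'a" where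
  "gradient f x = (\<Sum>b\<in>Basis. frechet_derivative f (at x) b *\<^sub>R b)"

definition weak_continuity_equation ::
  "(real \<Rightarrow> 'a::euclidean_space \<Rightarrow> real) \<Rightarrow> (real \<Rightarrow> 'a \<Rightarrow> 'a) \<Rightarrow> bool" where
  "weak_continuity_equation p v \<longleftrightarrow> (\<forall>\<zeta>\<in>test_functions ({0<..<1} \<times> UNIV).
     (LINT t:{0<..<1}|lborel. (LINT x|lborel.
        (deriv (\<lambda>s. \<zeta> (s, x)) t + gradient (\<lambda>y. \<zeta> (t, y)) x \<bullet> v t x) * p t x)) = 0)"

definition abs_continuous_on :: "real set \<Rightarrow> (real \<Rightarrow> real) \<Rightarrow> bool" where
  "abs_continuous_on I f \<longleftrightarrow> (\<forall>\<epsilon>>0. \<exists>\<delta>>0. \<forall>D.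
     finite D \<and> (\<forall>(a,b)\<in>D. a \<le> b \<and> {a..b} \<subseteq> I) \<and>
     pairwise (\<lambda>(a,b) (c,d). {a<..<b} \<inter> {c<..<d} = {}) D \<and>
     (\<Sum>(a,b)\<in>D. b - a) < \<delta> \<longrightarrow> (\<Sum>(a,b)\<in>D. \<bar>f b - f a\<bar>) < \<epsilon>)"

definition locally_abs_continuous_on :: "real set \<Rightarrow> (real \<Rightarrow> real) \<Rightarrow> bool" where
  "locally_abs_continuous_on I f \<longleftrightarrow> (\<forall>a b. {a..b} \<subseteq> I \<longrightarrow> abs_continuous_on {a..b} f)"

lemma prob_space_uniform_ball:
  "prob_space (uniform_measure lborel (ball 0 1 :: 'a::euclidean_space set))"
proof (rule prob_space_uniform_measure)
  show "emeasure lborel (ball 0 1 :: 'a set) \<noteq> 0"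
    using content_ball_pos[of 1 "0::'a"] by (auto simp: measure_def)
  show "emeasure lborel (ball 0 1 :: 'a set) \<noteq> \<infinity>"
    using emeasure_lborel_ball_finite[of "0::'a" 1] by (simp add: less_top)
qed

lemma prob_space_sphere_measure: "prob_space (sphere_measure :: 'a::euclidean_space measure)"
  unfolding sphere_measure_def
  by (rule prob_space.prob_space_distr[OF prob_space_uniform_ball]) simp

lemma AE_sphere_measure: "AE \<theta> in (sphere_measure :: 'a::euclidean_space measure). \<theta> \<in> sphere 0 1"
proof -
  have "AE x in lborel. x \<noteq> (0::'a)"
    by (rule AE_lborel_singleton)
  then have "AE x in uniform_measure lborel (ball (0::'a) 1). x /\<^sub>R norm x \<in> sphere 0 1"
    by (intro AE_uniform_measureI) auto
  then show ?thesis
    unfolding sphere_measure_def by (subst AE_distr_iff) auto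
qed

lemma sphere_measure_orthogonal_invariant:
  fixes T :: "real^'n::{finite,wellorder} \<Rightarrow> real^'n::_"
  assumes T: "orthogonal_transformation T"
  shows "distr sphere_measure borel T = sphere_measure"
proof (rule measure_eqI)
  have lin: "linear T" and nrm: "\<And>x. norm (T x) = norm x" and surj: "surj T" and inj: "inj T"
    using T orthogonal_transformation_linear orthogonal_transformation_norm
      orthogonal_transformation_surj orthogonal_transformation_inj by blast+
  have [measurable]: "T \<in> borel_measurable borel"
    using lin linear_continuous_on[of T UNIV] by (intro borel_measurable_continuous_onI)
      (simp add: linear_conv_bounded_linear)
  show "sets (distr sphere_measure borel T) = sets (sphere_measure :: (real^'n::_) measure)"
    by (simp add: sphere_measure_def)
  fix A assume "A \<in> sets (distr sphere_measure borel T)"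
  then have [measurable]: "A \<in> sets borel" by simp
  define C where "C B = {x \<in> ball 0 1. x /\<^sub>R norm x \<in> B}" for B :: "(real^'n::_) set"
  have C_sets [measurable]: "C B \<in> sets borel" if [measurable]: "B \<in> sets borel" for B
    unfolding C_def by measurable
  have C_lm: "C B \<in> lmeasurable" if "B \<in> sets borel" for B
  proof (rule bounded_set_imp_lmeasurable)
    show "bounded (C B)" by (rule bounded_subset[OF bounded_ball[of 0 1]]) (auto simp: C_def)
    show "C B \<in> sets lebesgue" using C_sets[OF that] by (simp add: sets_completionI_sets)
  qed
  have eq: "emeasure sphere_measure B = emeasure lborel (C B) / emeasure lborel (ball 0 1 :: (real^'n::_) set)"
    if [measurable]: "B \<in> sets borel" for B
  proof -
    have "emeasure sphere_measure B =
        emeasure (uniform_measure lborel (ball 0 1)) ((\<lambda>x. x /\<^sub>R norm x) -` B)"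
      unfolding sphere_measure_def by (subst emeasure_distr) auto
    also have "\<dots> = emeasure lborel (ball 0 1 \<inter> ((\<lambda>x. x /\<^sub>R norm x) -` B))
        / emeasure lborel (ball 0 1 :: (real^'n::_) set)"
      by (rule emeasure_uniform_measure)
        (use measurable_sets[of "\<lambda>x::real^'n::_. x /\<^sub>R norm x" borel borel B] in auto)
    finally show ?thesis by (simp add: C_def vimage_def Int_def)
  qed
  have pre [measurable]: "T -` A \<in> sets borel"
    using measurable_sets[of T borel borel A] by simp
  have img: "T ` C (T -` A) = C A"
  proof (intro set_eqI iffI)
    fix y assume "y \<in> T ` C (T -` A)"
    then show "y \<in> C A" using lin nrm by (auto simp: C_def linear_scale)
  next
    fix y assume y: "y \<in> C A"
    obtain x where x: "y = T x" using surj by (metis surjD)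
    then show "y \<in> T ` C (T -` A)" using y lin nrm by (auto simp: C_def linear_scale)
  qed
  have "measure lebesgue (C A) = measure lebesgue (C (T -` A))"
    using measure_orthogonal_image[OF T C_lm[OF pre]] img by simp
  moreover have "emeasure lborel (C B) = ennreal (measure lebesgue (C B))"
    if "B \<in> sets borel" for B
  proof -
    have "emeasure lborel (C B) = emeasure lebesgue (C B)"
      using C_sets[OF that] by (simp add: emeasure_completion)
    also have "\<dots> = ennreal (measure lebesgue (C B))"
      using C_lm[OF that] by (intro emeasure_eq_measure2) simp
    finally show ?thesis .
  qed
  ultimately have "emeasure lborel (C A) = emeasure lborel (C (T -` A))"
    using pre by simp
  moreover have "emeasure (distr sphere_measure borel T) A = emeasure sphere_measure (T -` A)"
    by (subst emeasure_distr) (auto simp: sphere_measure_def)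
  ultimately show "emeasure (distr sphere_measure borel T) A = emeasure sphere_measure A"
    by (simp add: eq)
qed

end

theory Submission
  imports Defs
begin

text \<open>Project onto a direction \<open>\<theta>\<close> and write \<open>Y\<close> for \<open>\<theta> \<bullet> x\<close> under \<open>\<rho>\<^sub>t\<close>. Up to second moments,
  \<open>W\<^sub>2\<^sup>2\<close> of the projections is \<open>-2 E[Y Z]\<close> for the monotone coupling with the target \<open>Z\<close>, and by slicing
  \<open>Z\<close> into levels \<open>E[Y Z]\<close> is an integral over \<open>z\<close> of the tail expectations \<open>E[Y; F\<^sub>t(Y) > \<beta>]\<close> with
  \<open>\<beta> = G(z)\<close>. Such a tail expectation is the minimum over \<open>c\<close> of \<open>E(Y - c)\<^sup>+ + c (1 - \<beta>)\<close>, so its increment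
  between two times is squeezed between the fluxes of the hinge functions that are optimal at either
  end point; refining a partition of the time interval turns both bounds into the integral of
  \<open>E[\<theta> \<bullet> v; F\<^sub>\<tau>(Y) > \<beta>]\<close>. Fubini over the levels \<open>z\<close> and the directions \<open>\<theta>\<close> then gives the increment of
  \<open>SW\<^sub>2\<^sup>2\<close> as a time integral, with no regularity of the transport maps in time needed, and
  Lebesgue differentiation gives the derivative.\<close>

section \<open>Smooth functions and cut-offs\<close>

text \<open>The equation is tested only against smooth functions of compact support, while the
  squares and hinges of the argument grow at infinity, and no bound on second moments uniform in
  time is assumed. The energy supplies one, through truncated squares; cut-offs and dominated
  convergence then admit every test function of quadratic growth. The two bounds of the squeeze meet
  because absolute continuity leaves the projections without atoms: \<open>F_\<tau>(y)\<close> is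
  then continuous in \<open>\<tau>\<close>, and the set where \<open>F_\<tau>(Y) = \<beta>\<close>
  is null. Off that set an indicator frozen at a nearby time already has the right value, so the
  limit is plain dominated convergence. Absolute continuity of the distance itself is a separate
  matter, since the square root is not Lipschitz at 0. An increment of the square is bounded by the
  largest distance times a flux, and Young's inequality with a free parameter \<open>\<eta>\<close>
  keeps the bound additive in the length and the energy of the interval, as a sum over disjoint
  intervals demands.\<close>

lemma C_k_Suc_imp: "C_k (Suc k) f \<Longrightarrow> C_k k f"
proof (induction k arbitrary: f)
  case 0
  then have "continuous (at x) f" for x
    by (auto intro: differentiable_imp_continuous_within)
  then show ?case by (simp add: continuous_on_eq_continuous_at)
next
  case (Suc k)
  then show ?case by (metis C_k.simps(2))
qed

text \<open>Derivatives are unique, so any explicit formula may stand in for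
  \<open>frechet_derivative\<close>. This rule and its converse below let the closure proofs be
  inductions on the order that use the ordinary product and chain rules.\<close>

lemma C_k_SucI:
  assumes "\<And>x. (f has_derivative D x) (at x)" "\<And>h. C_k k (\<lambda>x. D x h)"
  shows "C_k (Suc k) f"
proof -
  have "frechet_derivative f (at x) = D x" for x
    using frechet_derivative_at[OF assms(1)] by simp
  then show ?thesis using assms unfolding C_k.simps differentiable_def by auto
qed

lemma C_k_SucE:
  assumes "C_k (Suc k) f"
  obtains D where "\<And>x. (f has_derivative D x) (at x)" "\<And>h. C_k k (\<lambda>x. D x h)"
  using assms frechet_derivative_works by (fastforce simp: C_k.simps)

lemma C_k_const: "C_k k (\<lambda>x. c)"
proof (induction k arbitrary: c)
  case (Suc k)
  show ?case by (rule C_k_SucI[where D="\<lambda>x h. 0"]) (auto intro: Suc)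
qed simp

lemma C_k_linear: "bounded_linear f \<Longrightarrow> C_k k f"
proof (cases k)
  case (Suc l)
  assume "bounded_linear f"
  then show ?thesis unfolding Suc
    by (intro C_k_SucI[where D="\<lambda>x. f"]) (auto intro: bounded_linear.has_derivative C_k_const
       bounded_linear_imp_has_derivative)
qed (auto intro: linear_continuous_on)

lemma C_k_add: "C_k k f \<Longrightarrow> C_k k g \<Longrightarrow> C_k k (\<lambda>x. f x + g x)"
proof (induction k arbitrary: f g)
  case (Suc k)
  obtain D where D: "\<And>x. (f has_derivative D x) (at x)" "\<And>h. C_k k (\<lambda>x. D x h)"
    using Suc.prems(1) by (rule C_k_SucE) (rule that)
  obtain D' where D': "\<And>x. (g has_derivative D' x) (at x)" "\<And>h. C_k k (\<lambda>x. D' x h)"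
    using Suc.prems(2) by (rule C_k_SucE) (rule that)
  show ?case
    by (rule C_k_SucI[OF has_derivative_add[OF D(1) D'(1)]]) (intro Suc.IH D D')
qed (auto intro: continuous_intros)

text \<open>Leibniz's rule pairs each derivative with an undifferentiated factor; that factor has
  one order more than the induction hypothesis asks for, hence \<open>C_k_Suc_imp\<close>.\<close>

lemma C_k_mult: "C_k k f \<Longrightarrow> C_k k g \<Longrightarrow> C_k k (\<lambda>x. f x * g x)"
proof (induction k arbitrary: f g)
  case (Suc k)
  obtain D where D: "\<And>x. (f has_derivative D x) (at x)" "\<And>h. C_k k (\<lambda>x. D x h)"
    using Suc.prems(1) by (rule C_k_SucE) (rule that)
  obtain D' where D': "\<And>x. (g has_derivative D' x) (at x)" "\<And>h. C_k k (\<lambda>x. D' x h)"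
    using Suc.prems(2) by (rule C_k_SucE) (rule that)
  show ?case
    by (rule C_k_SucI[OF has_derivative_mult[OF D(1) D'(1)]])
      (intro C_k_add Suc.IH D D' C_k_Suc_imp[OF Suc.prems(1)] C_k_Suc_imp[OF Suc.prems(2)])
qed (auto intro: continuous_intros)

text \<open>With a real outer function the chain rule is a product of scalars: a derivative on the
  line is multiplication by \<open>D' y 1\<close>. The factor \<open>D' (f x) 1\<close> is again a
  composite and falls under the induction hypothesis.\<close>

lemma C_k_compose:
  fixes g :: "real \<Rightarrow> real"
  shows "C_k k g \<Longrightarrow> C_k k f \<Longrightarrow> C_k k (\<lambda>x. g (f x))"
proof (induction k arbitrary: f g)
  case 0
  then show ?case by (auto intro: continuous_on_compose2[of UNIV g])
next
  case (Suc k)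
  obtain D where D: "\<And>x. (f has_derivative D x) (at x)" "\<And>h. C_k k (\<lambda>x. D x h)"
    using Suc.prems(2) by (rule C_k_SucE) (rule that)
  obtain D' where D': "\<And>x. (g has_derivative D' x) (at x)" "\<And>h. C_k k (\<lambda>x. D' x h)"
    using Suc.prems(1) by (rule C_k_SucE) (rule that)
  have lin: "D' y h = D' y 1 * h" for y h
  proof -
    have "D' y (h *\<^sub>R 1) = h *\<^sub>R D' y 1"
      by (rule linear_scale[OF has_derivative_linear[OF D'(1)]])
    then show ?thesis by (simp add: mult.commute)
  qed
  have der: "((\<lambda>x. g (f x)) has_derivative (\<lambda>h. D' (f x) 1 * D x h)) (at x)" for x
    using has_derivative_compose[OF D(1) D'(1), of x] by (simp add: lin[of _ "D _ _"])
  show ?case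
    by (rule C_k_SucI[OF der])
      (intro C_k_mult D(2) Suc.IH[OF D'(2)] C_k_Suc_imp[OF Suc.prems(2)])
qed

lemma C_k_compose_linear:
  "C_k k g \<Longrightarrow> bounded_linear f \<Longrightarrow> C_k k (\<lambda>x. g (f x))"
proof (induction k arbitrary: g)
  case 0
  then show ?case by (auto intro: continuous_on_compose2[of UNIV g] linear_continuous_on)
next
  case (Suc k)
  obtain D where D: "\<And>x. (g has_derivative D x) (at x)" "\<And>h. C_k k (\<lambda>x. D x h)"
    using Suc.prems(1) by (rule C_k_SucE) (rule that)
  have "((\<lambda>x. g (f x)) has_derivative (\<lambda>h. D (f x) (f h))) (at x)" for x
    by (rule has_derivative_compose[OF bounded_linear_imp_has_derivative[OF Suc.prems(2)] D(1)])
  then show ?case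
    by (rule C_k_SucI) (intro Suc.IH[OF D(2)] Suc.prems(2))
qed

lemma C_k_Suc_real:
  assumes "\<And>x::real. (f has_real_derivative f' x) (at x)" "C_k k f'"
  shows "C_k (Suc k) f"
  by (rule C_k_SucI[where D="\<lambda>x h. f' x * h"])
    (use assms in \<open>auto simp: has_field_derivative_def intro: C_k_mult C_k_const\<close>)

definition smooth :: "('a::real_normed_vector \<Rightarrow> real) \<Rightarrow> bool" where
  "smooth f \<longleftrightarrow> (\<forall>k. C_k k f)"

lemma smooth_const [intro, simp]: "smooth (\<lambda>x. c)"
  and smooth_linear: "bounded_linear f \<Longrightarrow> smooth f"
  and smooth_add [intro]: "smooth f \<Longrightarrow> smooth g \<Longrightarrow> smooth (\<lambda>x. f x + g x)"
  and smooth_mult [intro]: "smooth f \<Longrightarrow> smooth g \<Longrightarrow> smooth (\<lambda>x. f x * g x)"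
  and smooth_compose: "smooth h \<Longrightarrow> smooth f \<Longrightarrow> smooth (\<lambda>x. h (f x))"
  and smooth_compose_linear: "smooth f' \<Longrightarrow> bounded_linear l \<Longrightarrow> smooth (\<lambda>x. f' (l x))"
  for f g :: "'a::real_normed_vector \<Rightarrow> real"
    and f' :: "'b::real_normed_vector \<Rightarrow> real" and h :: "real \<Rightarrow> real"
  unfolding smooth_def
  by (simp_all del: C_k.simps add: C_k_const C_k_linear C_k_add C_k_mult C_k_compose C_k_compose_linear)

lemma smooth_diff [intro]:
  assumes "smooth f" "smooth g" shows "smooth (\<lambda>x. f x - g x)"
  using smooth_add[OF assms(1) smooth_mult[OF smooth_const[of "-1"] assms(2)]] by simp

lemma smooth_id [intro, simp]: "smooth (\<lambda>x::real. x)"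
  by (rule smooth_linear) (rule bounded_linear_ident)

lemma smooth_inner [intro, simp]: "smooth (\<lambda>x. a \<bullet> x)"
  by (rule smooth_linear) (rule bounded_linear_inner_right)

lemma smooth_sum [intro]:
  assumes "\<And>i. i \<in> I \<Longrightarrow> smooth (f i)" shows "smooth (\<lambda>x. \<Sum>i\<in>I. f i x)"
  using assms by (induction I rule: infinite_finite_induct) auto

lemma smooth_norm_sq [intro, simp]: "smooth (\<lambda>x::'a::euclidean_space. (norm x)\<^sup>2)"
proof -
  have "(\<lambda>x::'a. (norm x)\<^sup>2) = (\<lambda>x. \<Sum>b\<in>Basis. (b \<bullet> x) * (b \<bullet> x))"
    unfolding power2_norm_eq_inner by (subst euclidean_inner) (auto simp: inner_commute)
  then show ?thesis by (simp only:) (intro smooth_sum smooth_mult smooth_inner)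
qed

lemma smooth_antideriv:
  assumes "\<And>x::real. (f has_real_derivative f' x) (at x)" "smooth f'"
  shows "smooth f"
  unfolding smooth_def
proof
  fix k show "C_k k f"
    by (rule C_k_Suc_imp, rule C_k_Suc_real[OF assms(1)]) (use assms(2) in \<open>auto simp: smooth_def\<close>)
qed

lemma smooth_imp_continuous: "smooth f \<Longrightarrow> continuous_on A f"
  unfolding smooth_def by (metis C_k.simps(1) continuous_on_subset subset_UNIV)

text \<open>The partial derivatives are the coordinates of the gradient. A continuous representative
  is what later yields measurability and local boundedness of a \<open>G\<close> that is known only
  through \<open>has_derivative\<close>.\<close>

lemma smooth_gradientE:
  fixes f :: "'a::euclidean_space \<Rightarrow> real"
  assumes "smooth f"
  obtains G where "\<And>x. (f has_derivative (\<lambda>h. G x \<bullet> h)) (at x)" "continuous_on UNIV G"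
proof -
  have "C_k (Suc 0) f" using assms by (simp add: smooth_def del: C_k.simps)
  then obtain D where D: "\<And>x. (f has_derivative D x) (at x)" "\<And>h. C_k 0 (\<lambda>x. D x h)"
    by (rule C_k_SucE) (rule that)
  define G where "G x = (\<Sum>b\<in>Basis. D x b *\<^sub>R b)" for x
  have "D x h = G x \<bullet> h" for x h
  proof -
    have "D x h = D x (\<Sum>b\<in>Basis. (h \<bullet> b) *\<^sub>R b)" by (simp add: euclidean_representation)
    also have "\<dots> = (\<Sum>b\<in>Basis. (h \<bullet> b) * D x b)"
      using has_derivative_linear[OF D(1)] by (simp add: linear_sum linear_scale)
    finally show ?thesis
      by (simp add: G_def inner_sum_left inner_commute[of h] mult.commute)
  qed
  then have "D = (\<lambda>x h. G x \<bullet> h)" by blast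
  moreover have "continuous_on UNIV G"
    unfolding G_def using D(2) by (auto intro!: continuous_intros)
  ultimately show ?thesis using D(1) that by blast
qed

section \<open>A smooth step function\<close>

text \<open>The functions with varying \<open>m\<close> are closed under differentiation up to
  linear combinations, which \<open>exp (- 1 / t)\<close> alone is not. Carrying the power turns
  smoothness into an induction over all \<open>m\<close> at once.\<close>

definition flat_exp :: "nat \<Rightarrow> real \<Rightarrow> real" where
  "flat_exp m t = (if 0 < t then (1 / t) ^ m * exp (- 1 / t) else 0)"

lemma flat_exp_tendsto_0: "(flat_exp m \<longlongrightarrow> 0) (at 0)"
proof -
  have "((\<lambda>t::real. (1 / t) ^ m * exp (- 1 / t)) \<longlongrightarrow> 0) (at_right 0)"
  proof -
    have "((\<lambda>x::real. x ^ m / exp x) \<longlongrightarrow> 0) at_top"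
      by (rule tendsto_power_div_exp_0)
    then have "((\<lambda>t::real. (inverse t) ^ m / exp (inverse t)) \<longlongrightarrow> 0) (at_right 0)"
      by (rule filterlim_compose) (rule filterlim_inverse_at_top_right)
    then show ?thesis by (simp add: exp_minus field_simps)
  qed
  then have "(flat_exp m \<longlongrightarrow> 0) (at_right 0)"
    by (rule Lim_transform_eventually) (auto simp: flat_exp_def eventually_at_filter)
  moreover have "(flat_exp m \<longlongrightarrow> 0) (at_left 0)"
    by (rule tendsto_eventually) (auto simp: flat_exp_def eventually_at_filter)
  ultimately show ?thesis by (simp add: filterlim_at_split)
qed

lemma flat_exp_deriv:
  "(flat_exp m has_real_derivative (flat_exp (Suc (Suc m)) t - real m * flat_exp (Suc m) t)) (at t)"
proof -
  consider "t > 0" | "t < 0" | "t = 0" by linarith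
  then show ?thesis
  proof cases
    case 1
    define i where "i = inverse t"
    have di: "(inverse has_real_derivative - (i * i)) (at t)"
      using DERIV_inverse[of t UNIV] 1 by (simp add: i_def numeral_2_eq_2)
    have dp: "((\<lambda>t. inverse t ^ m) has_real_derivative - (real m * i ^ Suc m)) (at t)"
      using DERIV_power[OF di, of m] by (cases m) (simp_all add: i_def algebra_simps)
    have "((\<lambda>t. exp (- inverse t)) has_real_derivative (exp (- i) * (i * i))) (at t)"
      using DERIV_chain2[OF DERIV_exp DERIV_minus[OF di]] by (simp add: i_def)
    from DERIV_mult[OF dp this]
    have "((\<lambda>t. (1 / t) ^ m * exp (- 1 / t)) has_real_derivative
        (flat_exp (Suc (Suc m)) t - real m * flat_exp (Suc m) t)) (at t)"
      using 1 by (simp add: flat_exp_def i_def inverse_eq_divide algebra_simps)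
    then show ?thesis
      by (rule has_field_derivative_transform_within_open[where S="{0<..}"])
        (use 1 in \<open>auto simp: flat_exp_def\<close>)
  next
    case 2
    have "((\<lambda>t::real. 0) has_real_derivative
        (flat_exp (Suc (Suc m)) t - real m * flat_exp (Suc m) t)) (at t)"
      using 2 by (auto simp: flat_exp_def)
    then show ?thesis
      by (rule has_field_derivative_transform_within_open[where S="{..<0}"])
        (use 2 in \<open>auto simp: flat_exp_def\<close>)
  next
    case 3
    \<comment> \<open>At the origin the difference quotient of \<open>flat_exp m\<close> is
      \<open>flat_exp (Suc m)\<close>, which tends to 0.\<close>
    have "((\<lambda>h. (flat_exp m (0 + h) - flat_exp m 0) / h) \<longlongrightarrow> 0) (at 0)"
      by (rule Lim_transform_eventually[OF flat_exp_tendsto_0[of "Suc m"]])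
        (auto simp: flat_exp_def eventually_at_filter)
    then show ?thesis using 3 by (simp add: DERIV_def flat_exp_def)
  qed
qed

lemma smooth_flat_exp: "smooth (flat_exp m)"
proof -
  have "\<forall>m. C_k k (flat_exp m)" for k
  proof (induction k)
    case 0
    have "isCont (flat_exp m) t" for m t by (rule DERIV_isCont[OF flat_exp_deriv])
    then show ?case by (auto intro!: continuous_at_imp_continuous_on)
  next
    case (Suc k)
    have "C_k k (\<lambda>t. flat_exp (Suc (Suc m)) t + (- real m) * flat_exp (Suc m) t)" for m
      by (intro C_k_add C_k_mult C_k_const) (use Suc in auto)
    then show ?case by (auto intro!: C_k_Suc_real[OF flat_exp_deriv] simp del: C_k.simps)
  qed
  then show ?thesis by (auto simp: smooth_def)
qed

text \<open>A chosen primitive, normalised at 0. What is built from it is estimated through its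
  derivative, by monotonicity or the mean value theorem, so that no integral over an oriented
  interval has to be evaluated.\<close>

definition antideriv :: "(real \<Rightarrow> real) \<Rightarrow> real \<Rightarrow> real" where
  "antideriv g = (SOME P. P 0 = 0 \<and> (\<forall>x. (P has_real_derivative g x) (at x)))"

lemma antideriv:
  assumes "continuous_on UNIV g"
  shows antideriv_0: "antideriv g 0 = 0"
    and antideriv_deriv: "(antideriv g has_real_derivative g x) (at x)"
proof -
  obtain P where P: "\<And>x. (P has_vector_derivative g x) (at x)"
    using einterval_antiderivative[of "-\<infinity>" \<infinity> g] assms by (auto simp: continuous_on_eq_continuous_at)
  have "\<exists>P. P 0 = 0 \<and> (\<forall>x. (P has_real_derivative g x) (at x))"
    using P by (intro exI[of _ "\<lambda>x. P x - P 0"])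
      (auto intro!: derivative_eq_intros simp: has_real_derivative_iff_has_vector_derivative)
  from someI_ex[OF this] show "antideriv g 0 = 0" "(antideriv g has_real_derivative g x) (at x)"
    unfolding antideriv_def by blast+
qed

definition bump :: "real \<Rightarrow> real" where "bump t = flat_exp 0 t * flat_exp 0 (1 - t)"

lemma smooth_bump: "smooth bump"
  unfolding bump_def[abs_def]
  by (rule smooth_mult[OF smooth_flat_exp smooth_compose[OF smooth_flat_exp
        smooth_diff[OF smooth_const smooth_id]]])

lemma continuous_bump: "continuous_on A bump"
  by (rule smooth_imp_continuous[OF smooth_bump])

lemma bump_nonneg: "0 \<le> bump t"
  and bump_pos: "0 < t \<Longrightarrow> t < 1 \<Longrightarrow> 0 < bump t"
  and bump_eq_0: "t \<le> 0 \<or> 1 \<le> t \<Longrightarrow> bump t = 0"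
  by (auto simp: bump_def flat_exp_def)

lemma antideriv_bump_pos: "0 < antideriv bump 1"
proof -
  have "antideriv bump 0 < antideriv bump 1"
  proof (rule DERIV_pos_imp_increasing_open[of 0 1 "antideriv bump"])
    show "\<exists>y. (antideriv bump has_real_derivative y) (at x) \<and> 0 < y" if "0 < x" "x < 1" for x :: real
      using antideriv_deriv[OF continuous_bump] bump_pos[OF that] by blast
    show "continuous_on {0..1} (antideriv bump)"
      by (rule DERIV_continuous_on[OF has_field_derivative_at_within[OF antideriv_deriv[OF continuous_bump]]])
  qed simp
  then show ?thesis by (simp add: antideriv_0 continuous_bump)
qed

text \<open>The normalised primitive of a bump on [0,1]: a smooth rise from 0 to 1, constant outside
  [0,1]. Rescaled it serves as a cut-off in time and in space, and its derivative as an approximate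
  identity.\<close>

definition sstep :: "real \<Rightarrow> real" where "sstep t = antideriv bump t / antideriv bump 1"
definition sstep' :: "real \<Rightarrow> real" where "sstep' t = bump t / antideriv bump 1"

lemma sstep_deriv: "(sstep has_real_derivative sstep' t) (at t)"
  unfolding sstep_def[abs_def] sstep'_def
  by (rule DERIV_cdivide) (rule antideriv_deriv[OF continuous_bump])

lemma smooth_sstep': "smooth sstep'"
proof -
  have "sstep' = (\<lambda>t. (1 / antideriv bump 1) * bump t)" by (auto simp: sstep'_def)
  then show ?thesis
    using smooth_mult[OF smooth_const smooth_bump, of "1 / antideriv bump 1"] by simp
qed

lemma smooth_sstep: "smooth sstep"
  by (rule smooth_antideriv[OF sstep_deriv smooth_sstep'])

lemma continuous_sstep: "continuous_on A sstep" and continuous_sstep': "continuous_on A sstep'"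
  by (auto intro: smooth_imp_continuous smooth_sstep smooth_sstep')

lemma sstep'_nonneg: "0 \<le> sstep' t"
  and sstep'_eq_0: "t \<le> 0 \<or> 1 \<le> t \<Longrightarrow> sstep' t = 0"
  using antideriv_bump_pos by (auto simp: sstep'_def bump_nonneg bump_eq_0)

lemma sstep_mono: "s \<le> t \<Longrightarrow> sstep s \<le> sstep t"
  by (rule DERIV_nonneg_imp_nondecreasing[of s t sstep]) (blast intro: sstep_deriv sstep'_nonneg)+

lemma sstep_eq_0: "t \<le> 0 \<Longrightarrow> sstep t = 0"
proof -
  assume t: "t \<le> 0"
  have "sstep 0 \<le> sstep t"
    by (rule DERIV_nonpos_imp_nonincreasing[OF t, of sstep], rule exI, rule conjI, rule sstep_deriv)
      (simp add: sstep'_eq_0)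
  moreover have "sstep 0 = 0" by (simp add: sstep_def antideriv_0 continuous_bump)
  ultimately show ?thesis using sstep_mono[OF t] by simp
qed

lemma sstep_eq_1: "1 \<le> t \<Longrightarrow> sstep t = 1"
proof -
  assume t: "1 \<le> t"
  have "sstep t \<le> sstep 1"
    by (rule DERIV_nonpos_imp_nonincreasing[OF t, of sstep], rule exI, rule conjI, rule sstep_deriv)
      (simp add: sstep'_eq_0)
  moreover have "sstep 1 = 1" using antideriv_bump_pos unfolding sstep_def by simp
  ultimately show ?thesis using sstep_mono[OF t] by simp
qed

lemma sstep_nonneg: "0 \<le> sstep t" and sstep_le_1: "sstep t \<le> 1"
  using sstep_mono[of "min 0 t" t] sstep_eq_0[of "min 0 t"]
    sstep_mono[of t "max 1 t"] sstep_eq_1[of "max 1 t"] by simp_all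

lemma sstep'_bounded: obtains C where "\<And>t. \<bar>sstep' t\<bar> \<le> C" "0 \<le> C"
proof -
  have "compact (sstep' ` {0..1})"
    by (intro compact_continuous_image continuous_sstep') auto
  then have "bounded (sstep' ` {0..1})" by (rule compact_imp_bounded)
  then obtain C where "\<forall>t\<in>{0..1}. \<bar>sstep' t\<bar> \<le> C"
    unfolding bounded_iff by auto
  then have C: "\<And>t. t \<in> {0..1} \<Longrightarrow> \<bar>sstep' t\<bar> \<le> C" by blast
  have "\<bar>sstep' t\<bar> \<le> C" for t
    using C[of t] C[of 0] sstep'_eq_0[of t] by (cases "t \<in> {0..1}") auto
  moreover from this have "0 \<le> C" using abs_ge_zero order_trans by blast
  ultimately show ?thesis using that by blast
qed

section \<open>Lebesgue differentiation\<close>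

text \<open>The proof has two halves: averages of \<open>f\<close> over \<open>[x, x + h]\<close>
  control the difference quotients to the right, and averages of the reflected function those to the
  left.\<close>

lemma AE_deriv_indefinite_integral:
  fixes f H :: "real \<Rightarrow> real"
  assumes f: "integrable lborel f"
    and H: "\<And>s t. a \<le> s \<Longrightarrow> s \<le> t \<Longrightarrow> t < b \<Longrightarrow>
      H t - H s = (LINT x|lborel. indicator {s<..t} x * f x)"
  shows "AE t in lborel. t \<in> {a<..<b} \<longrightarrow> (H has_real_derivative f t) (at t)"
proof -
  have int: "g integrable_on cbox c d" if "integrable lborel g" for g :: "real \<Rightarrow> real" and c d
    using integrable_on_lborel[OF that] by (rule integrable_on_subcbox) auto
  have g: "integrable lborel (\<lambda>x. f (- x))"
    using lborel_integrable_real_affine[OF f, of "-1" 0] by simp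
  obtain N1 where N1: "negligible N1" "\<And>x e. x \<notin> N1 \<Longrightarrow> 0 < e \<Longrightarrow>
      \<exists>d>0. \<forall>h. 0 < h \<and> h < d \<longrightarrow> norm (integral (cbox x (x + h *\<^sub>R One)) f /\<^sub>R h ^ DIM(real) - f x) < e"
    using integrable_ccontinuous_explicit[OF int[OF f]] by blast
  obtain N2 where N2: "negligible N2" "\<And>x e. x \<notin> N2 \<Longrightarrow> 0 < e \<Longrightarrow>
      \<exists>d>0. \<forall>h. 0 < h \<and> h < d \<longrightarrow>
        norm (integral (cbox x (x + h *\<^sub>R One)) (\<lambda>x. f (- x)) /\<^sub>R h ^ DIM(real) - f (- x)) < e"
    using integrable_ccontinuous_explicit[OF int[OF g]] by blast
  have H': "H t - H s = integral {s..t} f" if "a \<le> s" "s \<le> t" "t < b" for s t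
  proof -
    have "(LINT x|lborel. indicator {s<..t} x * f x) = (LINT x|lborel. indicator {s..t} x * f x)"
    proof (rule integral_cong_AE)
      show "AE x in lborel. indicator {s<..t} x * f x = indicator {s..t} x * f x"
        using AE_lborel_singleton[of s] by eventually_elim (auto simp: indicator_def)
    qed (use f in measurable)
    also have "\<dots> = integral {s..t} f"
      using set_borel_integral_eq_integral(2)[of "{s..t}" f] f
        integrable_mult_indicator[of "{s..t}" lborel f]
      by (simp add: set_lebesgue_integral_def set_integrable_def)
    finally show ?thesis using H[OF that] by simp
  qed
  have "(H has_real_derivative f t) (at t)" if t: "t \<in> {a<..<b}" "t \<notin> N1" "- t \<notin> N2" for t
    unfolding DERIV_def LIM_eq
  proof (intro allI impI)
    fix e :: real assume e: "0 < e"
    obtain d1 where d1: "d1 > 0" "\<And>h. 0 < h \<Longrightarrow> h < d1 \<Longrightarrow> \<bar>integral {t..t + h} f / h - f t\<bar> < e"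
      using N1(2)[OF t(2) e] by (auto simp: divide_inverse mult.commute)
    obtain d2 where d2: "d2 > 0" "\<And>h. 0 < h \<Longrightarrow> h < d2 \<Longrightarrow>
        \<bar>integral {- t..- t + h} (\<lambda>x. f (- x)) / h - f t\<bar> < e"
      using N2(2)[OF t(3) e] by (auto simp: divide_inverse mult.commute)
    define d where "d = Min {d1, d2, t - a, b - t}"
    have "\<bar>(H (t + h) - H t) / h - f t\<bar> < e" if h: "h \<noteq> 0" "\<bar>h\<bar> < d" for h
    proof (cases "h > 0")
      case True
      then show ?thesis using d1(2)[of h] H'[of t "t + h"] h t(1) by (simp add: d_def)
    next
      case False
      have "integral {- t..- t + - h} (\<lambda>x. f (- x)) = integral {t + h..t} f"
        using Henstock_Kurzweil_Integration.integral_reflect_real[of "t" "t + h" f] by (simp add: algebra_simps)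
      also have "\<dots> = H t - H (t + h)" using H'[of "t + h" t] h t(1) False by (simp add: d_def)
      finally have "\<bar>(H t - H (t + h)) / - h - f t\<bar> < e"
        using d2(2)[of "- h"] h False by (simp only: d_def) auto
      moreover have "(H t - H (t + h)) / - h = (H (t + h) - H t) / h"
        by (metis minus_diff_eq minus_divide_divide)
      ultimately show ?thesis by simp
    qed
    moreover have "d > 0" using d1(1) d2(1) t(1) by (simp add: d_def)
    ultimately show "\<exists>s>0. \<forall>h. h \<noteq> 0 \<and> norm (h - 0) < s \<longrightarrow> norm ((H (t + h) - H t) / h - f t) < e"
      by (intro exI[of _ d]) auto
  qed
  moreover have "AE t in lborel. t \<notin> N1 \<and> - t \<notin> N2"
  proof -
    have *: "AE t in lborel. t \<notin> N" if "negligible N" for N :: "real set"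
      using AE_not_in[of N lebesgue] that by (simp add: negligible_iff_null_sets AE_completion_iff)
    \<comment> \<open>The exceptional set for the left quotients is the mirror image of
      \<open>N2\<close>, null because Lebesgue measure is invariant under reflection.\<close>
    have "AE t in distr lborel borel uminus. t \<notin> N2"
      using *[OF N2(1)] by (simp only: lborel_distr_uminus)
    then have "AE t in lborel. - t \<notin> N2"
      by (rule AE_distrD[rotated]) simp
    with *[OF N1(1)] show ?thesis by eventually_elim simp
  qed
  ultimately show ?thesis by (auto elim: eventually_mono)
qed

section \<open>Optimal transport on the line\<close>

text \<open>Layer-cake kernel for numbers of either sign: the signed indicator of the interval
  between 0 and \<open>t\<close>, whose integral over \<open>z\<close> is \<open>t\<close>. The
  subtracted term does not depend on \<open>t\<close>; it makes the integral over \<open>z\<close>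
  converge.\<close>

definition level :: "real \<Rightarrow> real \<Rightarrow> real" where
  "level z t = (if z < t then 1 else 0) - (if z < 0 then 1 else 0)"

lemma measurable_level [measurable]:
  assumes [measurable]: "f \<in> borel_measurable M" "g \<in> borel_measurable M"
  shows "(\<lambda>x. level (f x) (g x)) \<in> borel_measurable M"
  unfolding level_def by measurable



lemma level_eq: "level z t = indicator {0..<t} z - indicator {t..<0} z"
  by (auto simp: level_def indicator_def)

lemma has_bochner_integral_level:
  "has_bochner_integral lborel (\<lambda>z. level z t) t"
  "has_bochner_integral lborel (\<lambda>z. \<bar>level z t\<bar>) \<bar>t\<bar>"
proof -
  have 1: "has_bochner_integral lborel (indicator {a..<b} :: real \<Rightarrow> real) (max 0 (b - a))" for a b :: real
    using has_bochner_integral_real_indicator[of "{a..<b}" lborel] by (cases "a \<le> b") (auto simp: max_def)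
  show "has_bochner_integral lborel (\<lambda>z. level z t) t"
    using has_bochner_integral_diff[OF 1[of 0 t] 1[of t 0]] by (simp add: level_eq max_def split: if_splits)
  have "\<bar>level z t\<bar> = indicator {0..<t} z + indicator {t..<0} z" for z
    by (auto simp: level_eq indicator_def)
  then show "has_bochner_integral lborel (\<lambda>z. \<bar>level z t\<bar>) \<bar>t\<bar>"
    using has_bochner_integral_add[OF 1[of 0 t] 1[of t 0]] by (simp add: max_def abs_if split: if_splits)
qed

text \<open>Fubini's theorem applies because \<open>\<bar>level z t\<bar>\<close> integrates over
  \<open>z\<close> to \<open>\<bar>t\<bar>\<close>, so that the absolute integral over the product
  is that of \<open>w x * Z x\<close>.\<close>

lemma layer_cake:
  fixes w Z :: "'a \<Rightarrow> real"
  assumes M: "sigma_finite_measure M"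
    and [measurable]: "w \<in> borel_measurable M" "Z \<in> borel_measurable M"
    and wZ: "integrable M (\<lambda>x. w x * Z x)"
  shows "integrable lborel (\<lambda>z. LINT x|M. w x * level z (Z x))"
    and "(LINT z|lborel. LINT x|M. w x * level z (Z x)) = (LINT x|M. w x * Z x)"
proof -
  interpret M: sigma_finite_measure M by fact
  interpret P: pair_sigma_finite M lborel ..
  have i: "integrable lborel (\<lambda>z. level z t)" "(LINT z|lborel. level z t) = t"
    "integrable lborel (\<lambda>z. \<bar>level z t\<bar>)" "(LINT z|lborel. \<bar>level z t\<bar>) = \<bar>t\<bar>" for t
    using has_bochner_integral_level[of t] by (simp_all add: has_bochner_integral_iff)
  have int: "integrable (M \<Otimes>\<^sub>M lborel) (\<lambda>(x, z). w x * level z (Z x))"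
  proof (rule P.Fubini_integrable)
    show "integrable M (\<lambda>x. LINT z|lborel. norm (case (x, z) of (x, z) \<Rightarrow> w x * level z (Z x)))"
      using integrable_abs[OF wZ] by (simp add: abs_mult i)
    show "AE x in M. integrable lborel (\<lambda>z. case (x, z) of (x, z) \<Rightarrow> w x * level z (Z x))"
      by (simp add: i)
  qed simp
  show "integrable lborel (\<lambda>z. LINT x|M. w x * level z (Z x))"
    using P.integrable_snd[OF int] by simp
  show "(LINT z|lborel. LINT x|M. w x * level z (Z x)) = (LINT x|M. w x * Z x)"
    using P.Fubini_integral[OF int] by (simp add: i)
qed

section \<open>Quantile functions\<close>

text \<open>Positivity of \<open>p\<close> bounds the defining set below and the point
  \<open>x\<close> makes it nonempty, so the infimum is genuine; right continuity of the
  distribution function makes it a member of the set.\<close>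

lemma quantile_le_iff:
  assumes "real_distribution \<nu>" "0 < p" "p \<le> cdf \<nu> x"
  shows "quantile \<nu> p \<le> s \<longleftrightarrow> p \<le> cdf \<nu> s"
proof -
  interpret real_distribution \<nu> by fact
  let ?S = "{s. p \<le> cdf \<nu> s}"
  have "eventually (\<lambda>y. cdf \<nu> y < p) at_bot"
    using order_tendstoD(2)[OF cdf_lim_at_bot assms(2)] .
  then obtain y where y: "cdf \<nu> y < p" by (auto simp: eventually_at_bot_linorder)
  have bdd: "bdd_below ?S"
  proof (rule bdd_belowI[of _ y])
    show "y \<le> x" if "x \<in> ?S" for x
      using that y cdf_nondecreasing[of x y] by (cases "y \<le> x") auto
  qed
  have ne: "?S \<noteq> {}" using assms(3) by auto
  have above: "p \<le> cdf \<nu> y" if y: "Inf ?S < y" for y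
  proof -
    obtain s' where "s' \<in> ?S" "s' < y" using cInf_lessD[OF ne y] by blast
    then show ?thesis using cdf_nondecreasing[of s' y] by simp
  qed
  have "p \<le> cdf \<nu> (Inf ?S)"
  proof (rule tendsto_lowerbound)
    show "(cdf \<nu> \<longlongrightarrow> cdf \<nu> (Inf ?S)) (at_right (Inf ?S))"
      using cdf_is_right_cont by (simp add: continuous_within)
    show "\<forall>\<^sub>F y in at_right (Inf ?S). p \<le> cdf \<nu> y"
      using above by (auto simp: eventually_at_filter)
  qed simp
  then show ?thesis
    unfolding quantile_def using cInf_lower[OF _ bdd, of s] cdf_nondecreasing[of "Inf ?S" s]
    by auto
qed

text \<open>A half-line test on the quantile becomes a test on the distribution function at
  \<open>s\<close>, except where the defining set is the whole line or empty; there the infimum is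
  an unspecified constant. By monotonicity emptiness can be decided at natural numbers, which keeps
  the case distinction countable and hence measurable.\<close>

lemma measurable_quantile:
  assumes \<kappa> [measurable]: "\<kappa> \<in> N \<rightarrow>\<^sub>M prob_algebra borel" and p [measurable]: "p \<in> borel_measurable N"
  shows "(\<lambda>n. quantile (\<kappa> n) (p n)) \<in> borel_measurable N"
proof (rule borel_measurableI_le)
  fix s :: real
  have rd: "real_distribution (\<kappa> n)" if "n \<in> space N" for n
    using measurable_space[OF \<kappa> that]
    by (simp add: space_prob_algebra real_distribution_def real_distribution_axioms_def)
  have c [measurable]: "(\<lambda>n. cdf (\<kappa> n) s) \<in> borel_measurable N" for s
    unfolding cdf_def by measurable
  have "quantile (\<kappa> n) (p n) \<le> s \<longleftrightarrow>
    (if p n \<le> 0 then Inf (UNIV::real set) \<le> s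
     else if \<exists>k::nat. p n \<le> cdf (\<kappa> n) (real k) then p n \<le> cdf (\<kappa> n) s
     else Inf ({}::real set) \<le> s)" (is "_ \<longleftrightarrow> ?r n") if n: "n \<in> space N" for n
  proof -
    interpret real_distribution "\<kappa> n" by (rule rd[OF n])
    have "{s. p n \<le> cdf (\<kappa> n) s} = UNIV" if "p n \<le> 0"
      using cdf_nonneg that by (auto intro: order_trans)
    moreover have "{s. p n \<le> cdf (\<kappa> n) s} = {}" if none: "\<nexists>k::nat. p n \<le> cdf (\<kappa> n) (real k)"
    proof (rule equals0I)
      fix x assume x: "x \<in> {s. p n \<le> cdf (\<kappa> n) s}"
      obtain k :: nat where "x \<le> real k" using real_arch_simple by blast
      then have "p n \<le> cdf (\<kappa> n) (real k)" using x cdf_nondecreasing[of x "real k"] by simp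
      then show False using none by blast
    qed
    ultimately show ?thesis using quantile_le_iff[OF rd[OF n]] by (auto simp: quantile_def)
  qed
  then have "{n \<in> space N. quantile (\<kappa> n) (p n) \<le> s} = {n \<in> space N. ?r n}"
    by blast
  also have "\<dots> \<in> sets N" by measurable
  finally show "{n \<in> space N. quantile (\<kappa> n) (p n) \<le> s} \<in> sets N" .
qed

text \<open>On \<open>A\<close> one has \<open>Y - c \<le> max 0 (Y - c)\<close>, and off
  \<open>A\<close> the right side is nonnegative. This is weak duality between maximising over
  events of given probability and minimising over \<open>c\<close>; \<open>upper_tail_eq\<close> is
  a case of equality.\<close>

lemma (in prob_space) expectation_event_le:
  fixes Y :: "'a \<Rightarrow> real"
  assumes "integrable M Y" "A \<in> events"
  shows "(LINT x|M. indicator A x * Y x) \<le> (LINT x|M. max 0 (Y x - c)) + c * prob A"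
proof -
  have i: "integrable M (\<lambda>x. indicator A x * Y x)"
    using integrable_mult_indicator[OF assms(2,1)] by simp
  have ic: "integrable M (\<lambda>x. c * indicator A x)"
    using assms by (intro integrable_mult_right integrable_real_indicator) (auto simp: emeasure_eq_measure)
  have "(LINT x|M. indicator A x * Y x) - c * prob A = (LINT x|M. indicator A x * Y x - c * indicator A x)"
    using assms(2) by (subst Bochner_Integration.integral_diff[OF i ic]) simp
  also have "\<dots> \<le> (LINT x|M. max 0 (Y x - c))"
    using assms(1) i ic by (intro integral_mono) (auto simp: indicator_def)
  finally show ?thesis by simp
qed

section \<open>Real distributions without atoms\<close>

locale atomless_distribution = real_distribution M for M +
  assumes atomless: "measure M {x} = 0"
begin

lemma isCont_cdf_atomless: "isCont (cdf M) x"
  by (simp add: isCont_cdf atomless)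

lemma measurable_cdf [measurable]: "cdf M \<in> borel_measurable borel"
  by (intro borel_measurable_mono monoI cdf_nondecreasing)

text \<open>Where the distribution function is flat, many points have level \<open>\<beta>\<close>.
  Taking the rightmost one, a supremum, gives the equivalence for every \<open>y\<close> and not
  only for almost every \<open>y\<close>.\<close>

lemma cdf_level:
  assumes "0 < \<beta>" "\<beta> < 1"
  obtains c where "cdf M c = \<beta>" "\<And>y. \<beta> < cdf M y \<longleftrightarrow> c < y"
proof -
  let ?S = "{y. cdf M y \<le> \<beta>}"
  have "eventually (\<lambda>y. cdf M y < \<beta>) at_bot"
    using order_tendstoD(2)[OF cdf_lim_at_bot assms(1)] .
  then obtain y0 where "cdf M y0 < \<beta>" by (auto simp: eventually_at_bot_linorder)
  then have ne: "?S \<noteq> {}" by (auto intro: less_imp_le)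
  have "eventually (\<lambda>y. \<beta> < cdf M y) at_top"
    using order_tendstoD(1)[OF cdf_lim_at_top_prob assms(2)] .
  then obtain y where y: "\<beta> < cdf M y" by (auto simp: eventually_at_top_linorder)
  have bdd: "bdd_above ?S"
  proof (rule bdd_aboveI[of _ y])
    show "x \<le> y" if "x \<in> ?S" for x
      using that y cdf_nondecreasing[of y x] by (cases "x \<le> y") auto
  qed
  have "closed ?S"
    by (intro closed_Collect_le continuous_at_imp_continuous_on ballI isCont_cdf_atomless continuous_intros)
  then have c: "cdf M (Sup ?S) \<le> \<beta>"
    using closed_contains_Sup[OF ne bdd] by simp
  have iff: "\<beta> < cdf M y \<longleftrightarrow> Sup ?S < y" for y
  proof
    show "\<beta> < cdf M y \<Longrightarrow> Sup ?S < y"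
      using c cdf_nondecreasing[of y "Sup ?S"] by linarith
    show "Sup ?S < y \<Longrightarrow> \<beta> < cdf M y"
      using cSup_upper[OF _ bdd, of y] by (auto simp: not_le[symmetric])
  qed
  have "\<beta> \<le> cdf M (Sup ?S)"
  proof (rule tendsto_lowerbound)
    show "(cdf M \<longlongrightarrow> cdf M (Sup ?S)) (at_right (Sup ?S))"
      using cdf_is_right_cont by (simp add: continuous_within)
    show "\<forall>\<^sub>F y in at_right (Sup ?S). \<beta> \<le> cdf M y"
      using eventually_at_right_less[of "Sup ?S"] by eventually_elim (metis iff less_imp_le)
  qed simp
  then show ?thesis using that[of "Sup ?S"] c iff by auto
qed

lemma prob_cdf_gt_aux:
  assumes "0 < \<beta>" "\<beta> < 1"
  shows "prob {y. \<beta> < cdf M y} = 1 - \<beta>"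
proof -
  obtain c where c: "cdf M c = \<beta>" "\<And>y. \<beta> < cdf M y \<longleftrightarrow> c < y"
    using cdf_level[OF assms] by blast
  have "prob (space M - {..c}) = 1 - prob {..c}" by (rule prob_compl) simp
  moreover have "space M - {..c} = {y. \<beta> < cdf M y}" by (auto simp: c(2))
  ultimately show ?thesis using c(1) by (simp add: cdf_def)
qed

text \<open>Without atoms the distribution function is uniformly distributed under its own law, so
  no level carries mass; \<open>\<beta>\<close> is enclosed between levels \<open>l\<close> and
  \<open>u\<close> whose tails are known and arbitrarily close.\<close>

lemma AE_cdf_neq: "AE y in M. cdf M y \<noteq> \<beta>"
proof -
  have "prob {y. cdf M y = \<beta>} \<le> 0 + e" if "0 < e" for e
  proof (cases "0 \<le> \<beta> \<and> \<beta> \<le> 1")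
    case False
    then have "{y. cdf M y = \<beta>} = {}" using cdf_nonneg cdf_bounded_prob by force
    then show ?thesis using that by simp
  next
    case True
    \<comment> \<open>Both are within \<open>e / 3\<close> of \<open>\<beta>\<close>. The midpoints
      towards 0 and 1 keep \<open>l\<close> positive when \<open>\<beta>\<close> is, and
      \<open>u\<close> below 1 when \<open>\<beta>\<close> is, so that
      \<open>prob_cdf_gt_aux\<close> applies to them.\<close>
    define l where "l = max (\<beta> - e / 3) (\<beta> / 2)"
    define u where "u = min (\<beta> + e / 3) ((\<beta> + 1) / 2)"
    have *: "0 \<le> l" "l \<le> \<beta>" "\<beta> \<le> u" "u \<le> 1" "u - l < e" "0 < \<beta> \<Longrightarrow> 0 < l \<and> l < \<beta>" "\<beta> < 1 \<Longrightarrow> \<beta> < u \<and> u < 1"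
      using that True by (auto simp: l_def u_def max_def min_def field_simps)
    have l: "1 - l \<ge> prob {y. \<beta> \<le> cdf M y}"
    proof (cases "0 < \<beta>")
      case True
      then have "prob {y. \<beta> \<le> cdf M y} \<le> prob {y. l < cdf M y}"
        using * by (intro finite_measure_mono) auto
      then show ?thesis using prob_cdf_gt_aux[of l] * True \<open>0 \<le> \<beta> \<and> \<beta> \<le> 1\<close> by simp
    qed (use * \<open>0 \<le> \<beta> \<and> \<beta> \<le> 1\<close> prob_le_1[of "{y. \<beta> \<le> cdf M y}"] in linarith)
    have u: "1 - u \<le> prob {y. \<beta> < cdf M y}"
    proof (cases "\<beta> < 1")
      case True
      then have "prob {y. u < cdf M y} \<le> prob {y. \<beta> < cdf M y}"
        using * by (intro finite_measure_mono) auto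
      then show ?thesis using prob_cdf_gt_aux[of u] * True \<open>0 \<le> \<beta> \<and> \<beta> \<le> 1\<close> by simp
    qed (use * \<open>0 \<le> \<beta> \<and> \<beta> \<le> 1\<close> measure_nonneg[of M "{y. \<beta> < cdf M y}"] in linarith)
    have "prob {y. cdf M y = \<beta>} = prob ({y. \<beta> \<le> cdf M y} - {y. \<beta> < cdf M y})"
      by (rule arg_cong[where f=prob]) auto
    also have "\<dots> = prob {y. \<beta> \<le> cdf M y} - prob {y. \<beta> < cdf M y}"
      by (rule finite_measure_Diff) auto
    finally show ?thesis using l u * by linarith
  qed
  then have "prob {y. cdf M y = \<beta>} = 0"
    using field_le_epsilon[of "prob {y. cdf M y = \<beta>}" 0] by (simp add: measure_le_0_iff)
  then have "{y \<in> space M. cdf M y = \<beta>} \<in> null_sets M"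
    by (intro null_setsI) (auto simp: emeasure_eq_measure)
  then show ?thesis
    by (rule AE_I') auto
qed

lemma AE_cdf_01: "AE y in M. 0 < cdf M y \<and> cdf M y < 1"
  using AE_cdf_neq[of 0] AE_cdf_neq[of 1]
  by eventually_elim (use cdf_nonneg cdf_bounded_prob in \<open>auto simp: less_le\<close>)

lemma prob_cdf_gt:
  assumes "0 \<le> \<beta>" "\<beta> \<le> 1"
  shows "prob {y. \<beta> < cdf M y} = 1 - \<beta>"
proof -
  have "prob {y. 0 < cdf M y} = 1"
    using AE_cdf_01 by (subst prob_eq_1) (auto elim: eventually_mono)
  moreover have "{y. 1 < cdf M y} = {}" using cdf_bounded_prob by (auto simp: not_less)
  ultimately show ?thesis using prob_cdf_gt_aux assms by (cases "\<beta> = 0 \<or> \<beta> = 1") auto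
qed

text \<open>Equality in \<open>expectation_event_le\<close>: on the event \<open>c < y\<close> the
  difference \<open>y - c\<close> is its own positive part, and off the event the positive part
  vanishes.\<close>

lemma upper_tail_eq:
  assumes "integrable M (\<lambda>y. y)" "cdf M c = \<beta>" "\<And>y. \<beta> < cdf M y \<longleftrightarrow> c < y"
  shows "(LINT y|M. indicator {y. \<beta> < cdf M y} y * y) = (LINT y|M. max 0 (y - c)) + c * (1 - \<beta>)"
proof -
  have "\<beta> \<le> 1" "0 \<le> \<beta>" using assms(2) cdf_bounded_prob cdf_nonneg by auto
  have e: "indicator {y. \<beta> < cdf M y} y * y = max 0 (y - c) + c * indicator {y. \<beta> < cdf M y} y" for y
    by (auto simp: assms(3) indicator_def)
  have [measurable]: "{y. \<beta> < cdf M y} \<in> sets borel" by measurable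
  have i1: "integrable M (\<lambda>y. max 0 (y - c))"
    using integrable_max[OF integrable_const[of 0] Bochner_Integration.integrable_diff[OF assms(1) integrable_const[of c]]] .
  have "integrable M (indicator {y. \<beta> < cdf M y} :: real \<Rightarrow> real)"
    by (rule integrable_real_indicator) (simp_all add: emeasure_eq_measure)
  then have i2: "integrable M (\<lambda>y. c * indicator {y. \<beta> < cdf M y} y)"
    by (rule integrable_mult_right)
  show ?thesis
    unfolding e Bochner_Integration.integral_add[OF i1 i2]
    using prob_cdf_gt[OF \<open>0 \<le> \<beta>\<close> \<open>\<beta> \<le> 1\<close>] by simp
qed

text \<open>Bathtub principle: at the threshold of the tail, the bound of
  \<open>expectation_event_le\<close> depends on \<open>A\<close> only through its probability and
  is attained by the tail. For \<open>\<beta>\<close> equal to 0 or 1 a threshold need not exist,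
  but then the event is almost sure or null.\<close>

lemma upper_tail_le:
  assumes P: "prob_space P" and Y [measurable]: "Y \<in> borel_measurable P" and d: "distr P borel Y = M"
    and i: "integrable P Y" and A [measurable]: "A \<in> sets P"
    and pA: "measure P A = 1 - \<beta>" and \<beta>: "0 \<le> \<beta>" "\<beta> \<le> 1"
  shows "(LINT x|P. indicator A x * Y x) \<le> (LINT y|M. indicator {y. \<beta> < cdf M y} y * y)"
proof -
  interpret P: prob_space P by fact
  have iM: "integrable M (\<lambda>y. y)" using i unfolding d[symmetric] by (simp add: integrable_distr_eq)
  consider "\<beta> = 0" | "\<beta> = 1" | "0 < \<beta>" "\<beta> < 1" using \<beta> by linarith
  then show ?thesis
  proof cases
    case 1
    have "AE x in P. x \<in> A" using pA 1 by (simp add: P.prob_eq_1)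
    then have "(LINT x|P. indicator A x * Y x) = (LINT x|P. Y x)"
      by (intro integral_cong_AE) (auto elim: eventually_mono)
    also have "\<dots> = (LINT y|M. y)" unfolding d[symmetric] by (simp add: integral_distr)
    also have "\<dots> = (LINT y|M. indicator {y. \<beta> < cdf M y} y * y)"
      using AE_cdf_01 1 by (intro integral_cong_AE) (auto elim: eventually_mono)
    finally show ?thesis by simp
  next
    case 2
    have "A \<in> null_sets P" using pA 2 by (intro null_setsI) (auto simp: P.emeasure_eq_measure)
    then have "AE x in P. x \<notin> A" by (rule AE_not_in)
    then have "(LINT x|P. indicator A x * Y x) = (LINT x|P. 0)"
      by (intro integral_cong_AE) (auto elim: eventually_mono)
    moreover have "{y. \<beta> < cdf M y} = {}" using cdf_bounded_prob 2 by (auto simp: not_less)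
    ultimately show ?thesis by simp
  next
    case 3
    obtain c where c: "cdf M c = \<beta>" "\<And>y. \<beta> < cdf M y \<longleftrightarrow> c < y"
      using cdf_level[OF 3] by blast
    have "(LINT x|P. max 0 (Y x - c)) = (LINT y|M. max 0 (y - c))"
      unfolding d[symmetric] by (simp add: integral_distr)
    then show ?thesis
      using P.expectation_event_le[OF i A, of c] upper_tail_eq[OF iM c] pA by simp
  qed
qed

end

text \<open>Off a null set \<open>cdf \<mu> y\<close> lies strictly between 0 and 1, where
  \<open>quantile_le_iff\<close> locates the map relative to all levels \<open>z\<close> at once.
  The image law then follows from the uniform distribution of \<open>cdf \<mu>\<close>.\<close>

lemma atomless_distribution_monotone_map:
  assumes \<mu>: "atomless_distribution \<mu>" and \<nu>: "real_distribution \<nu>"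
  shows measurable_monotone_map: "monotone_map \<mu> \<nu> \<in> borel_measurable borel"
    and AE_monotone_map_less: "AE y in \<mu>. \<forall>z. z < monotone_map \<mu> \<nu> y \<longleftrightarrow> cdf \<nu> z < cdf \<mu> y"
    and distr_monotone_map: "distr \<mu> borel (monotone_map \<mu> \<nu>) = \<nu>"
proof -
  interpret \<mu>: atomless_distribution \<mu> by fact
  interpret \<nu>: real_distribution \<nu> by fact
  have [measurable]: "monotone_map \<mu> \<nu> \<in> borel_measurable borel"
    unfolding monotone_map_def comp_def
    by (rule measurable_quantile) (auto simp: space_prob_algebra \<nu>.prob_space_axioms)
  then show "monotone_map \<mu> \<nu> \<in> borel_measurable borel" .
  show AE: "AE y in \<mu>. \<forall>z. z < monotone_map \<mu> \<nu> y \<longleftrightarrow> cdf \<nu> z < cdf \<mu> y"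
    using \<mu>.AE_cdf_01
  proof eventually_elim
    case (elim y)
    have "eventually (\<lambda>x. cdf \<mu> y < cdf \<nu> x) at_top"
      using order_tendstoD(1)[OF \<nu>.cdf_lim_at_top_prob, of "cdf \<mu> y"] elim by simp
    then obtain x where "cdf \<mu> y < cdf \<nu> x" by (auto simp: eventually_at_top_linorder)
    then show ?case
      using quantile_le_iff[OF \<nu>, of "cdf \<mu> y" x] elim
      by (auto simp: monotone_map_def not_le[symmetric])
  qed
  show "distr \<mu> borel (monotone_map \<mu> \<nu>) = \<nu>"
  proof (rule cdf_unique)
    show "real_distribution (distr \<mu> borel (monotone_map \<mu> \<nu>))"
      by (rule \<mu>.real_distribution_distr) simp
    show "cdf (distr \<mu> borel (monotone_map \<mu> \<nu>)) = cdf \<nu>"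
    proof
      fix z
      have z: "0 \<le> cdf \<nu> z" "cdf \<nu> z \<le> 1" using \<nu>.cdf_nonneg \<nu>.cdf_bounded_prob by auto
      have "cdf (distr \<mu> borel (monotone_map \<mu> \<nu>)) z = \<mu>.prob {y. monotone_map \<mu> \<nu> y \<le> z}"
        by (simp add: cdf_def measure_distr vimage_def)
      also have "\<dots> = \<mu>.prob (space \<mu> - {y. cdf \<nu> z < cdf \<mu> y})"
        using AE by (intro \<mu>.finite_measure_eq_AE) (auto elim!: eventually_mono simp: not_less[symmetric])
      also have "\<dots> = cdf \<nu> z"
        using \<mu>.prob_cdf_gt[OF z] by (subst \<mu>.prob_compl) auto
      finally show "cdf (distr \<mu> borel (monotone_map \<mu> \<nu>)) z = cdf \<nu> z" .
    qed
  qed (rule \<nu>)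
qed

lemma integrable_mult_square:
  fixes f g :: "'a \<Rightarrow> real"
  assumes [measurable]: "f \<in> borel_measurable M" "g \<in> borel_measurable M"
    and "integrable M (\<lambda>x. (f x)\<^sup>2)" "integrable M (\<lambda>x. (g x)\<^sup>2)"
  shows "integrable M (\<lambda>x. f x * g x)"
proof (rule Bochner_Integration.integrable_bound[OF Bochner_Integration.integrable_add[OF assms(3,4)]])
  show "AE x in M. norm (f x * g x) \<le> norm ((f x)\<^sup>2 + (g x)\<^sup>2)"
  proof (rule AE_I2)
    fix x
    have "0 \<le> (\<bar>f x\<bar> - \<bar>g x\<bar>)\<^sup>2" "0 \<le> \<bar>f x\<bar> * \<bar>g x\<bar>" by simp_all
    then have "\<bar>f x\<bar> * \<bar>g x\<bar> \<le> (f x)\<^sup>2 + (g x)\<^sup>2"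
      unfolding power2_diff power2_abs by linarith
    then show "norm (f x * g x) \<le> norm ((f x)\<^sup>2 + (g x)\<^sup>2)" by (simp add: abs_mult)
  qed
qed simp

lemma (in finite_measure) integrable_of_square:
  fixes f :: "'a \<Rightarrow> real"
  assumes [measurable]: "f \<in> borel_measurable M" and "integrable M (\<lambda>x. (f x)\<^sup>2)"
  shows "integrable M f"
  using integrable_mult_square[of f M "\<lambda>_. 1"] assms by simp

text \<open>The monotone coupling is optimal because it maximises \<open>E[Y; Z > z]\<close> for every level \<open>z\<close>
  simultaneously.\<close>

lemma monotone_map_optimal:
  assumes \<mu>: "atomless_distribution \<mu>" "\<mu> \<in> P2" and \<nu>: "\<nu> \<in> P2"
    and \<gamma>: "\<gamma> \<in> couplings \<mu> \<nu>"
  shows "(LINT z|\<gamma>. fst z * snd z) \<le> (LINT y|\<mu>. y * monotone_map \<mu> \<nu> y)"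
proof -
  interpret \<mu>: atomless_distribution \<mu> by fact
  interpret \<nu>: real_distribution \<nu>
    using \<nu> by (simp add: P2_def real_distribution_def real_distribution_axioms_def)
  interpret \<gamma>: prob_space \<gamma> using \<gamma> by (simp add: couplings_def)
  have [measurable_cong]: "sets \<gamma> = sets (borel \<Otimes>\<^sub>M borel)" and d1: "distr \<gamma> borel fst = \<mu>" and d2: "distr \<gamma> borel snd = \<nu>"
    using \<gamma> unfolding borel_prod by (simp_all add: couplings_def)
  define T where "T = monotone_map \<mu> \<nu>"
  have [measurable]: "T \<in> borel_measurable borel" unfolding T_def
    by (rule measurable_monotone_map[OF \<mu>(1)]) unfold_locales
  have T: "distr \<mu> borel T = \<nu>" unfolding T_def
    by (rule distr_monotone_map[OF \<mu>(1)]) unfold_locales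
  have AET: "AE y in \<mu>. \<forall>z. z < T y \<longleftrightarrow> cdf \<nu> z < cdf \<mu> y" unfolding T_def
    by (rule AE_monotone_map_less[OF \<mu>(1)]) unfold_locales
  have sq: "integrable \<mu> (\<lambda>y. y\<^sup>2)" "integrable \<nu> (\<lambda>y. y\<^sup>2)"
    using \<mu>(2) \<nu> by (simp_all add: P2_def)
  have sqT: "integrable \<mu> (\<lambda>y. (T y)\<^sup>2)"
    using sq(2) unfolding T[symmetric] by (simp add: integrable_distr_eq)
  have sq\<gamma>: "integrable \<gamma> (\<lambda>z. (fst z)\<^sup>2)" "integrable \<gamma> (\<lambda>z. (snd z)\<^sup>2)"
    using sq unfolding d1[symmetric] d2[symmetric] by (simp_all add: integrable_distr_eq)
  have i\<gamma>: "integrable \<gamma> (\<lambda>z. fst z * snd z)" and i\<mu>: "integrable \<mu> (\<lambda>y. y * T y)"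
    using sq sqT sq\<gamma> by (auto intro!: integrable_mult_square)
  have i1: "integrable \<gamma> fst" and i2: "integrable \<mu> (\<lambda>y. y)"
    by (rule \<gamma>.integrable_of_square[OF _ sq\<gamma>(1)] \<mu>.integrable_of_square[OF _ sq(1)]; simp)+
  note L\<gamma> = layer_cake[OF \<gamma>.sigma_finite_measure_axioms _ _ i\<gamma>]
  note L\<mu> = layer_cake[OF \<mu>.sigma_finite_measure_axioms _ _ i\<mu>]
  have "(LINT x|\<gamma>. fst x * level z (snd x)) \<le> (LINT y|\<mu>. y * level z (T y))" for z
  proof -
    \<comment> \<open>Only the first term sees the coupling; the second integrates to a quantity of
      the first marginal.\<close>
    have e: "y * level z t = indicator {z<..} t * y - (if z < 0 then 1 else 0) * y" for y t
      by (auto simp: level_def indicator_def)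
    have z: "0 \<le> cdf \<nu> z" "cdf \<nu> z \<le> 1" using \<nu>.cdf_nonneg \<nu>.cdf_bounded_prob by auto
    have "(LINT x|\<gamma>. indicator {z<..} (snd x) * fst x) = (LINT x|\<gamma>. indicator (snd -` {z<..} \<inter> space \<gamma>) x * fst x)"
      by (intro Bochner_Integration.integral_cong) (auto simp: indicator_def)
    \<comment> \<open>The event \<open>z < snd x\<close> has the probability
      \<open>1 - cdf \<nu> z\<close> of the tail of \<open>\<mu>\<close> above that level, so it
      competes in the bathtub principle.\<close>
    also have "\<dots> \<le> (LINT y|\<mu>. indicator {y. cdf \<nu> z < cdf \<mu> y} y * y)"
    proof (rule \<mu>.upper_tail_le[OF \<gamma>.prob_space_axioms _ d1 i1 _ _ z])
      have "measure \<gamma> (snd -` {z<..} \<inter> space \<gamma>) = measure (distr \<gamma> borel snd) (space \<nu> - {..z})"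
        by (subst measure_distr) (auto simp: Compl_eq_Diff_UNIV[symmetric])
      also have "\<dots> = 1 - cdf \<nu> z"
        unfolding d2 by (subst \<nu>.prob_compl) (auto simp: cdf_def)
      finally show "measure \<gamma> (snd -` {z<..} \<inter> space \<gamma>) = 1 - cdf \<nu> z" .
    qed measurable
    also have "\<dots> = (LINT y|\<mu>. indicator {z<..} (T y) * y)"
      using AET by (intro integral_cong_AE) (auto elim!: eventually_mono simp: indicator_def)
    finally have *: "(LINT x|\<gamma>. indicator {z<..} (snd x) * fst x) \<le> (LINT y|\<mu>. indicator {z<..} (T y) * y)" .
    have m: "(LINT x|\<gamma>. fst x) = (LINT y|\<mu>. y)" unfolding d1[symmetric] by (simp add: integral_distr)
    have "integrable \<gamma> (\<lambda>x. indicator {z<..} (snd x) * fst x)"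
      by (rule Bochner_Integration.integrable_bound[OF i1]) (auto simp: indicator_def)
    moreover have "integrable \<mu> (\<lambda>y. indicator {z<..} (T y) * y)"
      by (rule Bochner_Integration.integrable_bound[OF i2]) (auto simp: indicator_def)
    ultimately show ?thesis
      unfolding e using * m i1 i2 by (subst (1 2) Bochner_Integration.integral_diff) auto
  qed
  then have "(LINT z|lborel. LINT x|\<gamma>. fst x * level z (snd x)) \<le> (LINT z|lborel. LINT y|\<mu>. y * level z (T y))"
    by (intro integral_mono L\<gamma>(1) L\<mu>(1)) auto
  moreover have "(LINT z|lborel. LINT x|\<gamma>. fst x * level z (snd x)) = (LINT z|\<gamma>. fst z * snd z)"
    by (rule L\<gamma>(2)) simp_all
  moreover have "(LINT z|lborel. LINT y|\<mu>. y * level z (T y)) = (LINT y|\<mu>. y * T y)"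
    by (rule L\<mu>(2)) simp_all
  ultimately show ?thesis by (simp add: T_def)
qed

text \<open>After expanding the square, couplings share their second moments and differ only in the
  cross term, which \<open>monotone_map_optimal\<close> bounds. The image of \<open>\<mu>\<close>
  under the pair of the identity and \<open>T\<close> attains the bound, so the infimum is a finite
  minimum and \<open>enn2real\<close> returns it faithfully.\<close>

lemma W2_monotone_map:
  assumes \<mu>: "atomless_distribution \<mu>" "\<mu> \<in> P2" and \<nu>: "\<nu> \<in> P2"
  shows integrable_monotone_map_sq: "integrable \<mu> (\<lambda>y. (monotone_map \<mu> \<nu> y)\<^sup>2)"
    and integral_monotone_map_sq: "(LINT y|\<mu>. (monotone_map \<mu> \<nu> y)\<^sup>2) = (LINT z|\<nu>. z\<^sup>2)"
    and "(W2 \<mu> \<nu>)\<^sup>2 = (LINT y|\<mu>. (y - monotone_map \<mu> \<nu> y)\<^sup>2)"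
proof -
  interpret \<mu>: atomless_distribution \<mu> by fact
  interpret \<nu>: real_distribution \<nu>
    using \<nu> by (simp add: P2_def real_distribution_def real_distribution_axioms_def)
  define T where "T = monotone_map \<mu> \<nu>"
  have [measurable]: "T \<in> borel_measurable borel" unfolding T_def
    by (rule measurable_monotone_map[OF \<mu>(1)]) unfold_locales
  have T: "distr \<mu> borel T = \<nu>" unfolding T_def
    by (rule distr_monotone_map[OF \<mu>(1)]) unfold_locales
  have sq: "integrable \<mu> (\<lambda>y. y\<^sup>2)" "integrable \<nu> (\<lambda>y. y\<^sup>2)"
    using \<mu>(2) \<nu> by (simp_all add: P2_def)
  have sqT: "integrable \<mu> (\<lambda>y. (T y)\<^sup>2)"
    using sq(2) unfolding T[symmetric] by (simp add: integrable_distr_eq)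
  have sqTi: "(LINT y|\<mu>. (T y)\<^sup>2) = (LINT z|\<nu>. z\<^sup>2)"
    unfolding T[symmetric] by (simp add: integral_distr)
  show "integrable \<mu> (\<lambda>y. (monotone_map \<mu> \<nu> y)\<^sup>2)"
    "(LINT y|\<mu>. (monotone_map \<mu> \<nu> y)\<^sup>2) = (LINT z|\<nu>. z\<^sup>2)" using sqT sqTi by (simp_all add: T_def)
  have i\<mu>: "integrable \<mu> (\<lambda>y. y * T y)" using sq sqT by (auto intro!: integrable_mult_square)
  have ex: "(a - b)\<^sup>2 = a\<^sup>2 + b\<^sup>2 - 2 * (a * b)" for a b :: real by (simp add: power2_diff)
  have iopt: "integrable \<mu> (\<lambda>y. (y - T y)\<^sup>2)" unfolding ex using sq sqT i\<mu> by simp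
  have Topt: "(LINT y|\<mu>. (y - T y)\<^sup>2) = (LINT y|\<mu>. y\<^sup>2) + (LINT z|\<nu>. z\<^sup>2) - 2 * (LINT y|\<mu>. y * T y)"
    unfolding ex using sq sqT i\<mu> sqTi by simp
  have lower: "ennreal (LINT y|\<mu>. (y - T y)\<^sup>2) \<le> (\<integral>\<^sup>+z. ennreal ((dist (fst z) (snd z))\<^sup>2) \<partial>\<gamma>)"
    if \<gamma>: "\<gamma> \<in> couplings \<mu> \<nu>" for \<gamma>
  proof -
    have [measurable_cong]: "sets \<gamma> = sets (borel \<Otimes>\<^sub>M borel)" and d1: "distr \<gamma> borel fst = \<mu>" and d2: "distr \<gamma> borel snd = \<nu>"
      using \<gamma> unfolding borel_prod by (simp_all add: couplings_def)
    have sq\<gamma>: "integrable \<gamma> (\<lambda>z. (fst z)\<^sup>2)" "integrable \<gamma> (\<lambda>z. (snd z)\<^sup>2)"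
      using sq unfolding d1[symmetric] d2[symmetric] by (simp_all add: integrable_distr_eq)
    have i\<gamma>: "integrable \<gamma> (\<lambda>z. fst z * snd z)" using sq\<gamma> by (auto intro!: integrable_mult_square)
    have m: "(LINT z|\<gamma>. (fst z)\<^sup>2) = (LINT y|\<mu>. y\<^sup>2)" "(LINT z|\<gamma>. (snd z)\<^sup>2) = (LINT z|\<nu>. z\<^sup>2)"
      unfolding d1[symmetric] d2[symmetric] by (simp_all add: integral_distr)
    have "(LINT y|\<mu>. (y - T y)\<^sup>2) \<le> (LINT z|\<gamma>. (fst z - snd z)\<^sup>2)"
      unfolding Topt using monotone_map_optimal[OF \<mu> \<nu> \<gamma>] sq\<gamma> i\<gamma> m by (simp add: ex T_def)
    moreover have "integrable \<gamma> (\<lambda>z. (fst z - snd z)\<^sup>2)" unfolding ex using sq\<gamma> i\<gamma> by simp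
    ultimately show ?thesis
      by (simp add: dist_real_def nn_integral_eq_integral ennreal_leI)
  qed
  define \<gamma>0 where "\<gamma>0 = distr \<mu> borel (\<lambda>y. (y, T y))"
  have "distr \<gamma>0 borel fst = distr \<mu> borel (\<lambda>y. y)" "distr \<gamma>0 borel snd = distr \<mu> borel T"
    unfolding \<gamma>0_def by (subst distr_distr; simp add: comp_def borel_prod[symmetric])+
  moreover have "distr \<mu> borel (\<lambda>y. y) = \<mu>" by (rule distr_id2) simp
  moreover have "prob_space \<gamma>0" unfolding \<gamma>0_def by (rule \<mu>.prob_space_distr) (simp add: borel_prod[symmetric])
  ultimately have c0: "\<gamma>0 \<in> couplings \<mu> \<nu>" using T by (simp add: couplings_def \<gamma>0_def)
  have "(\<integral>\<^sup>+z. ennreal ((dist (fst z) (snd z))\<^sup>2) \<partial>\<gamma>0) = (\<integral>\<^sup>+y. ennreal ((y - T y)\<^sup>2) \<partial>\<mu>)"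
    unfolding \<gamma>0_def by (subst nn_integral_distr) (simp_all add: dist_real_def borel_prod[symmetric])
  also have "\<dots> = ennreal (LINT y|\<mu>. (y - T y)\<^sup>2)"
    using iopt by (simp add: nn_integral_eq_integral)
  finally have "(INF \<gamma>\<in>couplings \<mu> \<nu>. \<integral>\<^sup>+z. ennreal ((dist (fst z) (snd z))\<^sup>2) \<partial>\<gamma>) = ennreal (LINT y|\<mu>. (y - T y)\<^sup>2)"
    using lower c0 by (intro antisym) (auto intro!: INF_lower2 INF_greatest)
  then show "(W2 \<mu> \<nu>)\<^sup>2 = (LINT y|\<mu>. (y - monotone_map \<mu> \<nu> y)\<^sup>2)"
    by (simp add: W2_def T_def)
qed

section \<open>Integration over space-time\<close>

text \<open>The measure \<open>dt K_t(dx)\<close> on (0,T) times space. Built as a bind, it asks for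
  measurability of \<open>t \<mapsto> K t\<close> as a map into measures, and not for a density
  measurable jointly in time and space.\<close>

definition spacetime :: "real \<Rightarrow> (real \<Rightarrow> 'a::euclidean_space measure) \<Rightarrow> (real \<times> 'a) measure" where
  "spacetime T K = density lborel (indicator {0<..<T}) \<bind>
     (\<lambda>t. distr (K t) (borel \<Otimes>\<^sub>M borel) (Pair t))"

locale borel_kernel =
  fixes K :: "real \<Rightarrow> 'a::euclidean_space measure"
  assumes kernel: "K \<in> borel \<rightarrow>\<^sub>M prob_algebra borel"
begin

lemma kernel_sets [simp, measurable_cong]: "sets (K t) = sets borel"
  using measurable_space[OF kernel, of t] by (simp add: space_prob_algebra)

lemma kernel_space [simp]: "space (K t) = UNIV"
  using sets_eq_imp_space_eq[OF kernel_sets, of t] by simp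

lemma kernel_prob_space: "prob_space (K t)"
  using measurable_space[OF kernel, of t] by (simp add: space_prob_algebra)

lemma K_subprob [measurable]: "K \<in> borel \<rightarrow>\<^sub>M subprob_algebra borel"
  by (rule measurable_prob_algebraD[OF kernel])

lemma slice_kernel:
  "(\<lambda>t. distr (K t) (borel \<Otimes>\<^sub>M borel) (Pair t)) \<in>
     density lborel (indicator {0<..<T}) \<rightarrow>\<^sub>M subprob_algebra (borel \<Otimes>\<^sub>M borel)"
proof -
  have "(\<lambda>t. distr (K t) (borel \<Otimes>\<^sub>M borel) (Pair t)) \<in> borel \<rightarrow>\<^sub>M subprob_algebra (borel \<Otimes>\<^sub>M borel)"
    by (rule measurable_distr2[OF _ K_subprob]) simp
  then show ?thesis by (simp cong: measurable_cong_sets)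
qed

lemma sets_spacetime [simp, measurable_cong]: "sets (spacetime T K) = sets (borel \<Otimes>\<^sub>M borel)"
  unfolding spacetime_def using subprob_measurableD(2)[OF slice_kernel]
  by (intro sets_bind) auto

lemma space_spacetime [simp]: "space (spacetime T K) = UNIV"
  using sets_eq_imp_space_eq[OF sets_spacetime] by (simp add: space_pair_measure)

lemma finite_measure_spacetime:
  assumes T: "T \<le> 1"
  shows "finite_measure (spacetime T K)"
proof -
  have "subprob_space (density lborel (indicator {0<..<T}))"
    using T by (intro subprob_spaceI) (cases "0 \<le> T"; simp add: emeasure_density)+
  then have "subprob_space (spacetime T K)"
    unfolding spacetime_def by (rule subprob_space_bind) (rule slice_kernel)
  then show ?thesis by (simp add: subprob_space_def)
qed

lemma nn_integral_spacetime:
  assumes [measurable]: "f \<in> borel_measurable (borel \<Otimes>\<^sub>M borel)"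
  shows "(\<integral>\<^sup>+z. f z \<partial>spacetime T K) = (\<integral>\<^sup>+t. indicator {0<..<T} t * (\<integral>\<^sup>+x. f (t, x) \<partial>K t) \<partial>lborel)"
proof -
  have m: "(\<lambda>t. \<integral>\<^sup>+x. f (t, x) \<partial>K t) \<in> borel_measurable borel"
    by (rule nn_integral_measurable_subprob_algebra2[OF _ K_subprob]) simp
  have "(\<integral>\<^sup>+z. f z \<partial>spacetime T K) =
      (\<integral>\<^sup>+t. \<integral>\<^sup>+z. f z \<partial>distr (K t) (borel \<Otimes>\<^sub>M borel) (Pair t) \<partial>density lborel (indicator {0<..<T}))"
    unfolding spacetime_def by (rule nn_integral_bind[OF _ slice_kernel]) simp
  also have "\<dots> = (\<integral>\<^sup>+t. \<integral>\<^sup>+x. f (t, x) \<partial>K t \<partial>density lborel (indicator {0<..<T}))"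
    by (intro nn_integral_cong nn_integral_distr) (auto cong: measurable_cong_sets)
  also have "\<dots> = (\<integral>\<^sup>+t. indicator {0<..<T} t * (\<integral>\<^sup>+x. f (t, x) \<partial>K t) \<partial>lborel)"
    using m by (subst nn_integral_density) auto
  finally show ?thesis .
qed

lemma AE_spacetime:
  assumes [measurable]: "Measurable.pred (borel \<Otimes>\<^sub>M borel) P"
  shows "(AE z in spacetime T K. P z) \<longleftrightarrow> (AE t in lborel. t \<in> {0<..<T} \<longrightarrow> (AE x in K t. P (t, x)))"
proof -
  have "(AE z in spacetime T K. P z) \<longleftrightarrow>
      (AE t in density lborel (indicator {0<..<T}). AE z in distr (K t) (borel \<Otimes>\<^sub>M borel) (Pair t). P z)"
    unfolding spacetime_def by (rule AE_bind[OF slice_kernel]) simp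
  also have "\<dots> \<longleftrightarrow> (AE t in lborel. t \<in> {0<..<T} \<longrightarrow> (AE z in distr (K t) (borel \<Otimes>\<^sub>M borel) (Pair t). P z))"
    by (subst AE_density) (auto simp: indicator_def)
  also have "\<dots> \<longleftrightarrow> (AE t in lborel. t \<in> {0<..<T} \<longrightarrow> (AE x in K t. P (t, x)))"
  proof -
    have "(AE z in distr (K t) (borel \<Otimes>\<^sub>M borel) (Pair t). P z) \<longleftrightarrow> (AE x in K t. P (t, x))" for t
      by (rule AE_distr_iff) (auto cong: measurable_cong_sets)
    then show ?thesis by simp
  qed
  finally show ?thesis .
qed

text \<open>Tonelli's theorem for the kernel. A slice integral may be infinite on a null set of
  times; there the Bochner integral is 0 by default, as is \<open>enn2real\<close> of
  infinity.\<close>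

lemma spacetime_integral_nonneg:
  fixes f :: "real \<times> 'a \<Rightarrow> real"
  assumes f: "integrable (spacetime T K) f" and nn: "\<And>z. 0 \<le> f z"
  shows "AE t in lborel. t \<in> {0<..<T} \<longrightarrow> integrable (K t) (\<lambda>x. f (t, x))"
    and "has_bochner_integral lborel (\<lambda>t. indicator {0<..<T} t * (LINT x|K t. f (t, x)))
      (LINT z|spacetime T K. f z)"
proof -
  have [measurable]: "f \<in> borel_measurable (borel \<Otimes>\<^sub>M borel)"
    using borel_measurable_integrable[OF f] by (simp cong: measurable_cong_sets)
  define g where "g t = (\<integral>\<^sup>+x. ennreal (f (t, x)) \<partial>K t)" for t
  have gm [measurable]: "g \<in> borel_measurable borel"
    unfolding g_def by (rule nn_integral_measurable_subprob_algebra2[OF _ K_subprob]) simp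
  have eq: "(\<integral>\<^sup>+t. indicator {0<..<T} t * g t \<partial>lborel) = ennreal (LINT z|spacetime T K. f z)"
    using nn_integral_spacetime[of "\<lambda>z. ennreal (f z)"] nn_integral_eq_integral[OF f] nn
    by (simp add: g_def)
  have "AE t in lborel. indicator {0<..<T} t * g t \<noteq> \<infinity>"
    by (rule nn_integral_PInf_AE) (simp_all add: eq)
  then have fin: "AE t in lborel. t \<in> {0<..<T} \<longrightarrow> g t < \<infinity>"
    by eventually_elim (auto simp: indicator_def less_top)
  have int: "integrable (K t) (\<lambda>x. f (t, x))" if "g t < \<infinity>" for t
    by (rule integrableI_bounded) (use that nn in \<open>auto simp: g_def\<close>)
  show "AE t in lborel. t \<in> {0<..<T} \<longrightarrow> integrable (K t) (\<lambda>x. f (t, x))"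
    using fin by eventually_elim (auto intro: int)
  have e: "(LINT x|K t. f (t, x)) = enn2real (g t)" for t
    unfolding g_def by (rule integral_eq_nn_integral) (use nn in auto)
  show "has_bochner_integral lborel (\<lambda>t. indicator {0<..<T} t * (LINT x|K t. f (t, x)))
      (LINT z|spacetime T K. f z)"
  proof (rule has_bochner_integral_nn_integral)
    show "0 \<le> (LINT z|spacetime T K. f z)" by (rule Bochner_Integration.integral_nonneg) (rule nn)
    show "(\<integral>\<^sup>+t. ennreal (indicator {0<..<T} t * (LINT x|K t. f (t, x))) \<partial>lborel) =
        ennreal (LINT z|spacetime T K. f z)"
      unfolding eq[symmetric] using fin
      by (intro nn_integral_cong_AE, eventually_elim) (auto simp: e indicator_def)
  qed (auto simp: e)
qed

lemma spacetime_integral: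
  fixes f :: "real \<times> 'a \<Rightarrow> real"
  assumes f: "integrable (spacetime T K) f"
  shows AE_integrable_spacetime: "AE t in lborel. t \<in> {0<..<T} \<longrightarrow> integrable (K t) (\<lambda>x. f (t, x))"
    and has_bochner_integral_spacetime:
      "has_bochner_integral lborel (\<lambda>t. indicator {0<..<T} t * (LINT x|K t. f (t, x)))
        (LINT z|spacetime T K. f z)"
proof -
  have [measurable]: "f \<in> borel_measurable (borel \<Otimes>\<^sub>M borel)"
    using borel_measurable_integrable[OF f] by (simp cong: measurable_cong_sets)
  have p: "integrable (spacetime T K) (\<lambda>z. max 0 (f z))" "integrable (spacetime T K) (\<lambda>z. max 0 (- f z))"
    using f by (auto intro!: integrable_max)
  note P = spacetime_integral_nonneg[OF p(1) max.cobounded1]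
    and N = spacetime_integral_nonneg[OF p(2) max.cobounded1]
  have d: "f z = max 0 (f z) - max 0 (- f z)" for z by (simp add: max_def)
  have ae: "AE t in lborel. t \<in> {0<..<T} \<longrightarrow> integrable (K t) (\<lambda>x. max 0 (f (t, x)))
      \<and> integrable (K t) (\<lambda>x. max 0 (- f (t, x)))"
    using P(1) N(1) by eventually_elim simp
  have ae2: "AE t in lborel. t \<in> {0<..<T} \<longrightarrow>
      integrable (K t) (\<lambda>x. f (t, x)) \<and>
      (LINT x|K t. f (t, x)) = (LINT x|K t. max 0 (f (t, x))) - (LINT x|K t. max 0 (- f (t, x)))"
    using ae
  proof eventually_elim
    case (elim t)
    show ?case
    proof
      assume t: "t \<in> {0<..<T}"
      have e: "(\<lambda>x. f (t, x)) = (\<lambda>x. max 0 (f (t, x)) - max 0 (- f (t, x)))" using d by auto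
      show "integrable (K t) (\<lambda>x. f (t, x)) \<and>
        (LINT x|K t. f (t, x)) = (LINT x|K t. max 0 (f (t, x))) - (LINT x|K t. max 0 (- f (t, x)))"
        using elim t by (subst (1 2) e) (simp add: Bochner_Integration.integral_diff)
    qed
  qed
  then show "AE t in lborel. t \<in> {0<..<T} \<longrightarrow> integrable (K t) (\<lambda>x. f (t, x))"
    by eventually_elim auto
  have m: "(\<lambda>t. LINT x|K t. f (t, x)) \<in> borel_measurable borel"
  proof -
    have "(\<lambda>t. LINT z|distr (K t) (borel \<Otimes>\<^sub>M borel) (Pair t). f z) \<in> borel_measurable borel"
      by (rule measurable_compose[OF measurable_distr2[OF _ K_subprob] integral_measurable_subprob_algebra])
        simp_all
    then show ?thesis by (subst (asm) integral_distr) (auto cong: measurable_cong_sets)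
  qed
  have "(LINT z|spacetime T K. f z) = (LINT z|spacetime T K. max 0 (f z)) - (LINT z|spacetime T K. max 0 (- f z))"
    by (subst Bochner_Integration.integral_diff[OF p, symmetric]) (simp add: d[symmetric])
  moreover have "has_bochner_integral lborel (\<lambda>t. indicator {0<..<T} t * (LINT x|K t. f (t, x)))
    ((LINT z|spacetime T K. max 0 (f z)) - (LINT z|spacetime T K. max 0 (- f z)))"
  proof (rule has_bochner_integralI_AE[OF has_bochner_integral_diff[OF P(2) N(2)]])
    show "AE t in lborel. indicator {0<..<T} t * (LINT x|K t. max 0 (f (t, x))) -
       indicator {0<..<T} t * (LINT x|K t. max 0 (- f (t, x))) =
       indicator {0<..<T} t * (LINT x|K t. f (t, x))"
      using ae2 by eventually_elim (auto simp: indicator_def)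
  qed (use m in auto)
  ultimately show "has_bochner_integral lborel (\<lambda>t. indicator {0<..<T} t * (LINT x|K t. f (t, x)))
        (LINT z|spacetime T K. f z)" by simp
qed

end

section \<open>Curves solving the continuity equation\<close>

text \<open>The kernel is the derivative of a rescaled \<open>sstep\<close>: nonnegative, carried by
  \<open>[r, r + \<epsilon> n]\<close>, and of mass 1 because \<open>sstep\<close> climbs from 0 to
  1 there. So the average differs from \<open>f r\<close> by no more than the oscillation of
  \<open>f\<close> just to the right of \<open>r\<close>.\<close>

lemma approximate_identity:
  fixes f :: "real \<Rightarrow> real"
  assumes f: "continuous_on {0..<1} f" and r: "0 < r" "r < T" "T \<le> 1"
    and \<epsilon>: "\<epsilon> \<longlonglongrightarrow> 0" "\<And>n. 0 < \<epsilon> n" "\<And>n. r + \<epsilon> n < T"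
  shows "(\<lambda>n. LINT t|lborel. indicator {0<..<T} t * (sstep' ((t - r) / \<epsilon> n) / \<epsilon> n * f t)) \<longlonglongrightarrow> f r"
proof (rule LIMSEQ_I)
  fix e :: real assume e: "0 < e"
  have "r \<in> {0..<1}" "0 < e / 2" using r e by auto
  then have "\<exists>d>0. \<forall>t\<in>{0..<1}. \<bar>t - r\<bar> < d \<longrightarrow> \<bar>f t - f r\<bar> < e / 2"
    using f unfolding continuous_on_iff dist_real_def by blast
  then obtain d where d: "0 < d" "\<And>t. t \<in> {0..<1} \<Longrightarrow> \<bar>t - r\<bar> < d \<Longrightarrow> \<bar>f t - f r\<bar> < e / 2"
    by blast
  have "eventually (\<lambda>n. \<epsilon> n < d) sequentially"
    by (rule order_tendstoD(2)[OF \<epsilon>(1) d(1)])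
  then obtain N where N: "\<And>n. N \<le> n \<Longrightarrow> \<epsilon> n < d"
    by (auto simp: eventually_sequentially)
  have "\<bar>(LINT t|lborel. indicator {0<..<T} t * (sstep' ((t - r) / \<epsilon> n) / \<epsilon> n * f t)) - f r\<bar> < e"
    if n: "N \<le> n" for n
  proof -
    define k where "k t = sstep' ((t - r) / \<epsilon> n) / \<epsilon> n * indicator {r..r + \<epsilon> n} t" for t
    have dk: "((\<lambda>t. sstep ((t - r) / \<epsilon> n)) has_real_derivative sstep' ((t - r) / \<epsilon> n) / \<epsilon> n) (at t)" for t
    proof -
      have "((\<lambda>t. (t - r) / \<epsilon> n) has_real_derivative 1 / \<epsilon> n) (at t)"
        using \<epsilon>(2)[of n] by (auto intro!: derivative_eq_intros)
      from DERIV_chain2[OF sstep_deriv this] show ?thesis by simp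
    qed
    have ck: "isCont (\<lambda>t. sstep' ((t - r) / \<epsilon> n) / \<epsilon> n) t" for t
    proof -
      have "continuous_on UNIV (\<lambda>t. sstep' ((t - r) / \<epsilon> n) / \<epsilon> n)"
        using \<epsilon>(2)[of n]
        by (auto intro!: continuous_intros continuous_on_compose2[OF continuous_sstep'[of UNIV]])
      then show ?thesis by (simp add: continuous_on_eq_continuous_at)
    qed
    have k: "has_bochner_integral lborel k 1"
      using has_bochner_integral_FTC_Icc_real[OF _ dk ck, of r "r + \<epsilon> n"] \<epsilon>(2)[of n]
      by (simp add: sstep_eq_0 sstep_eq_1 k_def[abs_def])
    have k0: "0 \<le> k t" for t using \<epsilon>(2)[of n] by (simp add: k_def sstep'_nonneg)
    have zero: "sstep' ((t - r) / \<epsilon> n) = 0" if "t \<notin> {r..r + \<epsilon> n}" for t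
      using that \<epsilon>(2)[of n] by (intro sstep'_eq_0) (auto simp: divide_le_0_iff le_divide_eq)
    have eq: "indicator {0<..<T} t * (sstep' ((t - r) / \<epsilon> n) / \<epsilon> n * f t) = k t * f t" for t
      using r \<epsilon>(3)[of n] zero[of t] by (auto simp: indicator_def k_def)
    have "continuous_on {r..r + \<epsilon> n} (\<lambda>t. sstep' ((t - r) / \<epsilon> n) / \<epsilon> n * f t)"
      using \<epsilon>(3)[of n] r
      by (intro continuous_intros continuous_at_imp_continuous_on[of _ "\<lambda>t. sstep' ((t - r) / \<epsilon> n) / \<epsilon> n"] ballI ck
          continuous_on_subset[OF f]) auto
    then have "integrable lborel (\<lambda>t. indicator {r..r + \<epsilon> n} t *\<^sub>R (sstep' ((t - r) / \<epsilon> n) / \<epsilon> n * f t))"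
      by (rule borel_integrable_compact[OF compact_Icc])
    then have i: "integrable lborel (\<lambda>t. k t * f t)"
      by (rule Bochner_Integration.integrable_cong[THEN iffD1, rotated 2]) (simp_all add: k_def)
    have i1: "integrable lborel k" "(LINT t|lborel. k t) = 1"
      using k by (simp_all add: has_bochner_integral_iff)
    have "(LINT t|lborel. k t * f t) - f r = (LINT t|lborel. k t * f t - f r * k t)"
      using i1 by (subst Bochner_Integration.integral_diff[OF i]) auto
    also have "\<bar>\<dots>\<bar> \<le> (LINT t|lborel. (e / 2) * k t)"
    proof (rule integral_abs_bound_integral)
      show "integrable lborel (\<lambda>t. k t * f t - f r * k t)" using i i1 by auto
      show "integrable lborel (\<lambda>t. e / 2 * k t)" using i1 by auto
      show "\<bar>k t * f t - f r * k t\<bar> \<le> e / 2 * k t" if "t \<in> space lborel" for t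
      proof (cases "t \<in> {r..r + \<epsilon> n}")
        case True
        then have "\<bar>f t - f r\<bar> \<le> e / 2"
          using d(2)[of t] N[OF n] r \<epsilon>(3)[of n] by auto
        then have "k t * \<bar>f t - f r\<bar> \<le> k t * (e / 2)" by (rule mult_left_mono) (rule k0)
        moreover have "\<bar>k t * f t - f r * k t\<bar> = k t * \<bar>f t - f r\<bar>"
        proof -
          have "k t * f t - f r * k t = k t * (f t - f r)" by (simp only: algebra_simps)
          then show ?thesis using k0[of t] by (simp add: abs_mult)
        qed
        ultimately show ?thesis by (simp only: mult.commute)
      qed (simp add: k_def)
    qed
    also have "\<dots> = e / 2" using i1(2) by simp
    finally show ?thesis unfolding eq using e by linarith
  qed
  then show "\<exists>N. \<forall>n\<ge>N. norm ((LINT t|lborel. indicator {0<..<T} t *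
      (sstep' ((t - r) / \<epsilon> n) / \<epsilon> n * f t)) - f r) < e"
    by auto
qed

section \<open>The continuity equation between two times\<close>

text \<open>One slab (0,T) with T < 1, on which the energy is finite. The equation is stated for
  products of a time factor and a space factor, with an explicit \<open>G\<close> in place of
  \<open>gradient\<close>; the condition \<open>d < T\<close> keeps the support of the time factor
  inside the slab.\<close>

locale curve = borel_kernel K
  for K :: "real \<Rightarrow> 'a::euclidean_space measure" +
  fixes u :: "real \<times> 'a \<Rightarrow> 'a" and T :: real
  assumes T: "0 < T" "T < 1"
    and moments: "\<And>t. K t \<in> P2"
    and abs_cont: "\<And>t A. A \<in> null_sets lborel \<Longrightarrow> A \<in> null_sets (K t)"
    and narrow: "narrowly_continuous_on {0..<1} K"
    and measurable_u [measurable]: "u \<in> borel_measurable (borel \<Otimes>\<^sub>M borel)"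
    and energy: "integrable (spacetime T K) (\<lambda>z. (norm (u z))\<^sup>2)"
    and continuity_eq: "\<And>\<alpha> \<alpha>' \<phi> G c d R. \<lbrakk>smooth \<alpha>; \<And>t. (\<alpha> has_real_derivative \<alpha>' t) (at t);
        0 < c; d < T; \<And>t. \<alpha> t \<noteq> 0 \<Longrightarrow> t \<in> {c..d}; smooth \<phi>;
        \<And>x. (\<phi> has_derivative (\<lambda>h. G x \<bullet> h)) (at x); \<And>x. \<phi> x \<noteq> 0 \<Longrightarrow> norm x \<le> R\<rbrakk> \<Longrightarrow>
      (LINT z|spacetime T K. \<alpha>' (fst z) * \<phi> (snd z) + \<alpha> (fst z) * (G (snd z) \<bullet> u z)) = 0"
begin

abbreviation "L \<equiv> spacetime T K"

lemma T_le: "T \<le> 1" using T by simp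

sublocale K: prob_space "K t" for t by (rule kernel_prob_space)
sublocale L: finite_measure L by (rule finite_measure_spacetime[OF T_le])

lemmas nn_integral_L = nn_integral_spacetime[where T=T]
lemmas AE_L = AE_spacetime[where T=T]
lemmas AE_integrable_L = AE_integrable_spacetime[where T=T]
lemmas integral_L = has_bochner_integral_spacetime[where T=T]

lemma integrable_norm_sq_K: "integrable (K t) (\<lambda>x. (norm x)\<^sup>2)"
  using moments by (simp add: P2_def)

lemma integrable_norm_u: "integrable L (\<lambda>z. norm (u z))"
  by (rule L.integrable_of_square[OF _ energy]) simp

text \<open>The equation for one space function, integrated in time. \<open>G\<close> need not be a
  classical gradient: the relation passes to pointwise limits under growth bounds, which is how
  kinked functions such as hinges are reached.\<close>

definition transports :: "('a \<Rightarrow> real) \<Rightarrow> ('a \<Rightarrow> 'a) \<Rightarrow> bool" where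
  "transports \<phi> G \<longleftrightarrow> (\<forall>t. integrable (K t) \<phi>) \<and> integrable L (\<lambda>z. G (snd z) \<bullet> u z) \<and>
     (\<forall>s t. 0 \<le> s \<longrightarrow> s \<le> t \<longrightarrow> t < T \<longrightarrow> (LINT x|K t. \<phi> x) - (LINT x|K s. \<phi> x) =
        (LINT z|L. indicator {s<..t} (fst z) * (G (snd z) \<bullet> u z)))"

lemma narrowD:
  assumes "continuous_on UNIV f" "bounded (range f)"
  shows "continuous_on {0..<1} (\<lambda>t. LINT x|K t. f x :: real)"
  using narrow assms by (simp add: narrowly_continuous_on_def)

lemma integrable_bounded_u:
  assumes [measurable]: "f \<in> borel_measurable (borel \<Otimes>\<^sub>M borel)" and "\<And>z. norm (f z) \<le> C"
  shows "integrable L (\<lambda>z. f z \<bullet> u z)"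
proof (rule Bochner_Integration.integrable_bound[OF integrable_mult_right[of C, OF integrable_norm_u]])
  show "AE z in L. norm (f z \<bullet> u z) \<le> norm (C * norm (u z))"
  proof (rule AE_I2)
    fix z
    have "norm (f z \<bullet> u z) \<le> norm (f z) * norm (u z)"
      using Cauchy_Schwarz_ineq2[of "f z" "u z"] by simp
    also have "\<dots> \<le> C * norm (u z)" by (intro mult_right_mono assms(2)) simp
    finally show "norm (f z \<bullet> u z) \<le> norm (C * norm (u z))" by simp
  qed
qed simp

text \<open>The time factor is a smoothed indicator of the interval from \<open>s\<close> to
  \<open>t\<close>. Its derivative is an approximate identity at \<open>s\<close> minus one at
  \<open>t\<close>, so the equation relates averages of \<open>M\<close> near the two times to the
  flux; narrow continuity of \<open>M\<close> lets the smoothing width tend to 0.\<close>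

lemma transports_compact_support:
  assumes \<phi>: "smooth \<phi>" "\<And>x. (\<phi> has_derivative (\<lambda>h. G x \<bullet> h)) (at x)"
    and supp: "\<And>x. \<phi> x \<noteq> 0 \<Longrightarrow> norm x \<le> R"
  shows "transports \<phi> G"
proof -
  have c\<phi>: "continuous_on UNIV \<phi>" using \<phi>(1) by (rule smooth_imp_continuous)
  have G: "continuous_on UNIV G"
  proof -
    obtain G' where G': "\<And>x. (\<phi> has_derivative (\<lambda>h. G' x \<bullet> h)) (at x)" "continuous_on UNIV G'"
      using smooth_gradientE[OF \<phi>(1)] by blast
    have "G x = G' x" for x
      using fun_cong[OF has_derivative_unique[OF \<phi>(2) G'(1), of x]] vector_eq_rdot[of "G x" "G' x"] by blast
    then have "G = G'" by (rule ext)
    then show ?thesis using G'(2) by simp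
  qed
  \<comment> \<open>Outside the ball \<open>\<phi>\<close> vanishes on an open set, hence so does
    its gradient; this makes \<open>G\<close> bounded.\<close>
  have G0: "G x = 0" if x: "R < norm x" for x
  proof -
    have "open {x::'a. R < norm x}" by (intro open_Collect_less continuous_intros)
    then have "((\<lambda>x. 0) has_derivative (\<lambda>h. G x \<bullet> h)) (at x)"
      by (rule has_derivative_transform_within_open[OF \<phi>(2)]) (use x supp in force)+
    then have "(\<lambda>h. G x \<bullet> h) = (\<lambda>h. 0)"
      by (rule has_derivative_unique) (rule has_derivative_const)
    then have "G x \<bullet> G x = 0" by (rule fun_cong)
    then show ?thesis by simp
  qed
  have "compact (cball 0 R :: 'a set)" by simp
  then have "bounded (\<phi> ` cball 0 R)" "bounded (G ` cball 0 R)"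
    using c\<phi> G by (blast intro: compact_imp_bounded compact_continuous_image continuous_on_subset subset_UNIV)+
  then obtain C D where CD: "\<forall>x\<in>cball 0 R. \<bar>\<phi> x\<bar> \<le> C" "\<forall>x\<in>cball 0 R. norm (G x) \<le> D"
    unfolding bounded_iff by auto
  have C: "\<bar>\<phi> x\<bar> \<le> max 0 C" and D: "norm (G x) \<le> max 0 D" for x
  proof -
    show "\<bar>\<phi> x\<bar> \<le> max 0 C"
    proof (cases "\<phi> x = 0")
      case False
      then have "x \<in> cball 0 R" using supp by simp
      then show ?thesis using CD(1) by (simp add: le_max_iff_disj)
    qed simp
    show "norm (G x) \<le> max 0 D"
    proof (cases "G x = 0")
      case False
      then have "x \<in> cball 0 R" using G0[of x] by (cases "norm x \<le> R") auto
      then show ?thesis using CD(2) by (simp add: le_max_iff_disj)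
    qed simp
  qed
  have [measurable]: "\<phi> \<in> borel_measurable borel" "G \<in> borel_measurable borel"
    using c\<phi> G by (simp_all add: borel_measurable_continuous_onI)
  have int\<phi>: "integrable (K t) \<phi>" for t
    by (rule K.integrable_const_bound[where B="max 0 C"]) (use C in auto)
  have intG: "integrable L (\<lambda>z. G (snd z) \<bullet> u z)"
    by (rule integrable_bounded_u[of _ "max 0 D"]) (simp_all add: D)
  define M where "M t = (LINT x|K t. \<phi> x)" for t
  have cM: "continuous_on {0..<1} M" unfolding M_def
    by (rule narrowD[OF c\<phi>]) (use C in \<open>auto simp: bounded_iff\<close>)
  have pos: "M t - M s = (LINT z|L. indicator {s<..t} (fst z) * (G (snd z) \<bullet> u z))"
    if st: "0 < s" "s \<le> t" "t < T" for s t
  proof (cases "s = t")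
    case False
    \<comment> \<open>The factor \<open>(T - t) / 2\<close> leaves room for the smoothing to the
      right of \<open>t\<close> within the slab.\<close>
    define \<epsilon> where "\<epsilon> n = (T - t) / 2 * inverse (real (Suc n))" for n
    have \<epsilon>: "0 < \<epsilon> n" "t + \<epsilon> n < T" for n
    proof -
      show "0 < \<epsilon> n" using st by (simp add: \<epsilon>_def)
      have "inverse (real (Suc n)) \<le> 1" by (simp add: inverse_le_1_iff)
      then have "\<epsilon> n \<le> (T - t) / 2 * 1" unfolding \<epsilon>_def using st by (intro mult_left_mono) auto
      then show "t + \<epsilon> n < T" using st by simp
    qed
    have \<epsilon>0: "\<epsilon> \<longlonglongrightarrow> 0"
      unfolding \<epsilon>_def by (rule tendsto_mult_right_zero[OF LIMSEQ_inverse_real_of_nat])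
    define \<alpha> where "\<alpha> n \<tau> = sstep ((\<tau> - s) / \<epsilon> n) - sstep ((\<tau> - t) / \<epsilon> n)" for n \<tau>
    define \<alpha>' where "\<alpha>' n \<tau> = sstep' ((\<tau> - s) / \<epsilon> n) / \<epsilon> n - sstep' ((\<tau> - t) / \<epsilon> n) / \<epsilon> n" for n \<tau>
    have lin: "smooth (\<lambda>\<tau>. (\<tau> - r) / \<epsilon> n)" for r n
      using smooth_mult[OF smooth_const[of "1 / \<epsilon> n"] smooth_diff[OF smooth_id smooth_const[of r]]]
      by simp
    have \<alpha>_smooth: "smooth (\<alpha> n)" for n
      unfolding \<alpha>_def[abs_def] by (intro smooth_diff smooth_compose[OF smooth_sstep lin])
    have \<alpha>_deriv: "(\<alpha> n has_real_derivative \<alpha>' n \<tau>) (at \<tau>)" for n \<tau>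
    proof -
      have "((\<lambda>\<tau>. (\<tau> - r) / \<epsilon> n) has_real_derivative 1 / \<epsilon> n) (at \<tau>)" for r
        using \<epsilon>(1)[of n] by (auto intro!: derivative_eq_intros)
      from DERIV_diff[OF DERIV_chain2[OF sstep_deriv this] DERIV_chain2[OF sstep_deriv this]]
      show ?thesis unfolding \<alpha>_def[abs_def] \<alpha>'_def by simp
    qed
    have \<alpha>_supp: "\<tau> \<in> {s..t + \<epsilon> n}" if "\<alpha> n \<tau> \<noteq> 0" for n \<tau>
    proof (rule ccontr)
      assume "\<tau> \<notin> {s..t + \<epsilon> n}"
      then consider "\<tau> < s" | "t + \<epsilon> n < \<tau>" by fastforce
      then have "\<alpha> n \<tau> = 0"
      proof cases
        case 1
        then have "(\<tau> - s) / \<epsilon> n \<le> 0" "(\<tau> - t) / \<epsilon> n \<le> 0"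
          using \<epsilon>(1)[of n] st by (auto simp: divide_le_0_iff)
        then show ?thesis by (simp add: \<alpha>_def sstep_eq_0)
      next
        case 2
        then have "1 \<le> (\<tau> - s) / \<epsilon> n" "1 \<le> (\<tau> - t) / \<epsilon> n"
          using \<epsilon>(1)[of n] st by (auto simp: le_divide_eq)
        then show ?thesis by (simp add: \<alpha>_def sstep_eq_1)
      qed
      then show False using that by simp
    qed
    have \<alpha>_bound: "\<bar>\<alpha> n \<tau>\<bar> \<le> 1" for n \<tau>
      using sstep_nonneg[of "(\<tau> - s) / \<epsilon> n"] sstep_le_1[of "(\<tau> - s) / \<epsilon> n"]
        sstep_nonneg[of "(\<tau> - t) / \<epsilon> n"] sstep_le_1[of "(\<tau> - t) / \<epsilon> n"] by (simp add: \<alpha>_def)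
    \<comment> \<open>Since \<open>sstep\<close> vanishes at 0, the limit is the indicator of the
      open half-line; the difference of two such limits is the half-open interval
      \<open>{s<..t}\<close>.\<close>
    have step_lim: "(\<lambda>n. sstep ((\<tau> - r) / \<epsilon> n)) \<longlonglongrightarrow> indicator {r<..} \<tau>" for \<tau> r
    proof (cases "r < \<tau>")
      case True
      have "eventually (\<lambda>n. \<epsilon> n < \<tau> - r) sequentially"
        using order_tendstoD(2)[OF \<epsilon>0, of "\<tau> - r"] True by simp
      then have "eventually (\<lambda>n. sstep ((\<tau> - r) / \<epsilon> n) = 1) sequentially"
      proof eventually_elim
        case (elim n)
        then show ?case using \<epsilon>(1)[of n] by (intro sstep_eq_1) (simp add: le_divide_eq)
      qed
      then show ?thesis using True by (simp add: tendsto_eventually)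
    next
      case False
      then have "sstep ((\<tau> - r) / \<epsilon> n) = 0" for n
        using \<epsilon>(1)[of n] by (intro sstep_eq_0) (auto simp: divide_le_0_iff)
      then show ?thesis using False by simp
    qed
    have \<alpha>_lim: "(\<lambda>n. \<alpha> n \<tau>) \<longlonglongrightarrow> indicator {s<..t} \<tau>" for \<tau>
    proof -
      have "indicator {s<..t} \<tau> = (indicator {s<..} \<tau> - indicator {t<..} \<tau> :: real)"
        using st by (auto simp: indicator_def)
      then show ?thesis unfolding \<alpha>_def by (simp only:) (intro tendsto_diff step_lim)
    qed
    have [measurable]: "\<alpha> n \<in> borel_measurable borel" "\<alpha>' n \<in> borel_measurable borel" for n
    proof -
      show "\<alpha> n \<in> borel_measurable borel"
        by (rule borel_measurable_continuous_onI[OF smooth_imp_continuous[OF \<alpha>_smooth]])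
      have [measurable]: "sstep' \<in> borel_measurable borel"
        by (rule borel_measurable_continuous_onI[OF continuous_sstep'])
      show "\<alpha>' n \<in> borel_measurable borel" unfolding \<alpha>'_def[abs_def] by measurable
    qed
    obtain S where S: "\<And>t. \<bar>sstep' t\<bar> \<le> S" "0 \<le> S" using sstep'_bounded by blast
    have \<epsilon>s: "s + \<epsilon> n < T" for n using \<epsilon>(2)[of n] st by linarith
    have sM: "(\<lambda>n. LINT \<tau>|lborel. indicator {0<..<T} \<tau> * (sstep' ((\<tau> - s) / \<epsilon> n) / \<epsilon> n * M \<tau>)) \<longlonglongrightarrow> M s"
      by (rule approximate_identity[OF cM _ _ T_le \<epsilon>0 \<epsilon>(1)])
        (use st \<epsilon>s in auto)
    have tM: "(\<lambda>n. LINT \<tau>|lborel. indicator {0<..<T} \<tau> * (sstep' ((\<tau> - t) / \<epsilon> n) / \<epsilon> n * M \<tau>)) \<longlonglongrightarrow> M t"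
      by (rule approximate_identity[OF cM _ _ T_le \<epsilon>0 \<epsilon>(1)]) (use st \<epsilon>(2) in auto)
    have eq: "(LINT \<tau>|lborel. indicator {0<..<T} \<tau> * (sstep' ((\<tau> - s) / \<epsilon> n) / \<epsilon> n * M \<tau>))
        - (LINT \<tau>|lborel. indicator {0<..<T} \<tau> * (sstep' ((\<tau> - t) / \<epsilon> n) / \<epsilon> n * M \<tau>))
        + (LINT z|L. \<alpha> n (fst z) * (G (snd z) \<bullet> u z)) = 0" for n
    proof -
      have [measurable]: "sstep' \<in> borel_measurable borel"
        by (rule borel_measurable_continuous_onI[OF continuous_sstep'])
      define k where "k r z = sstep' ((fst z - r) / \<epsilon> n) / \<epsilon> n * \<phi> (snd z)" for r and z :: "real \<times> 'a"
      have ik: "integrable L (k r)" for r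
      proof (rule L.integrable_const_bound[of _ "S / \<epsilon> n * max 0 C"])
        show "AE z in L. norm (k r z) \<le> S / \<epsilon> n * max 0 C"
          using S C \<epsilon>(1)[of n]
          by (intro AE_I2) (auto simp: k_def abs_mult intro!: mult_mono divide_right_mono)
        show "k r \<in> borel_measurable L" unfolding k_def[abs_def] by measurable
      qed
      have i2: "integrable L (\<lambda>z. \<alpha> n (fst z) * (G (snd z) \<bullet> u z))"
      proof (rule Bochner_Integration.integrable_bound[OF intG])
        show "AE z in L. norm (\<alpha> n (fst z) * (G (snd z) \<bullet> u z)) \<le> norm (G (snd z) \<bullet> u z)"
          using mult_right_mono[OF \<alpha>_bound, of "\<bar>_\<bar>"] by (intro AE_I2) (auto simp: abs_mult)
      qed measurable
      have ke: "(LINT z|L. k r z) = (LINT \<tau>|lborel. indicator {0<..<T} \<tau> * (sstep' ((\<tau> - r) / \<epsilon> n) / \<epsilon> n * M \<tau>))" for r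
        using has_bochner_integral_integral_eq[OF integral_L[OF ik[of r]]]
        unfolding k_def M_def fst_conv snd_conv by (simp only: integral_mult_right_zero)
      have "(LINT z|L. \<alpha>' n (fst z) * \<phi> (snd z) + \<alpha> n (fst z) * (G (snd z) \<bullet> u z)) = 0"
        by (rule continuity_eq[OF \<alpha>_smooth \<alpha>_deriv _ _ \<alpha>_supp \<phi> supp]) (use st \<epsilon>(2) in auto)
      moreover have "\<alpha>' n (fst z) * \<phi> (snd z) = k s z - k t z" for z
        by (simp add: \<alpha>'_def k_def left_diff_distrib)
      ultimately show ?thesis
        using ik i2 by (simp add: ke Bochner_Integration.integral_add Bochner_Integration.integral_diff)
    qed
    have "(\<lambda>n. LINT z|L. \<alpha> n (fst z) * (G (snd z) \<bullet> u z)) \<longlonglongrightarrow>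
        (LINT z|L. indicator {s<..t} (fst z) * (G (snd z) \<bullet> u z))"
    proof (rule integral_dominated_convergence[where w="\<lambda>z. \<bar>G (snd z) \<bullet> u z\<bar>"])
      show "AE z in L. (\<lambda>n. \<alpha> n (fst z) * (G (snd z) \<bullet> u z)) \<longlonglongrightarrow>
          indicator {s<..t} (fst z) * (G (snd z) \<bullet> u z)"
        by (intro AE_I2 tendsto_mult_right \<alpha>_lim)
      show "AE z in L. norm (\<alpha> n (fst z) * (G (snd z) \<bullet> u z)) \<le> \<bar>G (snd z) \<bullet> u z\<bar>" for n
        using mult_right_mono[OF \<alpha>_bound, of "\<bar>_\<bar>"] by (intro AE_I2) (auto simp: abs_mult)
    qed (use intG in auto)
    from tendsto_add[OF tendsto_diff[OF sM tM] this] have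
      "(\<lambda>n. 0) \<longlonglongrightarrow> M s - M t + (LINT z|L. indicator {s<..t} (fst z) * (G (snd z) \<bullet> u z))"
      unfolding eq .
    then show ?thesis by (simp add: LIMSEQ_const_iff)
  qed simp
  have "M t - M s = (LINT z|L. indicator {s<..t} (fst z) * (G (snd z) \<bullet> u z))"
    if st: "0 \<le> s" "s \<le> t" "t < T" for s t
  proof (cases "0 < s \<or> s = t")
    case True
    then show ?thesis using pos st by (cases "s = t") auto
  next
    case False
    then have s: "s = 0" "0 < t" using st by auto
    \<comment> \<open>Test functions vanish near time 0, so the initial time is reached by a
      sequence decreasing to 0, again through narrow continuity of \<open>M\<close>.\<close>
    define \<sigma> where "\<sigma> n = t * inverse (real (Suc n))" for n
    have \<sigma>: "0 < \<sigma> n" "\<sigma> n \<le> t" for n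
    proof -
      show "0 < \<sigma> n" using s by (simp add: \<sigma>_def)
      have "inverse (real (Suc n)) \<le> 1" by (simp add: inverse_le_1_iff)
      then have "\<sigma> n \<le> t * 1" unfolding \<sigma>_def using s by (intro mult_left_mono) auto
      then show "\<sigma> n \<le> t" by simp
    qed
    have \<sigma>0: "\<sigma> \<longlonglongrightarrow> 0"
      unfolding \<sigma>_def by (rule tendsto_mult_right_zero[OF LIMSEQ_inverse_real_of_nat])
    have "(\<lambda>n. M (\<sigma> n)) \<longlonglongrightarrow> M 0"
    proof -
      have *: "\<sigma> n \<in> {0..<1}" for n using \<sigma>[of n] st T by auto
      show ?thesis
        by (rule continuous_on_tendsto_compose[OF cM \<sigma>0]) (use * in auto)
    qed
    then have "(\<lambda>n. M t - M (\<sigma> n)) \<longlonglongrightarrow> M t - M 0" by (intro tendsto_intros)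
    moreover have "(\<lambda>n. M t - M (\<sigma> n)) \<longlonglongrightarrow> (LINT z|L. indicator {0<..t} (fst z) * (G (snd z) \<bullet> u z))"
    proof -
      have lim: "(\<lambda>n. indicator {\<sigma> n<..t} \<tau>) \<longlonglongrightarrow> (indicator {0<..t} \<tau> :: real)" for \<tau>
      proof (cases "0 < \<tau>")
        case True
        then have "eventually (\<lambda>n. \<sigma> n < \<tau>) sequentially" using order_tendstoD(2)[OF \<sigma>0] by simp
        then have "eventually (\<lambda>n. indicator {\<sigma> n<..t} \<tau> = (indicator {0<..t} \<tau> :: real)) sequentially"
          by eventually_elim (use True in \<open>auto simp: indicator_def\<close>)
        then show ?thesis by (rule tendsto_eventually)
      next
        case False
        then have "indicator {\<sigma> n<..t} \<tau> = (0::real)" for n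
          using \<sigma>(1)[of n] by (auto simp: indicator_def)
        then show ?thesis using False by simp
      qed
      have "(\<lambda>n. LINT z|L. indicator {\<sigma> n<..t} (fst z) * (G (snd z) \<bullet> u z)) \<longlonglongrightarrow>
        (LINT z|L. indicator {0<..t} (fst z) * (G (snd z) \<bullet> u z))"
      proof (rule integral_dominated_convergence[where w="\<lambda>z. \<bar>G (snd z) \<bullet> u z\<bar>"])
        show "AE z in L. (\<lambda>n. indicator {\<sigma> n<..t} (fst z) * (G (snd z) \<bullet> u z)) \<longlonglongrightarrow>
            indicator {0<..t} (fst z) * (G (snd z) \<bullet> u z)"
          by (intro AE_I2 tendsto_mult_right lim)
        show "AE z in L. norm (indicator {\<sigma> n<..t} (fst z) * (G (snd z) \<bullet> u z)) \<le> \<bar>G (snd z) \<bullet> u z\<bar>" for n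
          by (intro AE_I2) (auto simp: indicator_def)
      qed (use intG in auto)
      then show ?thesis using pos[OF \<sigma>(1) \<sigma>(2) st(3)] by simp
    qed
    ultimately show ?thesis unfolding s by (rule LIMSEQ_unique)
  qed
  then show ?thesis using int\<phi> intG unfolding transports_def M_def by blast
qed

lemma transports_const: "transports (\<lambda>x. c) (\<lambda>x. 0)"
  using K.prob_space by (simp add: transports_def)

lemma integrable_time_slab:
  fixes f :: "real \<times> 'a \<Rightarrow> real"
  assumes "integrable L f"
  shows "integrable L (\<lambda>z. indicator {s<..t} (fst z) * f z)"
proof (rule Bochner_Integration.integrable_bound[OF assms])
  have [measurable]: "f \<in> borel_measurable (borel \<Otimes>\<^sub>M borel)"
    using borel_measurable_integrable[OF assms] by (simp cong: measurable_cong_sets)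
  show "(\<lambda>z. indicator {s<..t} (fst z) * f z) \<in> borel_measurable L" by measurable
qed (auto simp: indicator_def)

lemma transports_diff:
  assumes "transports \<phi> G" "transports \<psi> H"
  shows "transports (\<lambda>x. \<phi> x - \<psi> x) (\<lambda>x. G x - H x)"
proof -
  have i: "integrable (K t) \<phi>" "integrable (K t) \<psi>"
    "integrable L (\<lambda>z. G (snd z) \<bullet> u z)" "integrable L (\<lambda>z. H (snd z) \<bullet> u z)" for t
    using assms by (auto simp: transports_def)
  have "(LINT x|K t. \<phi> x - \<psi> x) - (LINT x|K s. \<phi> x - \<psi> x) =
      (LINT z|L. indicator {s<..t} (fst z) * ((G (snd z) - H (snd z)) \<bullet> u z))"
    if st: "0 \<le> s" "s \<le> t" "t < T" for s t
  proof -
    have "(LINT x|K t. \<phi> x) - (LINT x|K s. \<phi> x) = (LINT z|L. indicator {s<..t} (fst z) * (G (snd z) \<bullet> u z))"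
      "(LINT x|K t. \<psi> x) - (LINT x|K s. \<psi> x) = (LINT z|L. indicator {s<..t} (fst z) * (H (snd z) \<bullet> u z))"
      using assms st by (auto simp: transports_def)
    then show ?thesis
      using i by (simp add: inner_diff_left right_diff_distrib Bochner_Integration.integral_diff integrable_time_slab)
  qed
  then show ?thesis using i by (simp add: transports_def inner_diff_left)
qed

text \<open>The growth rates are those that can be dominated: \<open>1 + |x|^2\<close> by the second
  moment of each \<open>K t\<close>, and \<open>(1 + |x|) |u|\<close> by second moment and energy
  together. The second moment over the slab is a premise here because it is itself derived from
  transported truncations.\<close>

lemma transports_limit:
  assumes tr: "\<And>n. transports (\<phi> n) (G n)"
    and [measurable]: "\<phi>' \<in> borel_measurable borel" "G' \<in> borel_measurable borel"
      "\<And>n. \<phi> n \<in> borel_measurable borel" "\<And>n. G n \<in> borel_measurable borel"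
    and lim: "\<And>x. (\<lambda>n. \<phi> n x) \<longlonglongrightarrow> \<phi>' x" "\<And>x. (\<lambda>n. G n x) \<longlonglongrightarrow> G' x"
    and bound: "\<And>n x. \<bar>\<phi> n x\<bar> \<le> c * (1 + (norm x)\<^sup>2)" "\<And>n x. norm (G n x) \<le> c * (1 + norm x)"
    and M2: "integrable L (\<lambda>z. (norm (snd z))\<^sup>2)"
  shows "transports \<phi>' G'"
proof -
  have c1: "integrable (K t) (\<lambda>x. c * (1 + (norm x)\<^sup>2))" for t
    using integrable_norm_sq_K by auto
  have c2: "integrable L (\<lambda>z. c * (1 + norm (snd z)) * norm (u z))"
  proof -
    have "integrable L (\<lambda>z. norm (snd z) * norm (u z))"
      by (rule integrable_mult_square[OF _ _ M2 energy]) simp_all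
    then have "integrable L (\<lambda>z. c * (norm (u z) + norm (snd z) * norm (u z)))"
      using integrable_norm_u by auto
    then show ?thesis by (simp add: algebra_simps)
  qed
  have L1: "integrable (K t) \<phi>'" "(\<lambda>n. LINT x|K t. \<phi> n x) \<longlonglongrightarrow> (LINT x|K t. \<phi>' x)" for t
  proof -
    have *: "AE x in K t. (\<lambda>n. \<phi> n x) \<longlonglongrightarrow> \<phi>' x" "\<And>n. AE x in K t. norm (\<phi> n x) \<le> c * (1 + (norm x)\<^sup>2)"
      using lim(1) bound(1) by auto
    show "integrable (K t) \<phi>'" "(\<lambda>n. LINT x|K t. \<phi> n x) \<longlonglongrightarrow> (LINT x|K t. \<phi>' x)"
      by (rule integrable_dominated_convergence[OF _ _ c1 *] integral_dominated_convergence[OF _ _ c1 *]; simp)+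
  qed
  have b: "norm (G n (snd z) \<bullet> u z) \<le> c * (1 + norm (snd z)) * norm (u z)" for n z
  proof -
    have "norm (G n (snd z) \<bullet> u z) \<le> norm (G n (snd z)) * norm (u z)"
      using Cauchy_Schwarz_ineq2 by simp
    also have "\<dots> \<le> c * (1 + norm (snd z)) * norm (u z)" by (intro mult_right_mono bound) simp
    finally show ?thesis .
  qed
  have L2: "integrable L (\<lambda>z. G' (snd z) \<bullet> u z)"
  proof (rule integrable_dominated_convergence[OF _ _ c2])
    show "AE z in L. (\<lambda>n. G n (snd z) \<bullet> u z) \<longlonglongrightarrow> G' (snd z) \<bullet> u z"
      by (intro AE_I2 tendsto_inner lim tendsto_const)
    show "AE z in L. norm (G n (snd z) \<bullet> u z) \<le> c * (1 + norm (snd z)) * norm (u z)" for n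
      using b by simp
  qed measurable
  have L3: "(\<lambda>n. LINT z|L. indicator {s<..t} (fst z) * (G n (snd z) \<bullet> u z)) \<longlonglongrightarrow>
      (LINT z|L. indicator {s<..t} (fst z) * (G' (snd z) \<bullet> u z))" for s t
  proof (rule integral_dominated_convergence[OF _ _ c2])
    show "AE z in L. (\<lambda>n. indicator {s<..t} (fst z) * (G n (snd z) \<bullet> u z)) \<longlonglongrightarrow>
        indicator {s<..t} (fst z) * (G' (snd z) \<bullet> u z)"
      by (intro AE_I2 tendsto_intros lim)
    show "AE z in L. norm (indicator {s<..t} (fst z) * (G n (snd z) \<bullet> u z)) \<le> c * (1 + norm (snd z)) * norm (u z)" for n
    proof (rule AE_I2)
      fix z
      have "norm (indicator {s<..t} (fst z) * (G n (snd z) \<bullet> u z)) \<le> norm (G n (snd z) \<bullet> u z)"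
        by (simp add: indicator_def)
      also note b
      finally show "norm (indicator {s<..t} (fst z) * (G n (snd z) \<bullet> u z)) \<le> c * (1 + norm (snd z)) * norm (u z)" .
    qed
  qed measurable
  have "(LINT x|K t. \<phi>' x) - (LINT x|K s. \<phi>' x) =
      (LINT z|L. indicator {s<..t} (fst z) * (G' (snd z) \<bullet> u z))" if st: "0 \<le> s" "s \<le> t" "t < T" for s t
  proof (rule LIMSEQ_unique)
    show "(\<lambda>n. (LINT x|K t. \<phi> n x) - (LINT x|K s. \<phi> n x)) \<longlonglongrightarrow> (LINT x|K t. \<phi>' x) - (LINT x|K s. \<phi>' x)"
      by (intro tendsto_diff L1)
    show "(\<lambda>n. (LINT x|K t. \<phi> n x) - (LINT x|K s. \<phi> n x)) \<longlonglongrightarrow>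
        (LINT z|L. indicator {s<..t} (fst z) * (G' (snd z) \<bullet> u z))"
      using L3[of s t] tr st by (simp add: transports_def)
  qed
  then show ?thesis using L1(1) L2 by (simp add: transports_def)
qed

end

section \<open>Truncated identity and smoothed positive part\<close>

text \<open>A smooth concave truncation of the identity on the half-line, with slope 1 up to 1 and
  slope 0 from 2 on. Concavity enters as \<open>plateau_ge\<close>: \<open>w\<close> times the slope
  at \<open>w\<close> is at most the value at \<open>w\<close>.\<close>

definition plateau :: "real \<Rightarrow> real" where
  "plateau = antideriv (\<lambda>w. 1 - sstep (w - 1))"

lemma smooth_sstep_shift: "smooth (\<lambda>w. 1 - sstep (w - 1))"
  by (rule smooth_diff[OF smooth_const smooth_compose[OF smooth_sstep smooth_diff[OF smooth_id smooth_const]]])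

lemma plateau_deriv: "(plateau has_real_derivative 1 - sstep (w - 1)) (at w)"
  unfolding plateau_def by (rule antideriv_deriv[OF smooth_imp_continuous[OF smooth_sstep_shift]])

lemma smooth_plateau: "smooth plateau"
  by (rule smooth_antideriv[OF plateau_deriv smooth_sstep_shift])

lemma plateau_0: "plateau 0 = 0"
  unfolding plateau_def by (rule antideriv_0[OF smooth_imp_continuous[OF smooth_sstep_shift]])

lemma plateau_mvt:
  assumes "a < b"
  obtains z where "a < z" "z < b" "plateau b - plateau a = (b - a) * (1 - sstep (z - 1))"
  using MVT2[OF assms, of plateau "\<lambda>w. 1 - sstep (w - 1)"] plateau_deriv by blast

lemma plateau_const: "2 \<le> w \<Longrightarrow> plateau w = plateau 2"
proof (cases "w = 2")
  case False
  assume "2 \<le> w"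
  with False obtain z where "2 < z" "plateau w - plateau 2 = (w - 2) * (1 - sstep (z - 1))"
    using plateau_mvt[of 2 w] by auto
  then show ?thesis by (simp add: sstep_eq_1)
qed simp

lemma plateau_bounds:
  assumes "0 \<le> w"
  shows plateau_nonneg: "0 \<le> plateau w" and plateau_le: "plateau w \<le> w"
    and plateau_ge: "w * (1 - sstep (w - 1)) \<le> plateau w"
    and plateau_eq: "w \<le> 1 \<Longrightarrow> plateau w = w"
proof -
  have "0 \<le> plateau w \<and> plateau w \<le> w \<and> w * (1 - sstep (w - 1)) \<le> plateau w \<and> (w \<le> 1 \<longrightarrow> plateau w = w)"
  proof (cases "w = 0")
    case False
    then obtain z where z: "0 < z" "z < w" "plateau w = w * (1 - sstep (z - 1))"
      using plateau_mvt[of 0 w] assms plateau_0 by auto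
    have "sstep (z - 1) \<le> sstep (w - 1)" using z by (intro sstep_mono) simp
    then have "w * (1 - sstep (w - 1)) \<le> plateau w" using assms z by (simp add: mult_left_mono)
    moreover have "plateau w \<le> w * 1"
      unfolding z(3) using assms sstep_nonneg[of "z - 1"] by (intro mult_left_mono) auto
    moreover have "0 \<le> plateau w"
      unfolding z(3) using assms sstep_le_1[of "z - 1"] by simp
    moreover have "plateau w = w" if "w \<le> 1" using z that sstep_eq_0[of "z - 1"] by simp
    ultimately show ?thesis by simp
  qed (simp add: plateau_0)
  then show "0 \<le> plateau w" "plateau w \<le> w" "w * (1 - sstep (w - 1)) \<le> plateau w"
    "w \<le> 1 \<Longrightarrow> plateau w = w" by auto
qed

lemma plateau_le_2: "0 \<le> w \<Longrightarrow> plateau w \<le> 2"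
  using plateau_le[of w] plateau_le[of 2] plateau_const[of w] by (cases "2 \<le> w") auto

text \<open>A smoothed positive part. By \<open>ramp_bounds\<close> it is within 1 of
  \<open>max 0 w\<close>, so the rescaling \<open>\<epsilon> * ramp (a / \<epsilon>)\<close> is
  within \<open>\<epsilon>\<close> of \<open>max 0 a\<close>.\<close>

definition ramp :: "real \<Rightarrow> real" where "ramp = antideriv sstep"

lemma ramp_deriv: "(ramp has_real_derivative sstep w) (at w)"
  unfolding ramp_def by (rule antideriv_deriv[OF continuous_sstep])

lemma smooth_ramp: "smooth ramp"
  by (rule smooth_antideriv[OF ramp_deriv smooth_sstep])

lemma ramp_0: "ramp 0 = 0"
  unfolding ramp_def by (rule antideriv_0[OF continuous_sstep])

lemma ramp_mvt:
  assumes "a < b"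
  obtains z where "a < z" "z < b" "ramp b - ramp a = (b - a) * sstep z"
  using MVT2[OF assms, of ramp sstep] ramp_deriv by blast

lemma ramp_bounds: "0 \<le> ramp w" "ramp w \<le> max 0 w" "max 0 w - 1 \<le> ramp w"
proof -
  have "0 \<le> ramp w \<and> ramp w \<le> max 0 w \<and> max 0 w - 1 \<le> ramp w"
  proof (cases "0 < w")
    case True
    have le: "0 \<le> ramp v \<and> ramp v \<le> v" if v: "0 < v" for v
    proof -
      obtain z where z: "ramp v = v * sstep z" using ramp_mvt[OF v] ramp_0 by auto
      show ?thesis unfolding z using v sstep_nonneg[of z] sstep_le_1[of z]
        by (simp add: mult_left_le)
    qed
    have "w - 1 \<le> ramp w"
    proof (cases "1 < w")
      case True
      obtain z where "1 < z" "ramp w - ramp 1 = (w - 1) * sstep z" using ramp_mvt[OF True] by blast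
      then show ?thesis using le[of 1] by (simp add: sstep_eq_1)
    qed (use le[OF True] in simp)
    then show ?thesis using le[OF True] True by simp
  next
    case False
    have "ramp w = 0"
    proof (cases "w = 0")
      case False
      with \<open>\<not> 0 < w\<close> have "w < 0" by simp
      then obtain z where "z < 0" "ramp 0 - ramp w = (0 - w) * sstep z" using ramp_mvt[of w 0] by blast
      then show ?thesis by (simp add: ramp_0 sstep_eq_0)
    qed (simp add: ramp_0)
    then show ?thesis using False by simp
  qed
  then show "0 \<le> ramp w" "ramp w \<le> max 0 w" "max 0 w - 1 \<le> ramp w" by auto
qed

lemma has_derivative_radial:
  fixes x :: "'a::euclidean_space"
  assumes "(f has_real_derivative f') (at ((norm x)\<^sup>2 / r))"
  shows "((\<lambda>x. f ((norm x)\<^sup>2 / r)) has_derivative (\<lambda>h. ((2 * f' / r) *\<^sub>R x) \<bullet> h)) (at x)"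
proof -
  have "((\<lambda>x. (1 / r) * (x \<bullet> x)) has_derivative (\<lambda>h. (1 / r) * (2 * (x \<bullet> h)))) (at x)"
    by (intro has_derivative_mult_right) (auto intro!: derivative_eq_intros simp: inner_commute)
  then have "((\<lambda>x. (x \<bullet> x) / r) has_derivative (\<lambda>h. (2 * (x \<bullet> h)) / r)) (at x)" by simp
  from has_derivative_compose[OF this has_field_derivative_imp_has_derivative] assms
  have "((\<lambda>x. f (x \<bullet> x / r)) has_derivative (\<lambda>h. f' * ((2 * (x \<bullet> h)) / r))) (at x)"
    by (simp add: power2_norm_eq_inner)
  then show ?thesis by (simp add: power2_norm_eq_inner mult_ac)
qed

lemma smooth_radial:
  assumes "smooth f"
  shows "smooth (\<lambda>x::'a::euclidean_space. f ((norm x)\<^sup>2 / r))"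
proof -
  have "smooth (\<lambda>x::'a. (1 / r) * (norm x)\<^sup>2)" by (rule smooth_mult[OF smooth_const smooth_norm_sq])
  then show ?thesis using smooth_compose[OF assms] by simp
qed

lemma norm_le_of_sq_div_le:
  fixes x :: "'a::real_normed_vector"
  assumes "(norm x)\<^sup>2 / R\<^sup>2 < 2" "0 < R"
  shows "norm x \<le> 2 * R"
proof -
  have "(norm x)\<^sup>2 \<le> (2 * R)\<^sup>2"
  proof -
    have "(norm x)\<^sup>2 < 2 * R\<^sup>2" using assms by (simp add: divide_less_eq)
    moreover have "(2 * R)\<^sup>2 = 4 * R\<^sup>2" by (simp add: power_mult_distrib)
    moreover have "0 \<le> R\<^sup>2" by simp
    ultimately show ?thesis by linarith
  qed
  then show ?thesis using assms(2) by (auto intro: power2_le_imp_le)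
qed

section \<open>Second moments and test functions of quadratic growth\<close>

context curve begin

text \<open>The truncated square is constant far out. Subtracting it from that constant leaves a
  function of compact support, and constants are transported trivially.\<close>

lemma transports_plateau:
  assumes R: "0 < R"
  shows "transports (\<lambda>x. R\<^sup>2 * plateau ((norm x)\<^sup>2 / R\<^sup>2)) (\<lambda>x. (2 * (1 - sstep ((norm x)\<^sup>2 / R\<^sup>2 - 1))) *\<^sub>R x)"
proof -
  let ?\<psi> = "\<lambda>x::'a. R\<^sup>2 * (plateau 2 - plateau ((norm x)\<^sup>2 / R\<^sup>2))"
  let ?H = "\<lambda>x::'a. (- 2 * (1 - sstep ((norm x)\<^sup>2 / R\<^sup>2 - 1))) *\<^sub>R x"
  have "transports ?\<psi> ?H"
  proof (rule transports_compact_support[of _ _ "2 * R"])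
    show "smooth ?\<psi>"
      by (intro smooth_mult smooth_diff smooth_const smooth_radial smooth_plateau)
    show "(?\<psi> has_derivative (\<lambda>h. ?H x \<bullet> h)) (at x)" for x
    proof -
      have "((\<lambda>x. R\<^sup>2 * (plateau 2 - plateau ((norm x)\<^sup>2 / R\<^sup>2))) has_derivative
        (\<lambda>h. R\<^sup>2 * (0 - ((2 * (1 - sstep ((norm x)\<^sup>2 / R\<^sup>2 - 1)) / R\<^sup>2) *\<^sub>R x) \<bullet> h))) (at x)"
        by (intro has_derivative_mult_right has_derivative_diff has_derivative_const
            has_derivative_radial plateau_deriv)
      then show ?thesis
        by (rule has_derivative_eq_rhs)
          (rule ext, simp only: inner_scaleR_left, use R in \<open>simp add: field_simps\<close>)
    qed
    show "norm x \<le> 2 * R" if "?\<psi> x \<noteq> 0" for x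
      using that plateau_const[of "(norm x)\<^sup>2 / R\<^sup>2"] R
      by (intro norm_le_of_sq_div_le) (auto simp: not_less[symmetric])
  qed
  from transports_diff[OF transports_const[of "R\<^sup>2 * plateau 2"] this]
  moreover have "(\<lambda>x. R\<^sup>2 * plateau 2 - ?\<psi> x) = (\<lambda>x. R\<^sup>2 * plateau ((norm x)\<^sup>2 / R\<^sup>2))"
    by (simp add: right_diff_distrib)
  moreover have "(\<lambda>x. 0 - ?H x) = (\<lambda>x. (2 * (1 - sstep ((norm x)\<^sup>2 / R\<^sup>2 - 1))) *\<^sub>R x)"
    by (simp add: algebra_simps)
  ultimately show ?thesis by simp
qed

lemma continuous_on_plateau_moment:
  assumes "0 < R"
  shows "continuous_on {0..<1} (\<lambda>t. LINT x|K t. R\<^sup>2 * plateau ((norm x)\<^sup>2 / R\<^sup>2))"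
proof (rule narrowD)
  show "continuous_on UNIV (\<lambda>x::'a. R\<^sup>2 * plateau ((norm x)\<^sup>2 / R\<^sup>2))"
    by (intro continuous_intros smooth_imp_continuous smooth_radial smooth_plateau)
  have "\<bar>plateau w\<bar> \<le> 2" if "0 \<le> w" for w
    using plateau_nonneg[OF that] plateau_le_2[OF that] by simp
  then have "\<bar>R\<^sup>2 * plateau ((norm x)\<^sup>2 / R\<^sup>2)\<bar> \<le> R\<^sup>2 * 2" for x :: 'a
    by (simp add: abs_mult mult_left_mono)
  then show "bounded (range (\<lambda>x::'a. R\<^sup>2 * plateau ((norm x)\<^sup>2 / R\<^sup>2)))"
    by (auto simp: bounded_iff)
qed

text \<open>The truncations \<open>\<phi> = R\<^sup>2 plateau (|x|\<^sup>2 / R\<^sup>2)\<close> satisfy \<open>|\<nabla>\<phi>|\<^sup>2 \<le> 4 \<phi>\<close>, so the growth of \<open>\<integral> \<phi> dK\<^sub>t\<close> is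
  controlled by the energy uniformly in \<open>R\<close>, starting from its maximum over a compact interval.\<close>

lemma second_moment_bound:
  assumes t: "0 \<le> t" "t < T"
  shows "(LINT x|K t. (norm x)\<^sup>2) \<le> 2 * (LINT x|K 0. (norm x)\<^sup>2) + 4 * (LINT z|L. (norm (u z))\<^sup>2)"
    (is "_ \<le> ?C")
proof -
  have bound: "(LINT x|K t. R\<^sup>2 * plateau ((norm x)\<^sup>2 / R\<^sup>2)) \<le> ?C" if R: "0 < R" for R
  proof -
    define \<phi> where "\<phi> x = R\<^sup>2 * plateau ((norm x)\<^sup>2 / R\<^sup>2)" for x :: 'a
    define G where "G x = (2 * (1 - sstep ((norm x)\<^sup>2 / R\<^sup>2 - 1))) *\<^sub>R x" for x :: 'a
    have tr: "transports \<phi> G" using transports_plateau[OF R] by (simp add: \<phi>_def[abs_def] G_def[abs_def])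
    have cM: "continuous_on {0..t} (\<lambda>t. LINT x|K t. \<phi> x)"
      unfolding \<phi>_def
      by (rule continuous_on_subset[OF continuous_on_plateau_moment[OF R]]) (use t T in auto)
    have ne: "{0..t} \<noteq> {}" using t by auto
    \<comment> \<open>The estimate closes at the maximiser, whose value bounds the moments at all
      earlier times under the time integral.\<close>
    obtain m where m: "m \<in> {0..t}" "\<And>s. s \<in> {0..t} \<Longrightarrow> (LINT x|K s. \<phi> x) \<le> (LINT x|K m. \<phi> x)"
      using continuous_attains_sup[OF compact_Icc ne cM] by blast
    have [measurable]: "\<phi> \<in> borel_measurable borel" "G \<in> borel_measurable borel"
    proof -
      show "\<phi> \<in> borel_measurable borel" unfolding \<phi>_def
        by (intro borel_measurable_continuous_onI continuous_intros smooth_imp_continuous smooth_radial smooth_plateau)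
      have [measurable]: "sstep \<in> borel_measurable borel"
        by (rule borel_measurable_continuous_onI[OF continuous_sstep])
      show "G \<in> borel_measurable borel" unfolding G_def[abs_def] by measurable
    qed
    have \<phi>0: "0 \<le> \<phi> x" and \<phi>le: "\<phi> x \<le> (norm x)\<^sup>2" for x
    proof -
      show "0 \<le> \<phi> x" by (simp add: \<phi>_def plateau_nonneg)
      have "R\<^sup>2 * plateau ((norm x)\<^sup>2 / R\<^sup>2) \<le> R\<^sup>2 * ((norm x)\<^sup>2 / R\<^sup>2)"
        by (intro mult_left_mono plateau_le) auto
      then show "\<phi> x \<le> (norm x)\<^sup>2" using R by (simp add: \<phi>_def)
    qed
    \<comment> \<open>Young's inequality \<open>2 a b \<le> a^2 / 2 + 2 b^2\<close> with
      \<open>a = k |x|\<close>, where concavity of \<open>plateau\<close> gives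
      \<open>a^2 \<le> \<phi> x\<close>.\<close>
    have Gu: "G x \<bullet> w \<le> \<phi> x / 2 + 2 * (norm w)\<^sup>2" for x w
    proof -
      define k where "k = 1 - sstep ((norm x)\<^sup>2 / R\<^sup>2 - 1)"
      have k: "0 \<le> k" "k \<le> 1" using sstep_nonneg sstep_le_1 by (auto simp: k_def)
      have "k\<^sup>2 * (norm x)\<^sup>2 \<le> k * (norm x)\<^sup>2"
        using k by (intro mult_right_mono) (simp_all add: power2_eq_square mult_left_le)
      also have "\<dots> = R\<^sup>2 * ((norm x)\<^sup>2 / R\<^sup>2 * k)" using R by simp
      also have "\<dots> \<le> \<phi> x" unfolding \<phi>_def k_def by (intro mult_left_mono plateau_ge) auto
      finally have 1: "(k * norm x)\<^sup>2 \<le> \<phi> x" by (simp add: power_mult_distrib)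
      have "G x \<bullet> w = 2 * k * (x \<bullet> w)" by (simp add: G_def k_def)
      also have "\<dots> \<le> 2 * k * (norm x * norm w)"
        using k norm_cauchy_schwarz[of x w] by (intro mult_left_mono) auto
      also have "\<dots> = 2 * (k * norm x) * norm w" by simp
      also have "\<dots> \<le> (k * norm x)\<^sup>2 / 2 + 2 * (norm w)\<^sup>2"
      proof -
        have "0 \<le> (k * norm x - 2 * norm w)\<^sup>2" by simp
        then show ?thesis by (simp add: power2_diff)
      qed
      finally show ?thesis using 1 by linarith
    qed
    have i\<phi>: "integrable L (\<lambda>z. indicator {0<..m} (fst z) * \<phi> (snd z))"
    proof (rule L.integrable_const_bound[where B="R\<^sup>2 * 2"])
      have "\<phi> x \<le> R\<^sup>2 * 2" for x unfolding \<phi>_def by (intro mult_left_mono plateau_le_2) auto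
      then show "AE z in L. norm (indicator {0<..m} (fst z) * \<phi> (snd z)) \<le> R\<^sup>2 * 2"
        using \<phi>0 by (intro AE_I2) (auto simp: indicator_def)
    qed measurable
    have "(LINT x|K m. \<phi> x) - (LINT x|K 0. \<phi> x) = (LINT z|L. indicator {0<..m} (fst z) * (G (snd z) \<bullet> u z))"
      using tr m(1) t by (auto simp: transports_def)
    also have "\<dots> \<le> (LINT z|L. (1/2) * (indicator {0<..m} (fst z) * \<phi> (snd z)) + 2 * (norm (u z))\<^sup>2)"
    proof (rule integral_mono)
      show "integrable L (\<lambda>z. indicator {0<..m} (fst z) * (G (snd z) \<bullet> u z))"
        using tr by (intro integrable_time_slab) (simp add: transports_def)
      show "integrable L (\<lambda>z. (1/2) * (indicator {0<..m} (fst z) * \<phi> (snd z)) + 2 * (norm (u z))\<^sup>2)"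
        using i\<phi> energy by (intro Bochner_Integration.integrable_add integrable_mult_right) auto
      show "indicator {0<..m} (fst z) * (G (snd z) \<bullet> u z)
          \<le> (1/2) * (indicator {0<..m} (fst z) * \<phi> (snd z)) + 2 * (norm (u z))\<^sup>2" for z
        using Gu[of "snd z" "u z"] by (simp add: indicator_def)
    qed
    also have "\<dots> = (1/2) * (LINT z|L. indicator {0<..m} (fst z) * \<phi> (snd z)) + 2 * (LINT z|L. (norm (u z))\<^sup>2)"
      using i\<phi> energy by (subst Bochner_Integration.integral_add) auto
    \<comment> \<open>Because \<open>m < 1\<close>, the time integral is at most the maximum itself.
      Half of the maximum is then absorbed on the left, which doubles the remaining terms and
      produces the constants 2 and 4.\<close>
    also have "(LINT z|L. indicator {0<..m} (fst z) * \<phi> (snd z)) \<le> (LINT x|K m. \<phi> x)"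
    proof -
      have e: "(LINT x|K s. indicator {0<..m} s * \<phi> x) = indicator {0<..m} s * (LINT x|K s. \<phi> x)" for s
        by simp
      note h = integral_L[OF i\<phi>, unfolded fst_conv snd_conv e has_bochner_integral_iff]
      have "(LINT z|L. indicator {0<..m} (fst z) * \<phi> (snd z)) =
          (LINT s|lborel. indicator {0<..<T} s * (indicator {0<..m} s * (LINT x|K s. \<phi> x)))"
        using h by simp
      also have "\<dots> \<le> (LINT s|lborel. (LINT x|K m. \<phi> x) * indicator {0..m} s)"
      proof (rule integral_mono)
        show "integrable lborel (\<lambda>s. (LINT x|K m. \<phi> x) * indicator {0..m} s)"
          using m(1) by (intro integrable_mult_right integrable_real_indicator) auto
        show "indicator {0<..<T} s * (indicator {0<..m} s * (LINT x|K s. \<phi> x)) \<le> (LINT x|K m. \<phi> x) * indicator {0..m} s" for s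
          using m(2)[of s] m(1) \<phi>0 by (auto simp: indicator_def intro!: Bochner_Integration.integral_nonneg)
      qed (use h in simp)
      also have "\<dots> = (LINT x|K m. \<phi> x) * m" using m(1) by simp
      also have "\<dots> \<le> (LINT x|K m. \<phi> x) * 1"
        using m(1) t T \<phi>0 by (intro mult_left_mono Bochner_Integration.integral_nonneg) auto
      finally show ?thesis by simp
    qed
    finally have 1: "(LINT x|K m. \<phi> x) \<le> 2 * (LINT x|K 0. \<phi> x) + 4 * (LINT z|L. (norm (u z))\<^sup>2)" by simp
    have "(LINT x|K 0. \<phi> x) \<le> (LINT x|K 0. (norm x)\<^sup>2)"
      using tr integrable_norm_sq_K \<phi>le by (intro integral_mono) (auto simp: transports_def)
    then have "(LINT x|K t. \<phi> x) \<le> ?C" using 1 m(2)[of t] t by simp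
    then show ?thesis by (simp add: \<phi>_def)
  qed
  have "(\<lambda>n. LINT x|K t. (real (Suc n))\<^sup>2 * plateau ((norm x)\<^sup>2 / (real (Suc n))\<^sup>2)) \<longlonglongrightarrow> (LINT x|K t. (norm x)\<^sup>2)"
  proof (rule integral_dominated_convergence[OF _ _ integrable_norm_sq_K])
    show "AE x in K t. (\<lambda>n. (real (Suc n))\<^sup>2 * plateau ((norm x)\<^sup>2 / (real (Suc n))\<^sup>2)) \<longlonglongrightarrow> (norm x)\<^sup>2"
    proof (rule AE_I2, rule tendsto_eventually)
      fix x :: 'a
      obtain N :: nat where N: "norm x \<le> real N" using real_arch_simple by blast
      have "(real (Suc n))\<^sup>2 * plateau ((norm x)\<^sup>2 / (real (Suc n))\<^sup>2) = (norm x)\<^sup>2" if "N \<le> n" for n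
      proof -
        have "norm x \<le> real (Suc n)" using N that by simp
        then have "(norm x)\<^sup>2 \<le> (real (Suc n))\<^sup>2" by (intro power_mono) auto
        then have "plateau ((norm x)\<^sup>2 / (real (Suc n))\<^sup>2) = (norm x)\<^sup>2 / (real (Suc n))\<^sup>2"
          by (intro plateau_eq) (auto simp: divide_le_eq_1)
        then show ?thesis by simp
      qed
      then show "\<forall>\<^sub>F n in sequentially. (real (Suc n))\<^sup>2 * plateau ((norm x)\<^sup>2 / (real (Suc n))\<^sup>2) = (norm x)\<^sup>2"
        by (auto simp: eventually_sequentially)
    qed
    show "AE x in K t. norm ((real (Suc n))\<^sup>2 * plateau ((norm x)\<^sup>2 / (real (Suc n))\<^sup>2)) \<le> (norm x)\<^sup>2" for n
    proof (rule AE_I2)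
      fix x :: 'a
      have "(real (Suc n))\<^sup>2 * plateau ((norm x)\<^sup>2 / (real (Suc n))\<^sup>2) \<le> (real (Suc n))\<^sup>2 * ((norm x)\<^sup>2 / (real (Suc n))\<^sup>2)"
        by (intro mult_left_mono plateau_le) auto
      moreover have "0 \<le> (real (Suc n))\<^sup>2 * plateau ((norm x)\<^sup>2 / (real (Suc n))\<^sup>2)"
        by (simp add: plateau_nonneg)
      ultimately show "norm ((real (Suc n))\<^sup>2 * plateau ((norm x)\<^sup>2 / (real (Suc n))\<^sup>2)) \<le> (norm x)\<^sup>2"
        by simp
    qed
    show "(\<lambda>x. (real (Suc n))\<^sup>2 * plateau ((norm x)\<^sup>2 / (real (Suc n))\<^sup>2)) \<in> borel_measurable (K t)" for n
      using borel_measurable_continuous_onI[OF smooth_imp_continuous[OF smooth_plateau]]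
      by measurable
  qed simp
  then show ?thesis
    by (rule LIMSEQ_le_const2) (use bound in auto)
qed

lemma integrable_norm_sq_L: "integrable L (\<lambda>z. (norm (snd z))\<^sup>2)"
proof (rule integrableI_bounded)
  define C where "C = 2 * (LINT x|K 0. (norm x)\<^sup>2) + 4 * (LINT z|L. (norm (u z))\<^sup>2)"
  have "(\<integral>\<^sup>+z. ennreal (norm ((norm (snd z))\<^sup>2)) \<partial>L) =
      (\<integral>\<^sup>+t. indicator {0<..<T} t * (\<integral>\<^sup>+x. ennreal ((norm x)\<^sup>2) \<partial>K t) \<partial>lborel)"
    by (subst nn_integral_L) simp_all
  also have "\<dots> \<le> (\<integral>\<^sup>+t. ennreal C * indicator {0<..<T} t \<partial>lborel)"
  proof (rule nn_integral_mono)
    fix t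
    have "(\<integral>\<^sup>+x. ennreal ((norm x)\<^sup>2) \<partial>K t) = ennreal (LINT x|K t. (norm x)\<^sup>2)"
      using integrable_norm_sq_K by (intro nn_integral_eq_integral) auto
    moreover have "(LINT x|K t. (norm x)\<^sup>2) \<le> C" if "0 < t" "t < T"
      unfolding C_def by (rule second_moment_bound) (use that in auto)
    ultimately show "indicator {0<..<T} t * (\<integral>\<^sup>+x. ennreal ((norm x)\<^sup>2) \<partial>K t) \<le> ennreal C * indicator {0<..<T} t"
      by (auto simp: indicator_def intro!: ennreal_leI)
  qed
  also have "\<dots> < \<infinity>" using T by (simp add: nn_integral_cmult ennreal_mult_less_top)
  finally show "(\<integral>\<^sup>+z. ennreal (norm ((norm (snd z))\<^sup>2)) \<partial>L) < \<infinity>" .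
qed measurable

text \<open>Multiply by a spatial cut-off at radius \<open>R = n + 1\<close>. The additional
  gradient term is of order \<open>|\<phi>| |x| / R^2\<close> and lives where
  \<open>|x|^2 < 2 R^2\<close>; there \<open>|\<phi>| \<le> 3 c R^2\<close>, so it grows only
  linearly in \<open>x\<close>, uniformly in \<open>n\<close>.\<close>

lemma transports_quadratic:
  assumes \<phi>: "smooth \<phi>" "\<And>x. (\<phi> has_derivative (\<lambda>h. G x \<bullet> h)) (at x)"
    and [measurable]: "G \<in> borel_measurable borel"
    and bound: "\<And>x. \<bar>\<phi> x\<bar> \<le> c * (1 + (norm x)\<^sup>2)" "\<And>x. norm (G x) \<le> c * (1 + norm x)"
  shows "transports \<phi> G"
proof -
  obtain S where S: "\<And>t. \<bar>sstep' t\<bar> \<le> S" "0 \<le> S" using sstep'_bounded by blast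
  have c: "0 \<le> c" using bound(1)[of 0] by simp
  define w where "w n x = (norm x)\<^sup>2 / (real (Suc n))\<^sup>2" for n and x :: 'a
  define \<phi>n where "\<phi>n n x = \<phi> x * (1 - sstep (w n x - 1))" for n x
  define Gn where "Gn n x = (1 - sstep (w n x - 1)) *\<^sub>R G x + (\<phi> x * (- (2 * sstep' (w n x - 1) / (real (Suc n))\<^sup>2))) *\<^sub>R x" for n x
  have [measurable]: "\<phi> \<in> borel_measurable borel" "sstep \<in> borel_measurable borel" "sstep' \<in> borel_measurable borel"
    by (intro borel_measurable_continuous_onI smooth_imp_continuous \<phi>(1) smooth_sstep smooth_sstep')+
  have [measurable]: "w n \<in> borel_measurable borel" for n unfolding w_def[abs_def] by measurable
  have deriv: "(\<phi>n n has_derivative (\<lambda>h. Gn n x \<bullet> h)) (at x)" for n x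
  proof -
    have "((\<lambda>v. 1 - sstep (v - 1)) has_real_derivative - sstep' (v - 1)) (at v)" for v
      using DERIV_diff[OF DERIV_const[of 1] DERIV_chain2[OF sstep_deriv[of "v - 1"] DERIV_diff[OF DERIV_ident DERIV_const[of 1]]]]
      by simp
    from has_derivative_mult[OF \<phi>(2) has_derivative_radial[OF this, where x=x and r="(real (Suc n))\<^sup>2"]]
    show ?thesis unfolding \<phi>n_def[abs_def] Gn_def w_def
      by (rule has_derivative_eq_rhs) (auto simp: inner_add_left algebra_simps)
  qed
  have cut: "transports (\<phi>n n) (Gn n)" for n
  proof (rule transports_compact_support[OF _ deriv, of _ "2 * real (Suc n)"])
    show "smooth (\<phi>n n)" unfolding \<phi>n_def[abs_def] w_def
      by (intro smooth_mult \<phi>(1) smooth_radial[of "\<lambda>v. 1 - sstep (v - 1)"] smooth_sstep_shift)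
    show "norm x \<le> 2 * real (Suc n)" if "\<phi>n n x \<noteq> 0" for x
    proof (rule norm_le_of_sq_div_le)
      show "(norm x)\<^sup>2 / (real (Suc n))\<^sup>2 < 2"
        using that sstep_eq_1[of "w n x - 1"] by (cases "w n x < 2") (auto simp: \<phi>n_def w_def)
    qed simp
  qed
  have ev: "eventually (\<lambda>n. w n x \<le> 1) sequentially" for x
  proof -
    obtain N :: nat where N: "norm x \<le> real N" using real_arch_simple by blast
    have "w n x \<le> 1" if "N \<le> n" for n
    proof -
      have "norm x \<le> real (Suc n)" using N that by simp
      then have "(norm x)\<^sup>2 \<le> (real (Suc n))\<^sup>2" by (intro power_mono) auto
      then show ?thesis by (auto simp: w_def divide_le_eq_1)
    qed
    then show ?thesis by (auto simp: eventually_sequentially)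
  qed
  show ?thesis
  \<comment> \<open>The 6 is 3 from \<open>1 + |x|^2 \<le> 3 R^2\<close> times 2 from
    differentiating the squared norm; \<open>S\<close> bounds \<open>sstep'\<close>.\<close>
  proof (rule transports_limit[OF cut, where c="c * (1 + 6 * S)"])
    show "(\<lambda>n. \<phi>n n x) \<longlonglongrightarrow> \<phi> x" for x
      using ev[of x] by (intro tendsto_eventually, eventually_elim) (simp add: \<phi>n_def sstep_eq_0)
    show "(\<lambda>n. Gn n x) \<longlonglongrightarrow> G x" for x
      using ev[of x] by (intro tendsto_eventually, eventually_elim) (simp add: Gn_def sstep_eq_0 sstep'_eq_0)
    show "\<bar>\<phi>n n x\<bar> \<le> c * (1 + 6 * S) * (1 + (norm x)\<^sup>2)" for n x
    proof -
      have "\<bar>\<phi>n n x\<bar> \<le> \<bar>\<phi> x\<bar> * 1"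
        unfolding \<phi>n_def abs_mult using sstep_nonneg sstep_le_1 by (intro mult_left_mono) (auto simp: abs_le_iff)
      also have "\<dots> \<le> c * (1 + (norm x)\<^sup>2)" using bound(1) by simp
      also have "\<dots> \<le> c * (1 + 6 * S) * (1 + (norm x)\<^sup>2)"
        using c S(2) by (intro mult_right_mono) (auto simp: mult_le_cancel_left1)
      finally show ?thesis .
    qed
    show "norm (Gn n x) \<le> c * (1 + 6 * S) * (1 + norm x)" for n x
    proof -
      let ?R = "(real (Suc n))\<^sup>2"
      have R1: "1 \<le> ?R" by simp
      have "\<bar>\<phi> x * (- (2 * sstep' (w n x - 1) / ?R))\<bar> \<le> 6 * c * S"
      proof (cases "w n x < 2")
        case True
        then have "(norm x)\<^sup>2 \<le> 2 * ?R" by (simp add: w_def divide_less_eq)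
        then have "1 + (norm x)\<^sup>2 \<le> 3 * ?R" using R1 by linarith
        then have "c * (1 + (norm x)\<^sup>2) \<le> c * (3 * ?R)" using c by (intro mult_left_mono) auto
        then have "\<bar>\<phi> x\<bar> \<le> c * (3 * ?R)" using bound(1)[of x] by linarith
        then have "\<bar>\<phi> x\<bar> * (2 * \<bar>sstep' (w n x - 1)\<bar> / ?R) \<le> (c * (3 * ?R)) * (2 * S / ?R)"
          using S c by (intro mult_mono divide_right_mono) auto
        also have "\<dots> = 6 * c * S" by simp
        finally show ?thesis by (simp add: abs_mult)
      next
        case False
        then show ?thesis using sstep'_eq_0[of "w n x - 1"] c S(2) by simp
      qed
      then have 1: "norm ((\<phi> x * (- (2 * sstep' (w n x - 1) / ?R))) *\<^sub>R x) \<le> 6 * c * S * norm x"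
        unfolding norm_scaleR by (rule mult_right_mono) simp
      have "\<bar>1 - sstep (w n x - 1)\<bar> * norm (G x) \<le> 1 * norm (G x)"
        using sstep_nonneg sstep_le_1 by (intro mult_right_mono) (auto simp: abs_le_iff)
      then have 2: "norm ((1 - sstep (w n x - 1)) *\<^sub>R G x) \<le> norm (G x)" by simp
      have "norm (Gn n x) \<le> norm (G x) + 6 * c * S * norm x"
        unfolding Gn_def by (rule order_trans[OF norm_triangle_ineq add_mono[OF 2 1]])
      also have "\<dots> \<le> c * (1 + norm x) + 6 * c * S * (1 + norm x)"
        using bound(2) c S(2) by (intro add_mono mult_left_mono) auto
      also have "\<dots> = c * (1 + 6 * S) * (1 + norm x)" by (simp add: algebra_simps)
      finally show ?thesis .
    qed
    show "\<phi>n n \<in> borel_measurable borel" "Gn n \<in> borel_measurable borel" for n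
      unfolding \<phi>n_def[abs_def] Gn_def[abs_def] by measurable
  qed (use integrable_norm_sq_L in auto)
qed

lemma norm_le_1_sq: "norm x \<le> 1 + (norm x)\<^sup>2" for x :: 'a
proof -
  have "0 \<le> (norm x - 1)\<^sup>2 + (norm x)\<^sup>2" by simp
  then show ?thesis by (simp add: power2_diff)
qed

lemma transports_inner: "transports (\<lambda>x. \<theta> \<bullet> x) (\<lambda>x. \<theta>)"
proof (rule transports_quadratic[where c="norm \<theta>"])
  show "\<bar>\<theta> \<bullet> x\<bar> \<le> norm \<theta> * (1 + (norm x)\<^sup>2)" for x
    by (rule order_trans[OF Cauchy_Schwarz_ineq2]) (intro mult_left_mono norm_le_1_sq norm_ge_zero)
  show "norm \<theta> \<le> norm \<theta> * (1 + norm x)" for x :: 'a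
    by (simp add: mult_le_cancel_left1)
qed (auto intro: bounded_linear_imp_has_derivative bounded_linear_inner_right)

lemma transports_inner_sq: "transports (\<lambda>x. (\<theta> \<bullet> x)\<^sup>2) (\<lambda>x. (2 * (\<theta> \<bullet> x)) *\<^sub>R \<theta>)"
proof (rule transports_quadratic[where c="2 * (norm \<theta>)\<^sup>2"])
  show "smooth (\<lambda>x. (\<theta> \<bullet> x)\<^sup>2)" unfolding power2_eq_square by (rule smooth_mult) simp_all
  show "((\<lambda>x. (\<theta> \<bullet> x)\<^sup>2) has_derivative (\<lambda>h. ((2 * (\<theta> \<bullet> x)) *\<^sub>R \<theta>) \<bullet> h)) (at x)" for x
    by (auto intro!: derivative_eq_intros)
  have sq: "(\<theta> \<bullet> x)\<^sup>2 \<le> (norm \<theta>)\<^sup>2 * (norm x)\<^sup>2" for x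
    using Cauchy_Schwarz_ineq[of \<theta> x] by (simp add: power2_norm_eq_inner)
  show "\<bar>(\<theta> \<bullet> x)\<^sup>2\<bar> \<le> 2 * (norm \<theta>)\<^sup>2 * (1 + (norm x)\<^sup>2)" for x
  proof -
    have "\<bar>(\<theta> \<bullet> x)\<^sup>2\<bar> \<le> (norm \<theta>)\<^sup>2 * (norm x)\<^sup>2" using sq[of x] by simp
    also have "\<dots> \<le> (2 * (norm \<theta>)\<^sup>2) * (1 + (norm x)\<^sup>2)" by (intro mult_mono) auto
    finally show ?thesis .
  qed
  show "norm ((2 * (\<theta> \<bullet> x)) *\<^sub>R \<theta>) \<le> 2 * (norm \<theta>)\<^sup>2 * (1 + norm x)" for x
  proof -
    have "norm ((2 * (\<theta> \<bullet> x)) *\<^sub>R \<theta>) \<le> 2 * (norm \<theta> * norm x) * norm \<theta>"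
      using Cauchy_Schwarz_ineq2[of \<theta> x] by (auto intro!: mult_right_mono)
    also have "\<dots> = 2 * (norm \<theta>)\<^sup>2 * norm x" by (simp add: power2_eq_square)
    also have "\<dots> \<le> 2 * (norm \<theta>)\<^sup>2 * (1 + norm x)" by (intro mult_left_mono) auto
    finally show ?thesis .
  qed
qed measurable

text \<open>The hinge is approximated by a rescaled \<open>ramp\<close>. Since \<open>sstep\<close>
  vanishes at 0, the gradients converge at every point, also on the kink, where the limit picks the
  slope 0; hence the open half-line in the indicator.\<close>

lemma transports_hinge:
  "transports (\<lambda>x. max 0 (\<theta> \<bullet> x - c)) (\<lambda>x. indicator {c<..} (\<theta> \<bullet> x) *\<^sub>R \<theta>)"
proof -
  define \<epsilon> where "\<epsilon> n = inverse (real (Suc n))" for n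
  have \<epsilon>: "0 < \<epsilon> n" for n by (simp add: \<epsilon>_def)
  have \<epsilon>0: "\<epsilon> \<longlonglongrightarrow> 0" unfolding \<epsilon>_def by (rule LIMSEQ_inverse_real_of_nat)
  define \<phi> where "\<phi> n x = \<epsilon> n * ramp ((\<theta> \<bullet> x - c) / \<epsilon> n)" for n x
  define G where "G n x = sstep ((\<theta> \<bullet> x - c) / \<epsilon> n) *\<^sub>R \<theta>" for n x
  have [measurable]: "sstep \<in> borel_measurable borel" "ramp \<in> borel_measurable borel"
    by (intro borel_measurable_continuous_onI smooth_imp_continuous smooth_sstep smooth_ramp)+
  have [measurable]: "\<phi> n \<in> borel_measurable borel" "G n \<in> borel_measurable borel" for n
    unfolding \<phi>_def[abs_def] G_def[abs_def] by measurable
  have mx: "\<epsilon> n * max 0 (a / \<epsilon> n) = max 0 a" for n a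
    using \<epsilon>[of n] by (simp add: max_def divide_le_0_iff zero_le_divide_iff)
  have \<phi>_near: "max 0 (\<theta> \<bullet> x - c) - \<epsilon> n \<le> \<phi> n x" "\<phi> n x \<le> max 0 (\<theta> \<bullet> x - c)" "0 \<le> \<phi> n x" for n x
  proof -
    show "0 \<le> \<phi> n x" using \<epsilon>[of n] ramp_bounds(1) by (simp add: \<phi>_def)
    have "\<epsilon> n * (max 0 ((\<theta> \<bullet> x - c) / \<epsilon> n) - 1) \<le> \<phi> n x"
      unfolding \<phi>_def using \<epsilon>[of n] by (intro mult_left_mono ramp_bounds) auto
    then show "max 0 (\<theta> \<bullet> x - c) - \<epsilon> n \<le> \<phi> n x" by (simp add: right_diff_distrib mx)
    have "\<phi> n x \<le> \<epsilon> n * max 0 ((\<theta> \<bullet> x - c) / \<epsilon> n)"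
      unfolding \<phi>_def using \<epsilon>[of n] by (intro mult_left_mono ramp_bounds) auto
    then show "\<phi> n x \<le> max 0 (\<theta> \<bullet> x - c)" by (simp add: mx)
  qed
  have \<phi>b: "\<bar>\<phi> n x\<bar> \<le> (norm \<theta> + \<bar>c\<bar>) * (1 + (norm x)\<^sup>2)" for n x
  proof -
    have "\<bar>\<phi> n x\<bar> \<le> \<bar>\<theta> \<bullet> x\<bar> + \<bar>c\<bar>" using \<phi>_near(2)[of n x] \<phi>_near(3)[of n x] by auto
    also have "\<dots> \<le> norm \<theta> * norm x + \<bar>c\<bar>" using Cauchy_Schwarz_ineq2[of \<theta> x] by simp
    also have "\<dots> \<le> norm \<theta> * (1 + (norm x)\<^sup>2) + \<bar>c\<bar> * (1 + (norm x)\<^sup>2)"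
      by (intro add_mono mult_left_mono norm_le_1_sq) (simp_all add: mult_le_cancel_left1)
    finally show ?thesis by (simp add: distrib_right)
  qed
  have Gb: "norm (G n x) \<le> (norm \<theta> + \<bar>c\<bar>) * (1 + norm x)" for n x
  proof -
    have "norm (G n x) \<le> 1 * norm \<theta>"
      unfolding G_def norm_scaleR using sstep_nonneg sstep_le_1 by (intro mult_right_mono) auto
    also have "\<dots> \<le> (norm \<theta> + \<bar>c\<bar>) * (1 + norm x)"
      by (simp add: distrib_left distrib_right)
    finally show ?thesis .
  qed
  have tr: "transports (\<phi> n) (G n)" for n
  proof (rule transports_quadratic[where c="norm \<theta> + \<bar>c\<bar>", OF _ _ _ \<phi>b Gb])
    have "smooth (\<lambda>x. (1 / \<epsilon> n) * (\<theta> \<bullet> x - c))"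
      by (intro smooth_mult smooth_diff smooth_const smooth_inner)
    then have "smooth (\<lambda>x. (\<theta> \<bullet> x - c) / \<epsilon> n)" by simp
    then show "smooth (\<phi> n)" unfolding \<phi>_def[abs_def]
      by (intro smooth_mult[OF smooth_const] smooth_compose[OF smooth_ramp])
    show "(\<phi> n has_derivative (\<lambda>h. G n x \<bullet> h)) (at x)" for x
    proof -
      have "((\<lambda>x. (1 / \<epsilon> n) * (\<theta> \<bullet> x - c)) has_derivative (\<lambda>h. (1 / \<epsilon> n) * (\<theta> \<bullet> h))) (at x)"
        by (intro has_derivative_mult_right) (auto intro!: derivative_eq_intros)
      then have "((\<lambda>x. (\<theta> \<bullet> x - c) / \<epsilon> n) has_derivative (\<lambda>h. (\<theta> \<bullet> h) / \<epsilon> n)) (at x)" by simp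
      from has_derivative_mult_right[OF has_derivative_compose[OF this has_field_derivative_imp_has_derivative[OF ramp_deriv]], of "\<epsilon> n"]
      show ?thesis unfolding \<phi>_def[abs_def] G_def
        by (rule has_derivative_eq_rhs) (use \<epsilon>[of n] in auto)
    qed
  qed simp
  show ?thesis
  proof (rule transports_limit[OF tr _ _ _ _ _ _ \<phi>b Gb integrable_norm_sq_L])
    show "(\<lambda>n. \<phi> n x) \<longlonglongrightarrow> max 0 (\<theta> \<bullet> x - c)" for x
    proof (rule tendsto_sandwich[OF _ _ _ tendsto_const])
      show "(\<lambda>n. max 0 (\<theta> \<bullet> x - c) - \<epsilon> n) \<longlonglongrightarrow> max 0 (\<theta> \<bullet> x - c)"
        using tendsto_diff[OF tendsto_const \<epsilon>0] by simp
    qed (auto intro: \<phi>_near always_eventually)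
    show "(\<lambda>n. G n x) \<longlonglongrightarrow> indicator {c<..} (\<theta> \<bullet> x) *\<^sub>R \<theta>" for x
    proof (rule tendsto_eventually)
      show "\<forall>\<^sub>F n in sequentially. G n x = indicator {c<..} (\<theta> \<bullet> x) *\<^sub>R \<theta>"
      proof (cases "c < \<theta> \<bullet> x")
        case True
        have "\<forall>\<^sub>F n in sequentially. \<epsilon> n < \<theta> \<bullet> x - c" by (rule order_tendstoD(2)[OF \<epsilon>0]) (use True in simp)
        then show ?thesis
        proof eventually_elim
          case (elim n)
          then have "1 \<le> (\<theta> \<bullet> x - c) / \<epsilon> n" using \<epsilon>[of n] by (simp add: le_divide_eq)
          then show ?case using True by (simp add: G_def sstep_eq_1)
        qed
      next
        case False
        then have "(\<theta> \<bullet> x - c) / \<epsilon> n \<le> 0" for n using \<epsilon>[of n] by (simp add: divide_le_0_iff)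
        then show ?thesis using False by (simp add: G_def sstep_eq_0)
      qed
    qed
  qed measurable
qed

end

section \<open>Tail expectations of the projections\<close>

lemma proj_P2:
  fixes \<mu> :: "'a::euclidean_space measure"
  assumes "\<mu> \<in> P2"
  shows "proj_measure \<theta> \<mu> \<in> P2"
proof -
  interpret prob_space \<mu> using assms by (simp add: P2_def)
  have [measurable_cong]: "sets \<mu> = sets borel" and i: "integrable \<mu> (\<lambda>x. (norm x)\<^sup>2)"
    using assms by (simp_all add: P2_def)
  have "integrable \<mu> (\<lambda>x. (\<theta> \<bullet> x)\<^sup>2)"
  proof (rule Bochner_Integration.integrable_bound[OF integrable_mult_right[OF i, of "(norm \<theta>)\<^sup>2"]])
    show "AE x in \<mu>. norm ((\<theta> \<bullet> x)\<^sup>2) \<le> norm ((norm \<theta>)\<^sup>2 * (norm x)\<^sup>2)"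
      using Cauchy_Schwarz_ineq[of \<theta>] by (intro AE_I2) (simp add: power2_norm_eq_inner)
  qed measurable
  then show ?thesis
    by (simp add: P2_def proj_measure_def prob_space_distr integrable_distr_eq)
qed

text \<open>The cell index is obtained before \<open>h\<close> is quantified, so that one cell
  serves all families of summands at a given \<open>\<tau>\<close>.\<close>

lemma partition_sum:
  fixes s t :: real and N :: nat
  assumes st: "s < t" and N: "0 < N"
  defines "c \<equiv> \<lambda>i::nat. s + real i * ((t - s) / real N)"
  shows "\<tau> \<notin> {s<..t} \<Longrightarrow> (\<Sum>i<N. indicator {c i<..c (Suc i)} \<tau> * h i) = (0::real)"
    and "\<tau> \<in> {s<..t} \<Longrightarrow> \<exists>i<N. \<tau> \<in> {c i<..c (Suc i)} \<and>
      (\<forall>h. (\<Sum>j<N. indicator {c j<..c (Suc j)} \<tau> * h j) = (h i :: real))"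
proof -
  define d where "d = (t - s) / real N"
  have d: "0 < d" using st N by (simp add: d_def)
  have c: "c i = s + real i * d" for i by (simp add: c_def d_def)
  have mono: "c i \<le> c j" if "i \<le> j" for i j
    using that d by (simp add: c mult_right_mono)
  have c0: "c 0 = s" and cN: "c N = t" using N by (simp_all add: c_def)
  show "(\<Sum>i<N. indicator {c i<..c (Suc i)} \<tau> * h i) = 0" if "\<tau> \<notin> {s<..t}"
  proof (rule sum.neutral, rule ballI)
    fix i assume "i \<in> {..<N}"
    then have "s \<le> c i" "c (Suc i) \<le> t" using mono[of 0 i] mono[of "Suc i" N] c0 cN by auto
    then show "indicator {c i<..c (Suc i)} \<tau> * h i = 0" using that by (auto simp: indicator_def)
  qed
  show "\<exists>i<N. \<tau> \<in> {c i<..c (Suc i)} \<and> (\<forall>h. (\<Sum>j<N. indicator {c j<..c (Suc j)} \<tau> * h j) = (h i :: real))"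
    if \<tau>: "\<tau> \<in> {s<..t}"
  proof -
    \<comment> \<open>The right end of the cell is the first grid point not below
      \<open>\<tau>\<close>; it is not \<open>c 0\<close> because \<open>s < \<tau>\<close>.\<close>
    define k where "k = (LEAST k. \<tau> \<le> c k)"
    have ex: "\<tau> \<le> c N" using \<tau> cN by simp
    have k1: "\<tau> \<le> c k" unfolding k_def by (rule LeastI[of _ N]) (rule ex)
    have kN: "k \<le> N" unfolding k_def by (rule Least_le) (rule ex)
    have "k \<noteq> 0" using k1 \<tau> c0 by (auto intro: ccontr)
    then obtain i where i: "k = Suc i" by (cases k) auto
    have "\<not> \<tau> \<le> c i" using not_less_Least[of i "\<lambda>k. \<tau> \<le> c k"] i by (simp add: k_def)
    then have i1: "\<tau> \<in> {c i<..c (Suc i)}" using k1 i by simp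
    have other: "indicator {c j<..c (Suc j)} \<tau> = (0::real)" if j: "j \<noteq> i" for j
    proof -
      have "\<tau> \<notin> {c j<..c (Suc j)}"
      proof (cases "j < i")
        case True
        then show ?thesis using mono[of "Suc j" i] i1 by auto
      next
        case False
        then show ?thesis using mono[of "Suc i" j] i1 j by auto
      qed
      then show ?thesis by simp
    qed
    have "(\<Sum>j<N. indicator {c j<..c (Suc j)} \<tau> * h j) = h i" for h :: "nat \<Rightarrow> real"
    proof -
      have "(\<Sum>j<N. indicator {c j<..c (Suc j)} \<tau> * h j) = (\<Sum>j<N. if j = i then h j else 0)"
        by (intro sum.cong refl) (use other i1 in \<open>auto simp: indicator_def\<close>)
      also have "\<dots> = h i" using i kN by simp
      finally show ?thesis .
    qed
    then show ?thesis using i1 i kN by (intro exI[of _ i]) auto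
  qed
qed

context curve begin

definition proj_cdf :: "'a \<Rightarrow> real \<Rightarrow> real \<Rightarrow> real" where
  "proj_cdf \<theta> t y = cdf (proj_measure \<theta> (K t)) y"

lemma proj_kernel [measurable]:
  "(\<lambda>q. proj_measure (fst q) (K (snd q))) \<in> borel \<Otimes>\<^sub>M borel \<rightarrow>\<^sub>M prob_algebra borel"
  unfolding proj_measure_def
  by (rule measurable_distr_prob_space2[OF measurable_compose[OF measurable_snd kernel]]) measurable

text \<open>Joint measurability in direction, time and argument, as the later exchanges of integrals
  require. The half-lines are sections of one measurable set in the product.\<close>

lemma measurable_proj_cdf [measurable]:
  assumes [measurable]: "f \<in> borel_measurable N" "g \<in> borel_measurable N" "h \<in> borel_measurable N"
  shows "(\<lambda>n. proj_cdf (f n) (g n) (h n)) \<in> borel_measurable N"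
proof -
  have "(\<lambda>q :: ('a \<times> real) \<times> real. measure (proj_measure (fst (fst q)) (K (snd (fst q)))) {..snd q}) \<in>
      borel_measurable ((borel \<Otimes>\<^sub>M borel) \<Otimes>\<^sub>M borel)"
  proof (rule measure_measurable_subprob_algebra2[where N=borel])
    show "(\<lambda>q :: ('a \<times> real) \<times> real. proj_measure (fst (fst q)) (K (snd (fst q)))) \<in>
        (borel \<Otimes>\<^sub>M borel) \<Otimes>\<^sub>M borel \<rightarrow>\<^sub>M subprob_algebra borel"
      by (rule measurable_prob_algebraD[OF measurable_compose[OF measurable_fst proj_kernel]])
    have "(SIGMA q:space ((borel \<Otimes>\<^sub>M borel) \<Otimes>\<^sub>M borel). {..snd q}) =
        {p \<in> space (((borel \<Otimes>\<^sub>M borel) \<Otimes>\<^sub>M borel) \<Otimes>\<^sub>M borel). snd p \<le> snd (fst p :: ('a \<times> real) \<times> real)}"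
      by (auto simp: space_pair_measure)
    also have "\<dots> \<in> sets (((borel \<Otimes>\<^sub>M borel) \<Otimes>\<^sub>M borel) \<Otimes>\<^sub>M borel)" by measurable
    finally show "(SIGMA q:space ((borel \<Otimes>\<^sub>M borel) \<Otimes>\<^sub>M borel). {..snd (q :: ('a \<times> real) \<times> real)}) \<in>
        sets (((borel \<Otimes>\<^sub>M borel) \<Otimes>\<^sub>M borel) \<Otimes>\<^sub>M borel)" .
  qed
  from measurable_compose[OF _ this, of "\<lambda>n. ((f n, g n), h n)" N]
  show ?thesis by (simp add: proj_cdf_def cdf_def)
qed

text \<open>An atom of the projection would be a charged hyperplane, and hyperplanes are Lebesgue
  null.\<close>

lemma proj_atomless: "\<theta> \<noteq> 0 \<Longrightarrow> atomless_distribution (proj_measure \<theta> (K t))"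
proof -
  assume \<theta>: "\<theta> \<noteq> 0"
  have "measure (proj_measure \<theta> (K t)) {c} = 0" for c
  proof -
    have "negligible {x. \<theta> \<bullet> x = c}" using \<theta> by (intro negligible_hyperplane) simp
    then have "{x. \<theta> \<bullet> x = c} \<in> null_sets lborel"
      by (simp add: negligible_iff_null_sets null_sets_completion_iff)
    then have "{x. \<theta> \<bullet> x = c} \<in> null_sets (K t)" by (rule abs_cont)
    then have "measure (K t) {x. \<theta> \<bullet> x = c} = 0" by (simp add: measure_def null_setsD1)
    then show ?thesis by (simp add: proj_measure_def measure_distr vimage_def)
  qed
  moreover have "real_distribution (proj_measure \<theta> (K t))"
    unfolding proj_measure_def by (rule K.real_distribution_distr) simp
  ultimately show ?thesis
    by (simp add: atomless_distribution_def atomless_distribution_axioms_def)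
qed

text \<open>Narrow continuity passes to the projections. Weak convergence gives convergence of
  distribution functions at continuity points of the limit, and without atoms every \<open>y\<close>
  is one.\<close>

lemma continuous_on_proj_cdf:
  assumes \<theta>: "\<theta> \<noteq> 0"
  shows "continuous_on {0..<1} (\<lambda>t. proj_cdf \<theta> t y)"
proof (rule continuous_on_sequentiallyI)
  fix r :: "nat \<Rightarrow> real" and a
  assume r: "\<forall>n. r n \<in> {0..<1}" "a \<in> {0..<1}" "r \<longlonglongrightarrow> a"
  interpret A: atomless_distribution "proj_measure \<theta> (K a)" by (rule proj_atomless[OF \<theta>])
  interpret R: atomless_distribution "proj_measure \<theta> (K (r n))" for n by (rule proj_atomless[OF \<theta>])
  have "weak_conv_m (\<lambda>n. proj_measure \<theta> (K (r n))) (proj_measure \<theta> (K a))"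
  proof (rule integral_bdd_continuous_conv_imp_weak_conv)
    fix f :: "real \<Rightarrow> real" assume f: "\<And>x. isCont f x" "\<And>x. \<bar>f x\<bar> \<le> 1"
    have cf: "continuous_on UNIV f" using f(1) by (simp add: continuous_at_imp_continuous_on)
    then have [measurable]: "f \<in> borel_measurable borel" by (rule borel_measurable_continuous_onI)
    have e: "(LINT y|proj_measure \<theta> (K t). f y) = (LINT x|K t. f (\<theta> \<bullet> x))" for t
      unfolding proj_measure_def by (rule integral_distr) measurable
    have "continuous_on {0..<1} (\<lambda>t. LINT x|K t. f (\<theta> \<bullet> x))"
    proof (rule narrowD)
      show "continuous_on UNIV (\<lambda>x. f (\<theta> \<bullet> x))"
        by (intro continuous_on_compose2[OF cf] continuous_intros) auto
      show "bounded (range (\<lambda>x. f (\<theta> \<bullet> x)))" using f(2) by (auto simp: bounded_iff)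
    qed
    then show "(\<lambda>n. LINT y|proj_measure \<theta> (K (r n)). f y) \<longlonglongrightarrow> (LINT y|proj_measure \<theta> (K a). f y)"
      unfolding e by (rule continuous_on_tendsto_compose) (use r in auto)
  qed (unfold_locales)
  then show "(\<lambda>n. proj_cdf \<theta> (r n) y) \<longlonglongrightarrow> proj_cdf \<theta> a y"
    using A.isCont_cdf_atomless by (simp add: weak_conv_m_def weak_conv_def proj_cdf_def)
qed

text \<open>The tail is cut by the value of the distribution function and not by a threshold: no
  choice arises on flat pieces, and the event is measurable jointly in time and space.\<close>

definition tail_mean :: "'a \<Rightarrow> real \<Rightarrow> real \<Rightarrow> real" where
  "tail_mean \<theta> \<beta> t = (LINT x|K t. indicator {\<beta><..} (proj_cdf \<theta> t (\<theta> \<bullet> x)) * (\<theta> \<bullet> x))"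

lemma integrable_inner: "integrable (K t) (\<lambda>x. \<theta> \<bullet> x)"
  using transports_inner[of \<theta>] by (simp add: transports_def)

lemma AE_proj_cdf: 
  assumes "\<theta> \<noteq> 0"
  shows "AE x in K t. 0 < proj_cdf \<theta> t (\<theta> \<bullet> x) \<and> proj_cdf \<theta> t (\<theta> \<bullet> x) < 1"
    and "AE x in K t. proj_cdf \<theta> t (\<theta> \<bullet> x) \<noteq> \<beta>"
proof -
  interpret A: atomless_distribution "proj_measure \<theta> (K t)" by (rule proj_atomless[OF assms])
  have *: "AE x in K t. P (\<theta> \<bullet> x)" if "AE y in proj_measure \<theta> (K t). P y" for P
    using that unfolding proj_measure_def by (rule AE_distrD[rotated]) measurable
  show "AE x in K t. 0 < proj_cdf \<theta> t (\<theta> \<bullet> x) \<and> proj_cdf \<theta> t (\<theta> \<bullet> x) < 1" "AE x in K t. proj_cdf \<theta> t (\<theta> \<bullet> x) \<noteq> \<beta>"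
    unfolding proj_cdf_def by (rule *, rule A.AE_cdf_01) (rule *, rule A.AE_cdf_neq)
qed

lemma prob_proj_cdf_gt:
  assumes "\<theta> \<noteq> 0" "0 \<le> \<beta>" "\<beta> \<le> 1"
  shows "measure (K t) {x. \<beta> < proj_cdf \<theta> t (\<theta> \<bullet> x)} = 1 - \<beta>"
proof -
  interpret A: atomless_distribution "proj_measure \<theta> (K t)" by (rule proj_atomless[OF assms(1)])
  have "{y. \<beta> < cdf (proj_measure \<theta> (K t)) y} \<in> sets borel" by measurable
  then have "measure (proj_measure \<theta> (K t)) {y. \<beta> < cdf (proj_measure \<theta> (K t)) y} =
      measure (K t) {x. \<beta> < proj_cdf \<theta> t (\<theta> \<bullet> x)}"
    unfolding proj_cdf_def by (subst (1) proj_measure_def, subst measure_distr) (auto simp: vimage_def)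
  then show ?thesis using A.prob_cdf_gt[OF assms(2,3)] by simp
qed

text \<open>\<open>tail_mean \<theta> \<beta> t\<close> is the minimum over \<open>c\<close> of \<open>\<integral> (\<theta> \<bullet> x - c)\<^sup>+ dK\<^sub>t + c (1 - \<beta>)\<close>, attained
  where the distribution function equals \<open>\<beta>\<close>: the minimiser at time \<open>a\<close> therefore bounds the
  increment from \<open>a\<close> to any other time.\<close>

lemma tail_mean_diff_le:
  assumes \<theta>: "\<theta> \<noteq> 0" and \<beta>: "0 < \<beta>" "\<beta> < 1"
  obtains c where "\<And>y. \<beta> < proj_cdf \<theta> a y \<longleftrightarrow> c < y"
    "\<And>b. tail_mean \<theta> \<beta> b - tail_mean \<theta> \<beta> a \<le> (LINT x|K b. max 0 (\<theta> \<bullet> x - c)) - (LINT x|K a. max 0 (\<theta> \<bullet> x - c))"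
proof -
  interpret A: atomless_distribution "proj_measure \<theta> (K a)" by (rule proj_atomless[OF \<theta>])
  obtain c where c: "cdf (proj_measure \<theta> (K a)) c = \<beta>" "\<And>y. \<beta> < cdf (proj_measure \<theta> (K a)) y \<longleftrightarrow> c < y"
    using A.cdf_level[OF \<beta>] by blast
  have iM: "integrable (proj_measure \<theta> (K a)) (\<lambda>y. y)"
    unfolding proj_measure_def by (simp add: integrable_distr_eq integrable_inner)
  have m: "{y. \<beta> < cdf (proj_measure \<theta> (K a)) y} \<in> sets borel" by measurable
  have e: "(LINT y|proj_measure \<theta> (K a). f y) = (LINT x|K a. f (\<theta> \<bullet> x))"
    if "f \<in> borel_measurable borel" for f :: "real \<Rightarrow> real"
    unfolding proj_measure_def by (rule integral_distr) (use that in measurable)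
  have "tail_mean \<theta> \<beta> a = (LINT x|K a. indicator {y. \<beta> < cdf (proj_measure \<theta> (K a)) y} (\<theta> \<bullet> x) * (\<theta> \<bullet> x))"
    unfolding tail_mean_def proj_cdf_def by (intro Bochner_Integration.integral_cong) (auto simp: indicator_def)
  also have "\<dots> = (LINT y|proj_measure \<theta> (K a). indicator {y. \<beta> < cdf (proj_measure \<theta> (K a)) y} y * y)"
    by (rule e[symmetric]) (use m in measurable)
  also have "\<dots> = (LINT y|proj_measure \<theta> (K a). max 0 (y - c)) + c * (1 - \<beta>)"
    by (rule A.upper_tail_eq[OF iM c])
  also have "(LINT y|proj_measure \<theta> (K a). max 0 (y - c)) = (LINT x|K a. max 0 (\<theta> \<bullet> x - c))"
    by (rule e) measurable
  finally have Va: "tail_mean \<theta> \<beta> a = (LINT x|K a. max 0 (\<theta> \<bullet> x - c)) + c * (1 - \<beta>)" .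
  have "tail_mean \<theta> \<beta> b \<le> (LINT x|K b. max 0 (\<theta> \<bullet> x - c)) + c * (1 - \<beta>)" for b
  proof -
    have [measurable]: "{x. \<beta> < proj_cdf \<theta> b (\<theta> \<bullet> x)} \<in> sets borel" by measurable
    have "tail_mean \<theta> \<beta> b = (LINT x|K b. indicator {x. \<beta> < proj_cdf \<theta> b (\<theta> \<bullet> x)} x * (\<theta> \<bullet> x))"
      unfolding tail_mean_def by (intro Bochner_Integration.integral_cong) (auto simp: indicator_def)
    also have "\<dots> \<le> (LINT x|K b. max 0 (\<theta> \<bullet> x - c)) + c * measure (K b) {x. \<beta> < proj_cdf \<theta> b (\<theta> \<bullet> x)}"
      by (rule K.expectation_event_le[OF integrable_inner]) simp
    also have "measure (K b) {x. \<beta> < proj_cdf \<theta> b (\<theta> \<bullet> x)} = 1 - \<beta>"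
      using \<beta> by (intro prob_proj_cdf_gt \<theta>) auto
    finally show ?thesis .
  qed
  then show ?thesis using that[of c] c(2) Va by (simp add: proj_cdf_def) (metis add_le_imp_le_right diff_add_cancel)
qed

text \<open>At the optimal threshold the half-space of the hinge is the tail event of the
  corresponding time, so its flux can be written through \<open>proj_cdf\<close>. The lower bound is
  the comparison of \<open>tail_mean_diff_le\<close> with the two times exchanged.\<close>

lemma tail_mean_increment_bounds:
  assumes \<theta>: "\<theta> \<noteq> 0" and \<beta>: "0 < \<beta>" "\<beta> < 1" and st: "0 \<le> s" "s \<le> t" "t < T"
  shows "tail_mean \<theta> \<beta> t - tail_mean \<theta> \<beta> s \<le> (LINT z|L. indicator {s<..t} (fst z) * (indicator {\<beta><..} (proj_cdf \<theta> s (\<theta> \<bullet> snd z)) * (\<theta> \<bullet> u z)))"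
    and "(LINT z|L. indicator {s<..t} (fst z) * (indicator {\<beta><..} (proj_cdf \<theta> t (\<theta> \<bullet> snd z)) * (\<theta> \<bullet> u z))) \<le> tail_mean \<theta> \<beta> t - tail_mean \<theta> \<beta> s"
proof -
  have hinge: "(LINT x|K t. max 0 (\<theta> \<bullet> x - c)) - (LINT x|K s. max 0 (\<theta> \<bullet> x - c)) =
      (LINT z|L. indicator {s<..t} (fst z) * (indicator {\<beta><..} (proj_cdf \<theta> a (\<theta> \<bullet> snd z)) * (\<theta> \<bullet> u z)))"
    if c: "\<And>y. \<beta> < proj_cdf \<theta> a y \<longleftrightarrow> c < y" for c a
  proof -
    have "indicator {\<beta><..} (proj_cdf \<theta> a y) = (indicator {c<..} y :: real)" for y
      using c by (simp add: indicator_def)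
    then show ?thesis using transports_hinge[of \<theta> c] st by (simp add: transports_def)
  qed
  obtain c where c: "\<And>y. \<beta> < proj_cdf \<theta> s y \<longleftrightarrow> c < y"
    "\<And>b. tail_mean \<theta> \<beta> b - tail_mean \<theta> \<beta> s \<le> (LINT x|K b. max 0 (\<theta> \<bullet> x - c)) - (LINT x|K s. max 0 (\<theta> \<bullet> x - c))"
    using tail_mean_diff_le[OF \<theta> \<beta>] by blast
  show "tail_mean \<theta> \<beta> t - tail_mean \<theta> \<beta> s \<le> (LINT z|L. indicator {s<..t} (fst z) * (indicator {\<beta><..} (proj_cdf \<theta> s (\<theta> \<bullet> snd z)) * (\<theta> \<bullet> u z)))"
    using c(2)[of t] hinge[OF c(1)] by simp
  obtain c where c: "\<And>y. \<beta> < proj_cdf \<theta> t y \<longleftrightarrow> c < y"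
    "\<And>b. tail_mean \<theta> \<beta> b - tail_mean \<theta> \<beta> t \<le> (LINT x|K b. max 0 (\<theta> \<bullet> x - c)) - (LINT x|K t. max 0 (\<theta> \<bullet> x - c))"
    using tail_mean_diff_le[OF \<theta> \<beta>] by blast
  show "(LINT z|L. indicator {s<..t} (fst z) * (indicator {\<beta><..} (proj_cdf \<theta> t (\<theta> \<bullet> snd z)) * (\<theta> \<bullet> u z))) \<le> tail_mean \<theta> \<beta> t - tail_mean \<theta> \<beta> s"
    using c(2)[of s] hinge[OF c(1)] by simp
qed

lemma integrable_inner_u: "integrable L (\<lambda>z. \<theta> \<bullet> u z)"
  using transports_inner[of \<theta>] by (simp add: transports_def)

lemma integrable_bounded_inner_u:
  assumes [measurable]: "f \<in> borel_measurable (borel \<Otimes>\<^sub>M borel)" and "\<And>z. \<bar>f z\<bar> \<le> 1"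
  shows "integrable L (\<lambda>z. f z * (\<theta> \<bullet> u z))"
proof (rule Bochner_Integration.integrable_bound[OF integrable_inner_u[of \<theta>]])
  show "AE z in L. norm (f z * (\<theta> \<bullet> u z)) \<le> norm (\<theta> \<bullet> u z)"
    using mult_right_mono[OF assms(2), of "\<bar>_\<bar>"] by (intro AE_I2) (simp add: abs_mult)
qed measurable

text \<open>At a point where \<open>proj_cdf\<close> differs from \<open>\<beta>\<close>, the
  indicator is constant for nearby times, so replacing its time by a sample from the same cell is
  eventually exact. The remaining points are null and
  \<open>\<bar>\<theta> \<bullet> u z\<bar>\<close> dominates. The samples \<open>\<xi>\<close> are
  arbitrary in order to cover left and right end points together.\<close>

lemma riemann_sum_limit:
  assumes \<theta>: "\<theta> \<noteq> 0" and st: "0 \<le> s" "s < t" "t < T"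
    and \<xi>: "\<And>n i. i < Suc n \<Longrightarrow> \<xi> n i \<in> {s + real i * ((t - s) / real (Suc n))..s + real (Suc i) * ((t - s) / real (Suc n))}"
  shows "(\<lambda>n. \<Sum>i<Suc n. LINT z|L. indicator {s + real i * ((t - s) / real (Suc n))<..s + real (Suc i) * ((t - s) / real (Suc n))} (fst z) *
        (indicator {\<beta><..} (proj_cdf \<theta> (\<xi> n i) (\<theta> \<bullet> snd z)) * (\<theta> \<bullet> u z)))
    \<longlonglongrightarrow> (LINT z|L. indicator {s<..t} (fst z) * (indicator {\<beta><..} (proj_cdf \<theta> (fst z) (\<theta> \<bullet> snd z)) * (\<theta> \<bullet> u z)))"
proof -
  define c where "c n i = s + real i * ((t - s) / real (Suc n))" for n i
  define h where "h r z = (indicator {\<beta><..} (proj_cdf \<theta> r (\<theta> \<bullet> snd z)) :: real)" for r and z :: "real \<times> 'a"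
  define q where "q n z = (\<Sum>i<Suc n. indicator {c n i<..c n (Suc i)} (fst z) * h (\<xi> n i) z)" for n and z :: "real \<times> 'a"
  have h01: "0 \<le> h r z" "h r z \<le> 1" for r z by (auto simp: h_def indicator_def)
  have [measurable]: "h r \<in> borel_measurable (borel \<Otimes>\<^sub>M borel)" for r unfolding h_def[abs_def] by measurable
  have [measurable]: "(\<lambda>z. h (fst z) z) \<in> borel_measurable (borel \<Otimes>\<^sub>M borel)" unfolding h_def[abs_def] by measurable
  have [measurable]: "q n \<in> borel_measurable (borel \<Otimes>\<^sub>M borel)" for n unfolding q_def[abs_def] by measurable
  note cell = partition_sum[OF st(2) zero_less_Suc, folded c_def]
  have q_bound: "\<bar>q n z\<bar> \<le> 1" for n z
  proof (cases "fst z \<in> {s<..t}")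
    case True
    then obtain i where "q n z = h (\<xi> n i) z" using cell(2)[OF True, of n] by (auto simp: q_def)
    then show ?thesis using h01[of "\<xi> n i" z] by simp
  next
    case False
    have "q n z = 0" unfolding q_def by (rule cell(1)[OF False])
    then show ?thesis by simp
  qed
  have lim: "AE z in L. (\<lambda>n. q n z * (\<theta> \<bullet> u z)) \<longlonglongrightarrow> indicator {s<..t} (fst z) * (h (fst z) z * (\<theta> \<bullet> u z))"
  proof -
    have "AE z in L. proj_cdf \<theta> (fst z) (\<theta> \<bullet> snd z) \<noteq> \<beta>"
      by (subst AE_L) (use AE_proj_cdf(2)[OF \<theta>] in auto)
    then show ?thesis
    proof eventually_elim
      case (elim z)
      have "(\<lambda>n. q n z) \<longlonglongrightarrow> indicator {s<..t} (fst z) * h (fst z) z"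
      proof (cases "fst z \<in> {s<..t}")
        case False
        then have "q n z = 0" for n unfolding q_def by (rule cell(1))
        then show ?thesis using False by simp
      next
        case True
        define \<tau> y where "\<tau> = fst z" and "y = \<theta> \<bullet> snd z"
        have \<tau>: "s < \<tau>" "\<tau> \<le> t" using True by (auto simp: \<tau>_def)
        have "\<tau> \<in> {0..<1}" "0 < \<bar>proj_cdf \<theta> \<tau> y - \<beta>\<bar>" using \<tau> st T elim by (auto simp: \<tau>_def y_def)
        \<comment> \<open>A change smaller than the distance to \<open>\<beta>\<close> cannot cross
          that level.\<close>
        then have "\<exists>d>0. \<forall>r\<in>{0..<1}. dist r \<tau> < d \<longrightarrow> dist (proj_cdf \<theta> r y) (proj_cdf \<theta> \<tau> y) < \<bar>proj_cdf \<theta> \<tau> y - \<beta>\<bar>"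
          using continuous_on_proj_cdf[OF \<theta>, of y] unfolding continuous_on_iff by blast
        then obtain d where d: "0 < d"
          "\<And>r. r \<in> {0..<1} \<Longrightarrow> \<bar>r - \<tau>\<bar> < d \<Longrightarrow> \<bar>proj_cdf \<theta> r y - proj_cdf \<theta> \<tau> y\<bar> < \<bar>proj_cdf \<theta> \<tau> y - \<beta>\<bar>"
          unfolding dist_real_def by blast
        have h_eq: "h r z = h \<tau> z" if r: "r \<in> {s..t}" "\<bar>r - \<tau>\<bar> < d" for r
        proof -
          have "\<bar>proj_cdf \<theta> r y - proj_cdf \<theta> \<tau> y\<bar> < \<bar>proj_cdf \<theta> \<tau> y - \<beta>\<bar>" using d(2)[of r] r st T by auto
          then show ?thesis by (auto simp: h_def y_def[symmetric] indicator_def)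
        qed
        have "(\<lambda>n. (t - s) * inverse (real (Suc n))) \<longlonglongrightarrow> 0"
          by (rule tendsto_mult_right_zero[OF LIMSEQ_inverse_real_of_nat])
        then have "eventually (\<lambda>n. (t - s) * inverse (real (Suc n)) < d) sequentially"
          using d(1) by (rule order_tendstoD(2))
        then have "eventually (\<lambda>n. q n z = h \<tau> z) sequentially"
        proof eventually_elim
          case (elim n)
          obtain i where i: "i < Suc n" "fst z \<in> {c n i<..c n (Suc i)}"
            "\<And>g. (\<Sum>j<Suc n. indicator {c n j<..c n (Suc j)} (fst z) * g j) = (g i :: real)"
            using cell(2)[OF True, of n] by blast
          have mesh: "c n (Suc i) - c n i = (t - s) * inverse (real (Suc n))"
            by (simp add: c_def divide_inverse algebra_simps)
          have x: "c n i \<le> \<xi> n i" "\<xi> n i \<le> c n (Suc i)" using \<xi>[OF i(1)] by (auto simp: c_def)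
          then have near: "\<bar>\<xi> n i - \<tau>\<bar> < d" using i(2) mesh elim by (auto simp: \<tau>_def)
          have "s \<le> c n i" using st by (simp add: c_def)
          moreover have "c n (Suc i) \<le> t"
          proof -
            have "real (Suc i) * ((t - s) / real (Suc n)) \<le> real (Suc n) * ((t - s) / real (Suc n))"
              using i(1) st by (intro mult_right_mono) auto
            then show ?thesis by (simp add: c_def)
          qed
          ultimately have "h (\<xi> n i) z = h \<tau> z" using h_eq[OF _ near] x by auto
          then show ?case unfolding q_def i(3) .
        qed
        then show ?thesis using True by (simp add: tendsto_eventually \<tau>_def)
      qed
      then have "(\<lambda>n. q n z * (\<theta> \<bullet> u z)) \<longlonglongrightarrow> indicator {s<..t} (fst z) * h (fst z) z * (\<theta> \<bullet> u z)"
        by (rule tendsto_mult_right)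
      then show ?case by (simp only: mult.assoc)
    qed
  qed
  have "(\<lambda>n. LINT z|L. q n z * (\<theta> \<bullet> u z)) \<longlonglongrightarrow> (LINT z|L. indicator {s<..t} (fst z) * (h (fst z) z * (\<theta> \<bullet> u z)))"
  proof (rule integral_dominated_convergence[OF _ _ _ lim])
    show "integrable L (\<lambda>z. \<bar>\<theta> \<bullet> u z\<bar>)" using integrable_inner_u by simp
    show "AE z in L. norm (q n z * (\<theta> \<bullet> u z)) \<le> \<bar>\<theta> \<bullet> u z\<bar>" for n
      using mult_right_mono[OF q_bound, of "\<bar>_\<bar>"] by (intro AE_I2) (simp add: abs_mult)
  qed measurable
  moreover have "(LINT z|L. q n z * (\<theta> \<bullet> u z)) =
      (\<Sum>i<Suc n. (LINT z|L. indicator {c n i<..c n (Suc i)} (fst z) * (h (\<xi> n i) z * (\<theta> \<bullet> u z))))" for n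
  proof -
    have "(LINT z|L. q n z * (\<theta> \<bullet> u z)) =
        (LINT z|L. (\<Sum>i<Suc n. indicator {c n i<..c n (Suc i)} (fst z) * (h (\<xi> n i) z * (\<theta> \<bullet> u z))))"
      unfolding q_def by (simp only: sum_distrib_right mult.assoc)
    also have "\<dots> = (\<Sum>i<Suc n. LINT z|L. indicator {c n i<..c n (Suc i)} (fst z) * (h (\<xi> n i) z * (\<theta> \<bullet> u z)))"
      using h01 by (intro Bochner_Integration.integral_sum integrable_time_slab integrable_bounded_inner_u) auto
    finally show ?thesis .
  qed
  ultimately show ?thesis by (simp only: c_def h_def)
qed

text \<open>The increment telescopes over a partition; upper bounds sample the left end points,
  lower bounds the right ones, and both sums have the same limit. At \<open>\<beta> = 0\<close> the
  tail is almost everything and the linear function itself is transported; at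
  \<open>\<beta> = 1\<close> it is empty.\<close>

lemma tail_mean_increment:
  assumes \<theta>: "\<theta> \<noteq> 0" and \<beta>: "0 \<le> \<beta>" "\<beta> \<le> 1" and st: "0 \<le> s" "s \<le> t" "t < T"
  shows "tail_mean \<theta> \<beta> t - tail_mean \<theta> \<beta> s =
    (LINT z|L. indicator {s<..t} (fst z) * (indicator {\<beta><..} (proj_cdf \<theta> (fst z) (\<theta> \<bullet> snd z)) * (\<theta> \<bullet> u z)))"
proof -
  consider "\<beta> = 0" | "\<beta> = 1" | "s = t" | "0 < \<beta>" "\<beta> < 1" "s < t" using \<beta> st by linarith
  then show ?thesis
  proof cases
    case 1
    have "tail_mean \<theta> \<beta> r = (LINT x|K r. \<theta> \<bullet> x)" for r
      unfolding tail_mean_def using AE_proj_cdf(1)[OF \<theta>, of r] 1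
      by (intro integral_cong_AE) (auto elim: eventually_mono)
    moreover have "AE z in L. 0 < proj_cdf \<theta> (fst z) (\<theta> \<bullet> snd z)"
    proof (subst AE_L)
      show "AE t in lborel. t \<in> {0<..<T} \<longrightarrow> (AE x in K t. 0 < proj_cdf \<theta> (fst (t, x)) (\<theta> \<bullet> snd (t, x)))"
      proof (rule AE_I2, rule impI)
        fix t show "AE x in K t. 0 < proj_cdf \<theta> (fst (t, x)) (\<theta> \<bullet> snd (t, x))"
          using AE_proj_cdf(1)[OF \<theta>, of t] by (auto elim: eventually_mono)
      qed
    qed measurable
    then have "(LINT z|L. indicator {s<..t} (fst z) * (indicator {\<beta><..} (proj_cdf \<theta> (fst z) (\<theta> \<bullet> snd z)) * (\<theta> \<bullet> u z))) =
        (LINT z|L. indicator {s<..t} (fst z) * (\<theta> \<bullet> u z))"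
      using 1 by (intro integral_cong_AE) (auto elim: eventually_mono)
    ultimately show ?thesis using transports_inner[of \<theta>] st by (simp add: transports_def)
  next
    case 2
    interpret R: atomless_distribution "proj_measure \<theta> (K r)" for r by (rule proj_atomless[OF \<theta>])
    have "indicator {\<beta><..} (proj_cdf \<theta> r y) = (0::real)" for r y
      using R.cdf_bounded_prob[of r y] 2 by (auto simp: proj_cdf_def indicator_def)
    then show ?thesis by (simp add: tail_mean_def)
  next
    case 3
    then show ?thesis by simp
  next
    case 4
    define c where "c n i = s + real i * ((t - s) / real (Suc n))" for n i
    have c0: "c n 0 = s" "c n (Suc n) = t" for n by (simp_all add: c_def)
    have c: "0 \<le> c n i" "c n i \<le> c n (Suc i)" for n i
    proof -
      have "0 \<le> (t - s) / real (Suc n)" using st by simp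
      then have "0 \<le> real i * ((t - s) / real (Suc n))"
        "real i * ((t - s) / real (Suc n)) \<le> real (Suc i) * ((t - s) / real (Suc n))"
        by (simp_all only: mult_right_mono mult_nonneg_nonneg of_nat_0_le_iff of_nat_le_iff le_SucI order_refl)
      then show "0 \<le> c n i" "c n i \<le> c n (Suc i)" using st by (simp_all add: c_def)
    qed
    have cT: "c n (Suc i) < T" if "i < Suc n" for n i
    proof -
      have "real (Suc i) * ((t - s) / real (Suc n)) \<le> real (Suc n) * ((t - s) / real (Suc n))"
        using that st by (intro mult_right_mono) auto
      then have "c n (Suc i) \<le> t" by (simp add: c_def)
      then show ?thesis using st by simp
    qed
    have tel: "tail_mean \<theta> \<beta> t - tail_mean \<theta> \<beta> s = (\<Sum>i<Suc n. tail_mean \<theta> \<beta> (c n (Suc i)) - tail_mean \<theta> \<beta> (c n i))" for n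
      using sum_lessThan_telescope[of "\<lambda>i. tail_mean \<theta> \<beta> (c n i)" "Suc n"] c0[of n] by simp
    let ?I = "LINT z|L. indicator {s<..t} (fst z) * (indicator {\<beta><..} (proj_cdf \<theta> (fst z) (\<theta> \<bullet> snd z)) * (\<theta> \<bullet> u z))"
    have "tail_mean \<theta> \<beta> t - tail_mean \<theta> \<beta> s \<le> ?I"
    proof (rule LIMSEQ_le_const)
      show "(\<lambda>n. \<Sum>i<Suc n. LINT z|L. indicator {c n i<..c n (Suc i)} (fst z) *
          (indicator {\<beta><..} (proj_cdf \<theta> (c n i) (\<theta> \<bullet> snd z)) * (\<theta> \<bullet> u z))) \<longlonglongrightarrow> ?I"
        unfolding c_def by (rule riemann_sum_limit[OF \<theta> st(1) 4(3) st(3)]) (use c(2) in \<open>simp add: c_def\<close>)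
      show "\<exists>N. \<forall>n\<ge>N. tail_mean \<theta> \<beta> t - tail_mean \<theta> \<beta> s \<le> (\<Sum>i<Suc n. LINT z|L. indicator {c n i<..c n (Suc i)} (fst z) *
          (indicator {\<beta><..} (proj_cdf \<theta> (c n i) (\<theta> \<bullet> snd z)) * (\<theta> \<bullet> u z)))"
      proof (intro exI allI impI)
        fix n
        show "tail_mean \<theta> \<beta> t - tail_mean \<theta> \<beta> s \<le> (\<Sum>i<Suc n. LINT z|L. indicator {c n i<..c n (Suc i)} (fst z) *
          (indicator {\<beta><..} (proj_cdf \<theta> (c n i) (\<theta> \<bullet> snd z)) * (\<theta> \<bullet> u z)))"
          unfolding tel[of n] by (intro sum_mono tail_mean_increment_bounds(1) \<theta> 4 c cT) simp
      qed
    qed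
    moreover have "?I \<le> tail_mean \<theta> \<beta> t - tail_mean \<theta> \<beta> s"
    proof (rule LIMSEQ_le_const2)
      show "(\<lambda>n. \<Sum>i<Suc n. LINT z|L. indicator {c n i<..c n (Suc i)} (fst z) *
          (indicator {\<beta><..} (proj_cdf \<theta> (c n (Suc i)) (\<theta> \<bullet> snd z)) * (\<theta> \<bullet> u z))) \<longlonglongrightarrow> ?I"
        unfolding c_def by (rule riemann_sum_limit[OF \<theta> st(1) 4(3) st(3)]) (use c(2) in \<open>simp add: c_def\<close>)
      show "\<exists>N. \<forall>n\<ge>N. (\<Sum>i<Suc n. LINT z|L. indicator {c n i<..c n (Suc i)} (fst z) *
          (indicator {\<beta><..} (proj_cdf \<theta> (c n (Suc i)) (\<theta> \<bullet> snd z)) * (\<theta> \<bullet> u z))) \<le> tail_mean \<theta> \<beta> t - tail_mean \<theta> \<beta> s"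
      proof (intro exI allI impI)
        fix n
        show "(\<Sum>i<Suc n. LINT z|L. indicator {c n i<..c n (Suc i)} (fst z) *
          (indicator {\<beta><..} (proj_cdf \<theta> (c n (Suc i)) (\<theta> \<bullet> snd z)) * (\<theta> \<bullet> u z))) \<le> tail_mean \<theta> \<beta> t - tail_mean \<theta> \<beta> s"
          unfolding tel[of n] by (intro sum_mono tail_mean_increment_bounds(2) \<theta> 4 c cT) simp
      qed
    qed
    ultimately show ?thesis by simp
  qed
qed

end

section \<open>The increment of the sliced distance\<close>

locale sliced_curve = curve K u T
  for K :: "real \<Rightarrow> 'a::euclidean_space measure" and u :: "real \<times> 'a \<Rightarrow> 'a" and T :: real +
  fixes \<nu> :: "'a measure"
  assumes \<nu>: "\<nu> \<in> P2"
begin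

abbreviation "\<sigma> \<equiv> (sphere_measure :: 'a measure)"

sublocale \<sigma>: prob_space \<sigma> by (rule prob_space_sphere_measure)
sublocale \<nu>: prob_space \<nu> using \<nu> by (simp add: P2_def)

lemma \<sigma>_sets [simp, measurable_cong]: "sets \<sigma> = sets borel"
  by (simp add: sphere_measure_def)

lemma \<nu>_sets [simp, measurable_cong]: "sets \<nu> = sets borel"
  using \<nu> by (simp add: P2_def)

lemma integrable_norm_sq_\<nu>: "integrable \<nu> (\<lambda>x. (norm x)\<^sup>2)"
  using \<nu> by (simp add: P2_def)

lemma AE_\<sigma>: "AE \<theta> in \<sigma>. norm \<theta> = 1"
  using AE_sphere_measure by eventually_elim simp

definition transport :: "'a \<Rightarrow> real \<Rightarrow> real \<Rightarrow> real" where
  "transport \<theta> t y = monotone_map (proj_measure \<theta> (K t)) (proj_measure \<theta> \<nu>) y"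

text \<open>Up to the factor \<open>\<theta>\<close> the integrand of
  \<open>sliced_discrepancy\<close>; its square integrates to the squared distance of the
  projections.\<close>

definition gap :: "'a \<Rightarrow> real \<times> 'a \<Rightarrow> real" where
  "gap \<theta> z = \<theta> \<bullet> snd z - transport \<theta> (fst z) (\<theta> \<bullet> snd z)"

lemma real_distribution_proj_\<nu>: "real_distribution (proj_measure \<theta> \<nu>)"
  unfolding proj_measure_def by (rule \<nu>.real_distribution_distr) measurable

text \<open>Exchanging the integral over directions with those over space-time rests on
  measurability in direction, time and point together; both projected laws vary with
  \<open>\<theta>\<close>, which is why \<open>measurable_quantile\<close> is stated for
  kernels.\<close>

lemma measurable_transport [measurable]:
  assumes [measurable]: "f \<in> borel_measurable N" "g \<in> borel_measurable N" "h \<in> borel_measurable N"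
  shows "(\<lambda>n. transport (f n) (g n) (h n)) \<in> borel_measurable N"
proof -
  have "\<nu> \<in> space (prob_algebra borel)" by (simp add: space_prob_algebra \<nu>.prob_space_axioms)
  then have "(\<lambda>\<theta>. proj_measure \<theta> \<nu>) \<in> borel \<rightarrow>\<^sub>M prob_algebra borel"
    unfolding proj_measure_def
    by (intro measurable_distr_prob_space2[where M=borel]) (simp, measurable)
  then have "(\<lambda>n. proj_measure (f n) \<nu>) \<in> N \<rightarrow>\<^sub>M prob_algebra borel"
    using measurable_compose[OF assms(1)] by blast
  from measurable_quantile[OF this, of "\<lambda>n. proj_cdf (f n) (g n) (h n)"] show ?thesis
    by (simp add: transport_def monotone_map_def proj_cdf_def[symmetric])
qed

lemma measurable_gap [measurable]:
  assumes [measurable]: "f \<in> borel_measurable N" "g \<in> N \<rightarrow>\<^sub>M borel \<Otimes>\<^sub>M borel"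
  shows "(\<lambda>n. gap (f n) (g n)) \<in> borel_measurable N"
  unfolding gap_def by measurable

section \<open>One fixed direction\<close>

context
  fixes \<theta> :: 'a assumes \<theta>: "\<theta> \<noteq> 0"
begin

lemma AE_transport: "AE x in K t. \<forall>z. z < transport \<theta> t (\<theta> \<bullet> x) \<longleftrightarrow> cdf (proj_measure \<theta> \<nu>) z < proj_cdf \<theta> t (\<theta> \<bullet> x)"
proof -
  have "AE y in proj_measure \<theta> (K t).
      \<forall>z. z < transport \<theta> t y \<longleftrightarrow> cdf (proj_measure \<theta> \<nu>) z < proj_cdf \<theta> t y"
    using AE_monotone_map_less[OF proj_atomless[OF \<theta>] real_distribution_proj_\<nu>, of t \<theta>]
    by (simp only: transport_def proj_cdf_def)
  then show ?thesis
    unfolding proj_measure_def[of \<theta> "K t"] by (rule AE_distrD[rotated]) measurable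
qed

lemma LINT_proj:
  assumes [measurable]: "f \<in> borel_measurable borel"
  shows "(LINT y|proj_measure \<theta> (K t). f y) = (LINT x|K t. f (\<theta> \<bullet> x) :: real)"
    and "integrable (proj_measure \<theta> (K t)) f \<longleftrightarrow> integrable (K t) (\<lambda>x. f (\<theta> \<bullet> x))"
  unfolding proj_measure_def by (simp_all add: integral_distr integrable_distr_eq)

lemma transport_sq:
  "integrable (K t) (\<lambda>x. (transport \<theta> t (\<theta> \<bullet> x))\<^sup>2)"
  "(LINT x|K t. (transport \<theta> t (\<theta> \<bullet> x))\<^sup>2) = (LINT y|\<nu>. (\<theta> \<bullet> y)\<^sup>2)"
  "(W2 (proj_measure \<theta> (K t)) (proj_measure \<theta> \<nu>))\<^sup>2 = (LINT x|K t. (gap \<theta> (t, x))\<^sup>2)"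
proof -
  note W = W2_monotone_map[OF proj_atomless[OF \<theta>] proj_P2[OF moments] proj_P2[OF \<nu>], of t \<theta>, folded transport_def]
  have [measurable]: "(\<lambda>y. transport \<theta> t y) \<in> borel_measurable borel" by measurable
  have 1: "(\<lambda>y. (transport \<theta> t y)\<^sup>2) \<in> borel_measurable borel" "(\<lambda>y. (y - transport \<theta> t y)\<^sup>2) \<in> borel_measurable borel"
    by measurable
  show "integrable (K t) (\<lambda>x. (transport \<theta> t (\<theta> \<bullet> x))\<^sup>2)" using W(1) LINT_proj(2)[OF 1(1)] by simp
  have "(LINT z|proj_measure \<theta> \<nu>. z\<^sup>2) = (LINT y|\<nu>. (\<theta> \<bullet> y)\<^sup>2)"
    unfolding proj_measure_def by (simp add: integral_distr)
  then show "(LINT x|K t. (transport \<theta> t (\<theta> \<bullet> x))\<^sup>2) = (LINT y|\<nu>. (\<theta> \<bullet> y)\<^sup>2)"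
    using W(2) LINT_proj(1)[OF 1(1)] by simp
  show "(W2 (proj_measure \<theta> (K t)) (proj_measure \<theta> \<nu>))\<^sup>2 = (LINT x|K t. (gap \<theta> (t, x))\<^sup>2)"
    using W(3) LINT_proj(1)[OF 1(2)] by (simp add: gap_def)
qed

lemma integrable_inner_sq: "integrable (K t) (\<lambda>x. (\<theta> \<bullet> x)\<^sup>2)"
  using transports_inner_sq[of \<theta>] by (simp add: transports_def)

lemma integrable_inner_transport: "integrable (K t) (\<lambda>x. (\<theta> \<bullet> x) * transport \<theta> t (\<theta> \<bullet> x))"
  using integrable_inner_sq transport_sq(1) by (intro integrable_mult_square) measurable

text \<open>The monotone map has the law of the projected target, so its second moment is the same
  at every time; the slab only contributes its length, which is below 1.\<close>

lemma integrable_transport_sq_L: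
  "integrable L (\<lambda>z. (transport \<theta> (fst z) (\<theta> \<bullet> snd z))\<^sup>2)"
  "(LINT z|L. (transport \<theta> (fst z) (\<theta> \<bullet> snd z))\<^sup>2) \<le> (LINT y|\<nu>. (\<theta> \<bullet> y)\<^sup>2)"
proof -
  let ?C = "LINT y|\<nu>. (\<theta> \<bullet> y)\<^sup>2"
  have C: "0 \<le> ?C" by (rule Bochner_Integration.integral_nonneg) simp
  show i: "integrable L (\<lambda>z. (transport \<theta> (fst z) (\<theta> \<bullet> snd z))\<^sup>2)"
  proof (rule integrableI_bounded)
    have "(\<integral>\<^sup>+z. ennreal (norm ((transport \<theta> (fst z) (\<theta> \<bullet> snd z))\<^sup>2)) \<partial>L) =
        (\<integral>\<^sup>+t. indicator {0<..<T} t * (\<integral>\<^sup>+x. ennreal ((transport \<theta> t (\<theta> \<bullet> x))\<^sup>2) \<partial>K t) \<partial>lborel)"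
      by (subst nn_integral_L) simp_all
    also have "\<dots> = (\<integral>\<^sup>+t. ennreal ?C * indicator {0<..<T} t \<partial>lborel)"
      using transport_sq(1,2) by (intro nn_integral_cong) (simp add: nn_integral_eq_integral mult.commute)
    also have "\<dots> < \<infinity>" using T by (simp add: nn_integral_cmult ennreal_mult_less_top)
    finally show "(\<integral>\<^sup>+z. ennreal (norm ((transport \<theta> (fst z) (\<theta> \<bullet> snd z))\<^sup>2)) \<partial>L) < \<infinity>" .
  qed measurable
  have "(LINT z|L. (transport \<theta> (fst z) (\<theta> \<bullet> snd z))\<^sup>2) = (LINT t|lborel. ?C * indicator {0<..<T} t)"
    using has_bochner_integral_integral_eq[OF integral_L[OF i]] by (simp add: transport_sq(2) mult.commute)
  also have "\<dots> = ?C * T" using T by simp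
  also have "\<dots> \<le> ?C * 1" using T C by (intro mult_left_mono) auto
  finally show "(LINT z|L. (transport \<theta> (fst z) (\<theta> \<bullet> snd z))\<^sup>2) \<le> ?C" by simp
qed

lemma inner_sq_le: "(\<theta> \<bullet> x)\<^sup>2 \<le> (norm \<theta>)\<^sup>2 * (norm x)\<^sup>2"
  using Cauchy_Schwarz_ineq[of \<theta> x] by (simp add: power2_norm_eq_inner)

lemma gap_sq_le: "(gap \<theta> z)\<^sup>2 \<le> 2 * (norm \<theta>)\<^sup>2 * (norm (snd z))\<^sup>2 + 2 * (transport \<theta> (fst z) (\<theta> \<bullet> snd z))\<^sup>2"
proof -
  have "0 \<le> (\<theta> \<bullet> snd z + transport \<theta> (fst z) (\<theta> \<bullet> snd z))\<^sup>2" by simp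
  then have "(gap \<theta> z)\<^sup>2 \<le> 2 * (\<theta> \<bullet> snd z)\<^sup>2 + 2 * (transport \<theta> (fst z) (\<theta> \<bullet> snd z))\<^sup>2"
    by (simp add: gap_def power2_diff power2_sum)
  then show ?thesis using inner_sq_le[of "snd z"] by linarith
qed

lemma inner_sq_\<nu>_le: "(LINT y|\<nu>. (\<theta> \<bullet> y)\<^sup>2) \<le> (norm \<theta>)\<^sup>2 * (LINT y|\<nu>. (norm y)\<^sup>2)"
proof -
  have "integrable \<nu> (\<lambda>y. (\<theta> \<bullet> y)\<^sup>2)"
    by (rule Bochner_Integration.integrable_bound[OF integrable_mult_right[OF integrable_norm_sq_\<nu>, of "(norm \<theta>)\<^sup>2"]])
      (use inner_sq_le in auto)
  then have "(LINT y|\<nu>. (\<theta> \<bullet> y)\<^sup>2) \<le> (LINT y|\<nu>. (norm \<theta>)\<^sup>2 * (norm y)\<^sup>2)"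
    using integrable_norm_sq_\<nu> inner_sq_le by (intro integral_mono) auto
  then show ?thesis by simp
qed

text \<open>The bound scales with the squared norm of \<open>\<theta>\<close>, hence is uniform over
  the sphere, as integrability over directions requires.\<close>

lemma gap_sq_K:
  "integrable (K t) (\<lambda>x. (gap \<theta> (t, x))\<^sup>2)"
  "(LINT x|K t. (gap \<theta> (t, x))\<^sup>2) \<le> 2 * (norm \<theta>)\<^sup>2 * ((LINT x|K t. (norm x)\<^sup>2) + (LINT y|\<nu>. (norm y)\<^sup>2))"
proof -
  have b: "integrable (K t) (\<lambda>x. 2 * (norm \<theta>)\<^sup>2 * (norm x)\<^sup>2 + 2 * (transport \<theta> t (\<theta> \<bullet> x))\<^sup>2)"
    using integrable_norm_sq_K transport_sq(1) by simp
  show i: "integrable (K t) (\<lambda>x. (gap \<theta> (t, x))\<^sup>2)"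
    by (rule Bochner_Integration.integrable_bound[OF b]) (use gap_sq_le[of "(t, _)"] in auto)
  have "(LINT x|K t. (gap \<theta> (t, x))\<^sup>2) \<le> (LINT x|K t. 2 * (norm \<theta>)\<^sup>2 * (norm x)\<^sup>2 + 2 * (transport \<theta> t (\<theta> \<bullet> x))\<^sup>2)"
    using gap_sq_le[of "(t, _)"] by (intro integral_mono i b) auto
  also have "\<dots> = 2 * (norm \<theta>)\<^sup>2 * (LINT x|K t. (norm x)\<^sup>2) + 2 * (LINT y|\<nu>. (\<theta> \<bullet> y)\<^sup>2)"
    using integrable_norm_sq_K transport_sq(1,2) by simp
  also have "\<dots> \<le> 2 * (norm \<theta>)\<^sup>2 * ((LINT x|K t. (norm x)\<^sup>2) + (LINT y|\<nu>. (norm y)\<^sup>2))"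
    using inner_sq_\<nu>_le by (simp add: distrib_left)
  finally show "(LINT x|K t. (gap \<theta> (t, x))\<^sup>2) \<le> \<dots>" .
qed

lemma gap_sq_L:
  "integrable L (\<lambda>z. (gap \<theta> z)\<^sup>2)"
  "(LINT z|L. (gap \<theta> z)\<^sup>2) \<le> 2 * (norm \<theta>)\<^sup>2 * ((LINT z|L. (norm (snd z))\<^sup>2) + (LINT y|\<nu>. (norm y)\<^sup>2))"
proof -
  have b: "integrable L (\<lambda>z. 2 * (norm \<theta>)\<^sup>2 * (norm (snd z))\<^sup>2 + 2 * (transport \<theta> (fst z) (\<theta> \<bullet> snd z))\<^sup>2)"
    using integrable_norm_sq_L integrable_transport_sq_L(1) by simp
  show i: "integrable L (\<lambda>z. (gap \<theta> z)\<^sup>2)"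
    by (rule Bochner_Integration.integrable_bound[OF b]) (use gap_sq_le in auto)
  have "(LINT z|L. (gap \<theta> z)\<^sup>2) \<le> (LINT z|L. 2 * (norm \<theta>)\<^sup>2 * (norm (snd z))\<^sup>2 + 2 * (transport \<theta> (fst z) (\<theta> \<bullet> snd z))\<^sup>2)"
    using gap_sq_le by (intro integral_mono i b) auto
  also have "\<dots> = 2 * (norm \<theta>)\<^sup>2 * (LINT z|L. (norm (snd z))\<^sup>2) + 2 * (LINT z|L. (transport \<theta> (fst z) (\<theta> \<bullet> snd z))\<^sup>2)"
    using integrable_norm_sq_L integrable_transport_sq_L(1) by simp
  also have "\<dots> \<le> 2 * (norm \<theta>)\<^sup>2 * ((LINT z|L. (norm (snd z))\<^sup>2) + (LINT y|\<nu>. (norm y)\<^sup>2))"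
    using inner_sq_\<nu>_le integrable_transport_sq_L(2) by (simp add: distrib_left)
  finally show "(LINT z|L. (gap \<theta> z)\<^sup>2) \<le> \<dots>" .
qed

lemma inner_u_sq: "integrable L (\<lambda>z. (\<theta> \<bullet> u z)\<^sup>2)"
  by (rule Bochner_Integration.integrable_bound[OF integrable_mult_right[OF energy, of "(norm \<theta>)\<^sup>2"]])
    (use inner_sq_le in auto)

lemma integrable_transport_u: "integrable L (\<lambda>z. (\<theta> \<bullet> u z) * transport \<theta> (fst z) (\<theta> \<bullet> snd z))"
  using inner_u_sq integrable_transport_sq_L(1) by (intro integrable_mult_square) measurable



text \<open>The layer-cake formula is used with common levels at both times, weighted by
  \<open>\<theta> \<bullet> x\<close>, and on the slab, weighted by
  \<open>\<theta> \<bullet> u\<close> cut to the interval. At level \<open>z\<close> the claim is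
  \<open>tail_mean_increment\<close> for \<open>?G z\<close>; the second term of
  \<open>level\<close> adds, for negative \<open>z\<close>, the increment of the mean of
  \<open>\<theta> \<bullet> x\<close> on either side.\<close>

lemma inner_transport_increment:
  assumes st: "0 \<le> s" "s \<le> t" "t < T"
  shows "(LINT x|K t. (\<theta> \<bullet> x) * transport \<theta> t (\<theta> \<bullet> x)) - (LINT x|K s. (\<theta> \<bullet> x) * transport \<theta> s (\<theta> \<bullet> x)) =
    (LINT z|L. indicator {s<..t} (fst z) * ((\<theta> \<bullet> u z) * transport \<theta> (fst z) (\<theta> \<bullet> snd z)))"
proof -
  let ?G = "cdf (proj_measure \<theta> \<nu>)"
  let ?neg = "\<lambda>z::real. if z < 0 then 1 else 0 :: real"
  interpret R: real_distribution "proj_measure \<theta> \<nu>" by (rule real_distribution_proj_\<nu>)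
  have G: "0 \<le> ?G z" "?G z \<le> 1" for z using R.cdf_nonneg R.cdf_bounded_prob by auto
  have lev: "level z y = indicator {?G z<..} f - ?neg z" if "z < y \<longleftrightarrow> ?G z < f" for z y f
    using that by (simp add: level_def indicator_def)
  have K1: "(LINT x|K r. (\<theta> \<bullet> x) * level z (transport \<theta> r (\<theta> \<bullet> x))) = tail_mean \<theta> (?G z) r - ?neg z * (LINT x|K r. \<theta> \<bullet> x)" for r z
  proof -
    have i: "integrable (K r) (\<lambda>x. indicator {?G z<..} (proj_cdf \<theta> r (\<theta> \<bullet> x)) * (\<theta> \<bullet> x))"
      by (rule Bochner_Integration.integrable_bound[OF integrable_inner[of r \<theta>]]) (auto simp: indicator_def)
    have "(LINT x|K r. (\<theta> \<bullet> x) * level z (transport \<theta> r (\<theta> \<bullet> x))) =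
        (LINT x|K r. indicator {?G z<..} (proj_cdf \<theta> r (\<theta> \<bullet> x)) * (\<theta> \<bullet> x) - ?neg z * (\<theta> \<bullet> x))"
    proof (rule integral_cong_AE)
      show "AE x in K r. (\<theta> \<bullet> x) * level z (transport \<theta> r (\<theta> \<bullet> x)) =
          indicator {?G z<..} (proj_cdf \<theta> r (\<theta> \<bullet> x)) * (\<theta> \<bullet> x) - ?neg z * (\<theta> \<bullet> x)"
        using AE_transport
      proof eventually_elim
        case (elim x)
        show ?case unfolding lev[OF elim[rule_format]] by (simp add: algebra_simps)
      qed
    qed measurable
    also have "\<dots> = tail_mean \<theta> (?G z) r - ?neg z * (LINT x|K r. \<theta> \<bullet> x)"
      unfolding tail_mean_def using integrable_inner by (subst Bochner_Integration.integral_diff[OF i]) auto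
    finally show ?thesis .
  qed
  have L1: "(LINT q|L. (indicator {s<..t} (fst q) * (\<theta> \<bullet> u q)) * level z (transport \<theta> (fst q) (\<theta> \<bullet> snd q))) =
      (tail_mean \<theta> (?G z) t - tail_mean \<theta> (?G z) s) - ?neg z * ((LINT x|K t. \<theta> \<bullet> x) - (LINT x|K s. \<theta> \<bullet> x))" for z
  proof -
    have AEL: "AE q in L. z < transport \<theta> (fst q) (\<theta> \<bullet> snd q) \<longleftrightarrow> ?G z < proj_cdf \<theta> (fst q) (\<theta> \<bullet> snd q)"
    proof (subst AE_L)
      show "AE t in lborel. t \<in> {0<..<T} \<longrightarrow> (AE x in K t. z < transport \<theta> (fst (t, x)) (\<theta> \<bullet> snd (t, x)) \<longleftrightarrow>
          ?G z < proj_cdf \<theta> (fst (t, x)) (\<theta> \<bullet> snd (t, x)))"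
      proof (rule AE_I2, rule impI)
        fix t show "AE x in K t. z < transport \<theta> (fst (t, x)) (\<theta> \<bullet> snd (t, x)) \<longleftrightarrow>
          ?G z < proj_cdf \<theta> (fst (t, x)) (\<theta> \<bullet> snd (t, x))"
          using AE_transport[of t] by eventually_elim simp
      qed
    qed measurable
    have i1: "integrable L (\<lambda>q. indicator {s<..t} (fst q) * (indicator {?G z<..} (proj_cdf \<theta> (fst q) (\<theta> \<bullet> snd q)) * (\<theta> \<bullet> u q)))"
    proof (rule integrable_time_slab, rule integrable_bounded_inner_u)
      show "(\<lambda>q. indicator {?G z<..} (proj_cdf \<theta> (fst q) (\<theta> \<bullet> snd q)) :: real) \<in> borel_measurable (borel \<Otimes>\<^sub>M borel)"
        by measurable
    qed (simp add: indicator_def)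
    have i2: "integrable L (\<lambda>q. ?neg z * (indicator {s<..t} (fst q) * (\<theta> \<bullet> u q)))"
      by (intro integrable_mult_right integrable_time_slab integrable_inner_u)
    have "(LINT q|L. (indicator {s<..t} (fst q) * (\<theta> \<bullet> u q)) * level z (transport \<theta> (fst q) (\<theta> \<bullet> snd q))) =
      (LINT q|L. indicator {s<..t} (fst q) * (indicator {?G z<..} (proj_cdf \<theta> (fst q) (\<theta> \<bullet> snd q)) * (\<theta> \<bullet> u q)) -
        ?neg z * (indicator {s<..t} (fst q) * (\<theta> \<bullet> u q)))"
    proof (rule integral_cong_AE)
      show "AE q in L. (indicator {s<..t} (fst q) * (\<theta> \<bullet> u q)) * level z (transport \<theta> (fst q) (\<theta> \<bullet> snd q)) =
        indicator {s<..t} (fst q) * (indicator {?G z<..} (proj_cdf \<theta> (fst q) (\<theta> \<bullet> snd q)) * (\<theta> \<bullet> u q)) -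
        ?neg z * (indicator {s<..t} (fst q) * (\<theta> \<bullet> u q))"
        using AEL
      proof eventually_elim
        case (elim q)
        show ?case unfolding lev[OF elim] by (simp add: algebra_simps)
      qed
    qed measurable
    also have "\<dots> = (tail_mean \<theta> (?G z) t - tail_mean \<theta> (?G z) s) - ?neg z * ((LINT x|K t. \<theta> \<bullet> x) - (LINT x|K s. \<theta> \<bullet> x))"
      using transports_inner[of \<theta>] st
      by (simp only: Bochner_Integration.integral_diff[OF i1 i2] tail_mean_increment[OF \<theta> G st] integral_mult_right_zero)
        (simp add: transports_def)
    finally show ?thesis .
  qed
  have c: "integrable L (\<lambda>q. (indicator {s<..t} (fst q) * (\<theta> \<bullet> u q)) * transport \<theta> (fst q) (\<theta> \<bullet> snd q))"
    using integrable_time_slab[OF integrable_transport_u] by (simp only: mult.assoc)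
  have cake_L: "(LINT z|lborel. LINT q|L. (indicator {s<..t} (fst q) * (\<theta> \<bullet> u q)) * level z (transport \<theta> (fst q) (\<theta> \<bullet> snd q))) =
      (LINT q|L. (indicator {s<..t} (fst q) * (\<theta> \<bullet> u q)) * transport \<theta> (fst q) (\<theta> \<bullet> snd q))"
    by (rule layer_cake(2)[OF L.sigma_finite_measure_axioms _ _ c]) measurable
  have cake_K: "integrable lborel (\<lambda>z. LINT x|K r. (\<theta> \<bullet> x) * level z (transport \<theta> r (\<theta> \<bullet> x)))"
    "(LINT z|lborel. LINT x|K r. (\<theta> \<bullet> x) * level z (transport \<theta> r (\<theta> \<bullet> x))) = (LINT x|K r. (\<theta> \<bullet> x) * transport \<theta> r (\<theta> \<bullet> x))" for r
    by (rule layer_cake[OF K.sigma_finite_measure_axioms _ _ integrable_inner_transport]; measurable)+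
  have "(LINT x|K t. (\<theta> \<bullet> x) * transport \<theta> t (\<theta> \<bullet> x)) - (LINT x|K s. (\<theta> \<bullet> x) * transport \<theta> s (\<theta> \<bullet> x)) =
      (LINT z|lborel. (LINT x|K t. (\<theta> \<bullet> x) * level z (transport \<theta> t (\<theta> \<bullet> x))) - (LINT x|K s. (\<theta> \<bullet> x) * level z (transport \<theta> s (\<theta> \<bullet> x))))"
    by (simp only: Bochner_Integration.integral_diff[OF cake_K(1) cake_K(1)] cake_K(2))
  also have "\<dots> = (LINT z|lborel. LINT q|L. (indicator {s<..t} (fst q) * (\<theta> \<bullet> u q)) * level z (transport \<theta> (fst q) (\<theta> \<bullet> snd q)))"
    by (intro Bochner_Integration.integral_cong refl) (simp only: K1 L1 right_diff_distrib)
  finally show ?thesis unfolding cake_L by (simp only: mult.assoc)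
qed

text \<open>In the expanded square the target contributes a constant, the second moment is
  transported as a quadratic function, and the cross term is
  \<open>inner_transport_increment\<close>. The two fluxes recombine into
  \<open>gap\<close>.\<close>

lemma W2_sq_increment:
  assumes st: "0 \<le> s" "s \<le> t" "t < T"
  shows "(W2 (proj_measure \<theta> (K t)) (proj_measure \<theta> \<nu>))\<^sup>2 - (W2 (proj_measure \<theta> (K s)) (proj_measure \<theta> \<nu>))\<^sup>2 =
    (LINT z|L. indicator {s<..t} (fst z) * (2 * (gap \<theta> z * (\<theta> \<bullet> u z))))"
proof -
  have W: "(W2 (proj_measure \<theta> (K r)) (proj_measure \<theta> \<nu>))\<^sup>2 =
      (LINT x|K r. (\<theta> \<bullet> x)\<^sup>2) + (LINT y|\<nu>. (\<theta> \<bullet> y)\<^sup>2) - 2 * (LINT x|K r. (\<theta> \<bullet> x) * transport \<theta> r (\<theta> \<bullet> x))" for r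
  proof -
    have "(gap \<theta> (r, x))\<^sup>2 = (\<theta> \<bullet> x)\<^sup>2 + (transport \<theta> r (\<theta> \<bullet> x))\<^sup>2 - 2 * ((\<theta> \<bullet> x) * transport \<theta> r (\<theta> \<bullet> x))" for x
      by (simp add: gap_def power2_diff)
    then show ?thesis
      using integrable_inner_sq[of r] transport_sq[of r] integrable_inner_transport[of r] by simp
  qed
  have e: "indicator {s<..t} (fst z) * (2 * (gap \<theta> z * (\<theta> \<bullet> u z))) =
      indicator {s<..t} (fst z) * (((2 * (\<theta> \<bullet> snd z)) *\<^sub>R \<theta>) \<bullet> u z) -
      2 * (indicator {s<..t} (fst z) * ((\<theta> \<bullet> u z) * transport \<theta> (fst z) (\<theta> \<bullet> snd z)))" for z
    by (simp add: gap_def algebra_simps)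
  have i1: "integrable L (\<lambda>z. indicator {s<..t} (fst z) * (((2 * (\<theta> \<bullet> snd z)) *\<^sub>R \<theta>) \<bullet> u z))"
    using transports_inner_sq[of \<theta>] by (intro integrable_time_slab) (simp add: transports_def)
  have i2: "integrable L (\<lambda>z. 2 * (indicator {s<..t} (fst z) * ((\<theta> \<bullet> u z) * transport \<theta> (fst z) (\<theta> \<bullet> snd z))))"
    by (intro integrable_mult_right integrable_time_slab integrable_transport_u)
  have "(LINT x|K t. (\<theta> \<bullet> x)\<^sup>2) - (LINT x|K s. (\<theta> \<bullet> x)\<^sup>2) =
      (LINT z|L. indicator {s<..t} (fst z) * (((2 * (\<theta> \<bullet> snd z)) *\<^sub>R \<theta>) \<bullet> u z))"
    using transports_inner_sq[of \<theta>] st by (simp only: transports_def)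
  then show ?thesis
    unfolding W e Bochner_Integration.integral_diff[OF i1 i2] integral_mult_right_zero
    using inner_transport_increment[OF st] by linarith
qed

end

end

section \<open>Integration over directions\<close>

context sliced_curve begin

sublocale PL: pair_sigma_finite \<sigma> L ..
sublocale PK: pair_sigma_finite \<sigma> "K t" for t ..

lemma AE_\<sigma>_nonzero: "AE \<theta> in \<sigma>. \<theta> \<noteq> 0"
  using AE_\<sigma> by eventually_elim auto

lemma integrable_gap_sq_pair_K: "integrable (\<sigma> \<Otimes>\<^sub>M K t) (\<lambda>(\<theta>, x). (gap \<theta> (t, x))\<^sup>2)"
proof (rule PK.Fubini_integrable)
  show "integrable \<sigma> (\<lambda>\<theta>. LINT x|K t. norm (case (\<theta>, x) of (\<theta>, x) \<Rightarrow> (gap \<theta> (t, x))\<^sup>2))"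
  proof (rule \<sigma>.integrable_const_bound[where B="2 * ((LINT x|K t. (norm x)\<^sup>2) + (LINT y|\<nu>. (norm y)\<^sup>2))"])
    show "AE \<theta> in \<sigma>. norm (LINT x|K t. norm (case (\<theta>, x) of (\<theta>, x) \<Rightarrow> (gap \<theta> (t, x))\<^sup>2)) \<le>
        2 * ((LINT x|K t. (norm x)\<^sup>2) + (LINT y|\<nu>. (norm y)\<^sup>2))"
      using AE_\<sigma>
    proof eventually_elim
      case (elim \<theta>)
      then have "\<theta> \<noteq> 0" by auto
      from gap_sq_K(2)[OF this, of t] elim show ?case by simp
    qed
  qed measurable
  show "AE \<theta> in \<sigma>. integrable (K t) (\<lambda>x. case (\<theta>, x) of (\<theta>, x) \<Rightarrow> (gap \<theta> (t, x))\<^sup>2)"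
    using AE_\<sigma>_nonzero by eventually_elim (simp add: gap_sq_K(1))
qed measurable

lemma integrable_gap_sq_pair_L: "integrable (\<sigma> \<Otimes>\<^sub>M L) (\<lambda>(\<theta>, z). (gap \<theta> z)\<^sup>2)"
proof (rule PL.Fubini_integrable)
  show "integrable \<sigma> (\<lambda>\<theta>. LINT z|L. norm (case (\<theta>, z) of (\<theta>, z) \<Rightarrow> (gap \<theta> z)\<^sup>2))"
  proof (rule \<sigma>.integrable_const_bound[where B="2 * ((LINT z|L. (norm (snd z))\<^sup>2) + (LINT y|\<nu>. (norm y)\<^sup>2))"])
    show "AE \<theta> in \<sigma>. norm (LINT z|L. norm (case (\<theta>, z) of (\<theta>, z) \<Rightarrow> (gap \<theta> z)\<^sup>2)) \<le>
        2 * ((LINT z|L. (norm (snd z))\<^sup>2) + (LINT y|\<nu>. (norm y)\<^sup>2))"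
      using AE_\<sigma>
    proof eventually_elim
      case (elim \<theta>)
      then have "\<theta> \<noteq> 0" by auto
      from gap_sq_L(2)[OF this] elim show ?case by simp
    qed
  qed measurable
  show "AE \<theta> in \<sigma>. integrable L (\<lambda>z. case (\<theta>, z) of (\<theta>, z) \<Rightarrow> (gap \<theta> z)\<^sup>2)"
    using AE_\<sigma>_nonzero by eventually_elim (simp add: gap_sq_L(1))
qed measurable

lemma integrable_inner_u_sq_pair: "integrable (\<sigma> \<Otimes>\<^sub>M L) (\<lambda>(\<theta>, z). (\<theta> \<bullet> u z)\<^sup>2)"
proof (rule PL.Fubini_integrable)
  show "integrable \<sigma> (\<lambda>\<theta>. LINT z|L. norm (case (\<theta>, z) of (\<theta>, z) \<Rightarrow> (\<theta> \<bullet> u z)\<^sup>2))"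
  proof (rule \<sigma>.integrable_const_bound[where B="LINT z|L. (norm (u z))\<^sup>2"])
    show "AE \<theta> in \<sigma>. norm (LINT z|L. norm (case (\<theta>, z) of (\<theta>, z) \<Rightarrow> (\<theta> \<bullet> u z)\<^sup>2)) \<le> (LINT z|L. (norm (u z))\<^sup>2)"
      using AE_\<sigma>
    proof eventually_elim
      case (elim \<theta>)
      then have \<theta>: "\<theta> \<noteq> 0" by auto
      have "(LINT z|L. (\<theta> \<bullet> u z)\<^sup>2) \<le> (LINT z|L. (norm (u z))\<^sup>2)"
        using inner_sq_le[OF \<theta>] elim by (intro integral_mono inner_u_sq[OF \<theta>] energy) simp
      then show ?case by simp
    qed
  qed measurable
  show "AE \<theta> in \<sigma>. integrable L (\<lambda>z. case (\<theta>, z) of (\<theta>, z) \<Rightarrow> (\<theta> \<bullet> u z)\<^sup>2)"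
    using AE_\<sigma>_nonzero by eventually_elim (simp add: inner_u_sq)
qed measurable

lemma integrable_gap_u_pair: "integrable (\<sigma> \<Otimes>\<^sub>M L) (\<lambda>(\<theta>, z). gap \<theta> z * (\<theta> \<bullet> u z))"
proof -
  have "integrable (\<sigma> \<Otimes>\<^sub>M L) (\<lambda>q. gap (fst q) (snd q) * (fst q \<bullet> u (snd q)))"
  proof (rule integrable_mult_square)
    show "integrable (\<sigma> \<Otimes>\<^sub>M L) (\<lambda>q. (gap (fst q) (snd q))\<^sup>2)"
      using integrable_gap_sq_pair_L by (simp add: case_prod_unfold)
    show "integrable (\<sigma> \<Otimes>\<^sub>M L) (\<lambda>q. (fst q \<bullet> u (snd q))\<^sup>2)"
      using integrable_inner_u_sq_pair by (simp add: case_prod_unfold)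
  qed measurable
  then show ?thesis by (simp add: case_prod_unfold)
qed

lemma measurable_gap_fixed [measurable]:
  "f \<in> borel_measurable N \<Longrightarrow> (\<lambda>n. gap (f n) z) \<in> borel_measurable N"
  by (rule measurable_gap) (auto simp: space_pair_measure)

abbreviation "r t \<equiv> SW2 (K t) \<nu>"

lemma r_nonneg: "0 \<le> r t"
  unfolding SW2_def by (simp add: Bochner_Integration.integral_nonneg)

text \<open>The third form, with the integrals exchanged, lets the time integral of the squared
  distance be read off the slab.\<close>

lemma SW2_sq:
  "integrable \<sigma> (\<lambda>\<theta>. (W2 (proj_measure \<theta> (K t)) (proj_measure \<theta> \<nu>))\<^sup>2)"
  "(r t)\<^sup>2 = (LINT \<theta>|\<sigma>. (W2 (proj_measure \<theta> (K t)) (proj_measure \<theta> \<nu>))\<^sup>2)"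
  "(r t)\<^sup>2 = (LINT x|K t. LINT \<theta>|\<sigma>. (gap \<theta> (t, x))\<^sup>2)"
proof -
  let ?w = "\<lambda>\<theta>. (W2 (proj_measure \<theta> (K t)) (proj_measure \<theta> \<nu>))\<^sup>2"
  \<comment> \<open>The formula through \<open>gap\<close> holds for nonzero directions; the value
    at the origin is patched in to obtain measurability, and the sphere measure does not charge that
    point.\<close>
  have "?w = (\<lambda>\<theta>. if \<theta> = 0 then ?w 0 else LINT x|K t. (gap \<theta> (t, x))\<^sup>2)"
    using transport_sq(3) by auto
  also have "\<dots> \<in> borel_measurable \<sigma>" by measurable
  finally have m: "?w \<in> borel_measurable \<sigma>" .
  have ae: "AE \<theta> in \<sigma>. ?w \<theta> = (LINT x|K t. (gap \<theta> (t, x))\<^sup>2)"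
    using AE_\<sigma>_nonzero by eventually_elim (rule transport_sq(3))
  have i: "integrable \<sigma> (\<lambda>\<theta>. LINT x|K t. (gap \<theta> (t, x))\<^sup>2)"
    using PK.integrable_fst[OF integrable_gap_sq_pair_K] .
  show iw: "integrable \<sigma> ?w"
    by (rule iffD2[OF integrable_cong_AE[OF m borel_measurable_integrable[OF i] ae] i])
  show *: "(r t)\<^sup>2 = (LINT \<theta>|\<sigma>. ?w \<theta>)"
    unfolding SW2_def by (simp add: Bochner_Integration.integral_nonneg)
  also have "\<dots> = (LINT \<theta>|\<sigma>. LINT x|K t. (gap \<theta> (t, x))\<^sup>2)"
    by (rule integral_cong_AE[OF m _ ae]) (rule borel_measurable_integrable[OF i])
  also have "\<dots> = (LINT x|K t. LINT \<theta>|\<sigma>. (gap \<theta> (t, x))\<^sup>2)"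
    using PK.Fubini_integral[OF integrable_gap_sq_pair_K] by simp
  finally show "(r t)\<^sup>2 = (LINT x|K t. LINT \<theta>|\<sigma>. (gap \<theta> (t, x))\<^sup>2)" .
qed

text \<open>A scalar stand-in for the inner product of the discrepancy field with \<open>u\<close>.
  The two agree wherever \<open>gap\<close> is square integrable over directions; elsewhere the
  vector integral may be a default value, and working with \<open>D\<close> postpones the
  distinction until it concerns a null set.\<close>

definition D :: "real \<times> 'a \<Rightarrow> real" where
  "D z = (LINT \<theta>|\<sigma>. gap \<theta> z * (\<theta> \<bullet> u z))"

lemma measurable_D [measurable]: "D \<in> borel_measurable (borel \<Otimes>\<^sub>M borel)"
  unfolding D_def[abs_def] by measurable

lemma integrable_D: "integrable L D"
  using PL.integrable_snd[OF integrable_gap_u_pair] by (simp add: D_def[abs_def])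

lemma SW2_sq_increment:
  assumes st: "0 \<le> s" "s \<le> t" "t < T"
  shows "(r t)\<^sup>2 - (r s)\<^sup>2 = (LINT z|L. indicator {s<..t} (fst z) * (2 * D z))"
proof -
  let ?w = "\<lambda>t \<theta>. (W2 (proj_measure \<theta> (K t)) (proj_measure \<theta> \<nu>))\<^sup>2"
  let ?g = "\<lambda>\<theta> z. indicator {s<..t} (fst z) * (2 * (gap \<theta> z * (\<theta> \<bullet> u z)))"
  have ig: "integrable (\<sigma> \<Otimes>\<^sub>M L) (\<lambda>(\<theta>, z). ?g \<theta> z)"
  proof (rule Bochner_Integration.integrable_bound[OF integrable_mult_right[OF integrable_gap_u_pair, of 2]])
    show "AE q in \<sigma> \<Otimes>\<^sub>M L. norm (case q of (\<theta>, z) \<Rightarrow> ?g \<theta> z) \<le> norm (2 * (case q of (\<theta>, z) \<Rightarrow> gap \<theta> z * (\<theta> \<bullet> u z)))"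
      by (intro AE_I2) (auto simp: indicator_def split: prod.split)
  qed measurable
  have "(r t)\<^sup>2 - (r s)\<^sup>2 = (LINT \<theta>|\<sigma>. ?w t \<theta> - ?w s \<theta>)"
    unfolding SW2_sq(2) by (rule Bochner_Integration.integral_diff[symmetric]) (rule SW2_sq(1))+
  also have "\<dots> = (LINT \<theta>|\<sigma>. LINT z|L. ?g \<theta> z)"
  proof (rule integral_cong_AE)
    show "AE \<theta> in \<sigma>. ?w t \<theta> - ?w s \<theta> = (LINT z|L. ?g \<theta> z)"
      using AE_\<sigma>_nonzero by eventually_elim (rule W2_sq_increment[OF _ st])
    show "(\<lambda>\<theta>. ?w t \<theta> - ?w s \<theta>) \<in> borel_measurable \<sigma>"
      using SW2_sq(1) by (intro borel_measurable_diff borel_measurable_integrable)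
  qed measurable
  also have "\<dots> = (LINT z|L. LINT \<theta>|\<sigma>. ?g \<theta> z)"
    using PL.Fubini_integral[OF ig] by simp
  also have "\<dots> = (LINT z|L. indicator {s<..t} (fst z) * (2 * D z))"
    by (simp add: D_def)
  finally show ?thesis .
qed

lemma sliced_discrepancy_eq: "sliced_discrepancy (K t) \<nu> x = (LINT \<theta>|\<sigma>. gap \<theta> (t, x) *\<^sub>R \<theta>)"
  by (simp add: sliced_discrepancy_def gap_def transport_def)

lemma measurable_sliced_discrepancy [measurable]: "sliced_discrepancy (K t) \<nu> \<in> borel_measurable borel"
  unfolding sliced_discrepancy_eq[abs_def] by measurable

text \<open>Finiteness of a nonnegative integral is a measurable predicate, which is what
  \<open>AE_L\<close> needs to pass from the slab to its slices.\<close>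

lemma AE_gap_sq_finite: "AE z in L. (\<integral>\<^sup>+\<theta>. ennreal ((gap \<theta> z)\<^sup>2) \<partial>\<sigma>) < \<infinity>"
  using PL.AE_integrable_snd[OF integrable_gap_sq_pair_L]
  by eventually_elim (auto simp: integrable_iff_bounded)

text \<open>On a probability space square integrability gives integrability of \<open>gap\<close>,
  hence of the vector integrand, as directions have norm 1 almost surely. Only then may the inner
  product with \<open>u\<close> leave the integral.\<close>

lemma gap_sq_finiteD:
  assumes fin: "(\<integral>\<^sup>+\<theta>. ennreal ((gap \<theta> z)\<^sup>2) \<partial>\<sigma>) < \<infinity>"
  shows "integrable \<sigma> (\<lambda>\<theta>. (gap \<theta> z)\<^sup>2)"
    and "D z = sliced_discrepancy (K (fst z)) \<nu> (snd z) \<bullet> u z"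
proof -
  show sq: "integrable \<sigma> (\<lambda>\<theta>. (gap \<theta> z)\<^sup>2)"
    by (rule integrableI_bounded) (use fin in auto)
  have i: "integrable \<sigma> (\<lambda>\<theta>. gap \<theta> z)" by (rule \<sigma>.integrable_of_square[OF _ sq]) measurable
  have "integrable \<sigma> (\<lambda>\<theta>. gap \<theta> z *\<^sub>R \<theta>)"
  proof (rule Bochner_Integration.integrable_bound[OF i])
    show "AE \<theta> in \<sigma>. norm (gap \<theta> z *\<^sub>R \<theta>) \<le> norm (gap \<theta> z)"
      using AE_\<sigma> by eventually_elim simp
  qed measurable
  from integral_inner_left[OF this, of "u z"]
  show "D z = sliced_discrepancy (K (fst z)) \<nu> (snd z) \<bullet> u z"
    by (simp add: D_def sliced_discrepancy_eq)
qed

text \<open>The squared distance is an indefinite integral in time, so Lebesgue differentiation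
  applies with \<open>D\<close> as integrand. At almost every time, almost every point of the slice
  has a finite \<open>gap\<close> moment, and there \<open>D\<close> is the inner product with the
  discrepancy field.\<close>

lemma AE_deriv_SW2_sq:
  "AE t in lborel. t \<in> {0<..<T} \<longrightarrow>
     integrable (K t) (\<lambda>x. sliced_discrepancy (K t) \<nu> x \<bullet> u (t, x)) \<and>
     ((\<lambda>s. (r s)\<^sup>2) has_real_derivative 2 * (LINT x|K t. sliced_discrepancy (K t) \<nu> x \<bullet> u (t, x))) (at t)"
proof -
  define f where "f t = indicator {0<..<T} t * (LINT x|K t. 2 * D (t, x))" for t
  have i2: "integrable L (\<lambda>z. 2 * D z)" using integrable_D by simp
  have f: "integrable lborel f"
    using integral_L[OF i2] unfolding f_def[abs_def] by (simp only: has_bochner_integral_iff)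
  have inc: "(r t)\<^sup>2 - (r s)\<^sup>2 = (LINT \<tau>|lborel. indicator {s<..t} \<tau> * f \<tau>)"
    if st: "0 \<le> s" "s \<le> t" "t < T" for s t
  proof -
    have e: "indicator {0<..<T} \<tau> * (LINT x|K \<tau>. indicator {s<..t} (fst (\<tau>, x)) * (2 * D (\<tau>, x))) =
        indicator {s<..t} \<tau> * f \<tau>" for \<tau>
      by (simp add: f_def)
    show ?thesis
      using has_bochner_integral_integral_eq[OF integral_L[OF integrable_time_slab[OF i2, of s t]]]
        SW2_sq_increment[OF st] by (simp only: e)
  qed
  have der: "AE t in lborel. t \<in> {0<..<T} \<longrightarrow> ((\<lambda>s. (r s)\<^sup>2) has_real_derivative f t) (at t)"
    by (rule AE_deriv_indefinite_integral[OF f]) (rule inc)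
  have "AE t in lborel. t \<in> {0<..<T} \<longrightarrow> (AE x in K t. (\<integral>\<^sup>+\<theta>. ennreal ((gap \<theta> (t, x))\<^sup>2) \<partial>\<sigma>) < \<infinity>)"
    using AE_gap_sq_finite by (subst (asm) AE_L) measurable
  moreover note AE_integrable_L[OF integrable_D] der
  ultimately show ?thesis
  proof eventually_elim
    case (elim t)
    show ?case
    proof
      assume t: "t \<in> {0<..<T}"
      have ae: "AE x in K t. D (t, x) = sliced_discrepancy (K t) \<nu> x \<bullet> u (t, x)"
        using elim(1)[rule_format, OF t] by eventually_elim (use gap_sq_finiteD(2)[of "(t, _)"] in simp)
      have iD: "integrable (K t) (\<lambda>x. D (t, x))" using elim(2) t by simp
      have m: "(\<lambda>x. D (t, x)) \<in> borel_measurable (K t)"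
        "(\<lambda>x. sliced_discrepancy (K t) \<nu> x \<bullet> u (t, x)) \<in> borel_measurable (K t)" by measurable
      have "integrable (K t) (\<lambda>x. sliced_discrepancy (K t) \<nu> x \<bullet> u (t, x))"
        using integrable_cong_AE[OF m ae] iD by simp
      moreover have "f t = 2 * (LINT x|K t. sliced_discrepancy (K t) \<nu> x \<bullet> u (t, x))"
        using integral_cong_AE[OF m ae] t by (simp add: f_def)
      ultimately show "integrable (K t) (\<lambda>x. sliced_discrepancy (K t) \<nu> x \<bullet> u (t, x)) \<and>
        ((\<lambda>s. (r s)\<^sup>2) has_real_derivative 2 * (LINT x|K t. sliced_discrepancy (K t) \<nu> x \<bullet> u (t, x))) (at t)"
        using elim(3) t by simp
    qed
  qed
qed

section \<open>Absolute continuity of the distance\<close>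

definition slab_energy :: "real \<Rightarrow> real \<Rightarrow> real" where
  "slab_energy s t = (LINT z|L. indicator {s<..t} (fst z) * (norm (u z))\<^sup>2)"

lemma slab_energy_nonneg: "0 \<le> slab_energy s t"
  unfolding slab_energy_def by (rule Bochner_Integration.integral_nonneg) simp

lemma slab_energy_mono: "s' \<le> s \<Longrightarrow> t \<le> t' \<Longrightarrow> slab_energy s t \<le> slab_energy s' t'"
  unfolding slab_energy_def
  by (intro integral_mono integrable_time_slab energy) (auto simp: indicator_def)

text \<open>Young's inequality with weight \<open>l\<close>, direction by direction; the weight
  stays free in order to balance distance against energy.\<close>

lemma abs_D_le:
  assumes fin: "(\<integral>\<^sup>+\<theta>. ennreal ((gap \<theta> z)\<^sup>2) \<partial>\<sigma>) < \<infinity>" and l: "0 < l"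
  shows "\<bar>2 * D z\<bar> \<le> l * (LINT \<theta>|\<sigma>. (gap \<theta> z)\<^sup>2) + (norm (u z))\<^sup>2 / l"
proof -
  note sq = gap_sq_finiteD(1)[OF fin]
  have b: "AE \<theta> in \<sigma>. \<bar>2 * (gap \<theta> z * (\<theta> \<bullet> u z))\<bar> \<le> l * (gap \<theta> z)\<^sup>2 + (norm (u z))\<^sup>2 / l"
    using AE_\<sigma>
  proof eventually_elim
    case (elim \<theta>)
    have "\<bar>\<theta> \<bullet> u z\<bar> \<le> norm (u z)" using Cauchy_Schwarz_ineq2[of \<theta> "u z"] elim by simp
    then have "2 * (\<bar>gap \<theta> z\<bar> * \<bar>\<theta> \<bullet> u z\<bar>) \<le> 2 * (\<bar>gap \<theta> z\<bar> * norm (u z))"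
      by (intro mult_left_mono) auto
    also have "\<dots> \<le> l * (gap \<theta> z)\<^sup>2 + (norm (u z))\<^sup>2 / l"
    proof -
      have "0 \<le> (l * \<bar>gap \<theta> z\<bar> - norm (u z))\<^sup>2 / l" using l by simp
      also have "\<dots> = l * (gap \<theta> z)\<^sup>2 + (norm (u z))\<^sup>2 / l - 2 * (\<bar>gap \<theta> z\<bar> * norm (u z))"
        using l by (simp add: power2_eq_square field_simps)
      finally show ?thesis by simp
    qed
    finally show ?case by (simp add: abs_mult)
  qed
  have i: "integrable \<sigma> (\<lambda>\<theta>. l * (gap \<theta> z)\<^sup>2 + (norm (u z))\<^sup>2 / l)" using sq by simp
  have ig: "integrable \<sigma> (\<lambda>\<theta>. 2 * (gap \<theta> z * (\<theta> \<bullet> u z)))"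
    by (rule Bochner_Integration.integrable_bound[OF i])
      (measurable, use b in \<open>auto elim!: eventually_mono\<close>)
  have "\<bar>2 * D z\<bar> = \<bar>LINT \<theta>|\<sigma>. 2 * (gap \<theta> z * (\<theta> \<bullet> u z))\<bar>" by (simp add: D_def)
  also have "\<dots> \<le> (LINT \<theta>|\<sigma>. \<bar>2 * (gap \<theta> z * (\<theta> \<bullet> u z))\<bar>)" by (rule integral_abs_bound)
  also have "\<dots> \<le> (LINT \<theta>|\<sigma>. l * (gap \<theta> z)\<^sup>2 + (norm (u z))\<^sup>2 / l)"
    using ig by (intro integral_mono_AE i b) auto
  also have "\<dots> = l * (LINT \<theta>|\<sigma>. (gap \<theta> z)\<^sup>2) + (norm (u z))\<^sup>2 / l"
    using sq \<sigma>.prob_space by simp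
  finally show ?thesis .
qed

lemma SW2_sq_increment_le:
  assumes st: "0 \<le> s" "s \<le> t" "t < T" and M: "0 < M" "\<And>\<tau>. \<tau> \<in> {s..t} \<Longrightarrow> (r \<tau>)\<^sup>2 \<le> M\<^sup>2"
    and \<eta>: "0 < \<eta>"
  shows "\<bar>(r t)\<^sup>2 - (r s)\<^sup>2\<bar> \<le> M * ((t - s) / \<eta> + \<eta> * slab_energy s t)"
proof -
  \<comment> \<open>With this weight the distance term \<open>l M^2 (t - s)\<close> and the energy
    term divided by \<open>l\<close> both carry the common factor \<open>M\<close>.\<close>
  define l where "l = 1 / (\<eta> * M)"
  have l: "0 < l" using M \<eta> by (simp add: l_def)
  define Q where "Q z = (LINT \<theta>|\<sigma>. (gap \<theta> z)\<^sup>2)" for z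
  have iQ: "integrable L Q" using PL.integrable_snd[OF integrable_gap_sq_pair_L] by (simp add: Q_def[abs_def])
  note iQs = integrable_time_slab[OF iQ, of s t] and iEs = integrable_time_slab[OF energy, of s t]
  have "\<bar>(r t)\<^sup>2 - (r s)\<^sup>2\<bar> \<le> (LINT z|L. \<bar>indicator {s<..t} (fst z) * (2 * D z)\<bar>)"
    unfolding SW2_sq_increment[OF st] by (rule integral_abs_bound)
  also have "\<dots> \<le> (LINT z|L. l * (indicator {s<..t} (fst z) * Q z) + (1 / l) * (indicator {s<..t} (fst z) * (norm (u z))\<^sup>2))"
  proof (rule integral_mono_AE)
    show "integrable L (\<lambda>z. \<bar>indicator {s<..t} (fst z) * (2 * D z)\<bar>)"
      using integrable_D by (intro integrable_abs integrable_time_slab) simp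
    show "integrable L (\<lambda>z. l * (indicator {s<..t} (fst z) * Q z) + (1 / l) * (indicator {s<..t} (fst z) * (norm (u z))\<^sup>2))"
      using iQs iEs by (intro Bochner_Integration.integrable_add integrable_mult_right)
    show "AE z in L. \<bar>indicator {s<..t} (fst z) * (2 * D z)\<bar> \<le>
        l * (indicator {s<..t} (fst z) * Q z) + (1 / l) * (indicator {s<..t} (fst z) * (norm (u z))\<^sup>2)"
      using AE_gap_sq_finite
    proof eventually_elim
      case (elim z)
      from abs_D_le[OF this l] show ?case by (simp add: Q_def indicator_def)
    qed
  qed
  also have "\<dots> = l * (LINT z|L. indicator {s<..t} (fst z) * Q z) + (1 / l) * slab_energy s t"
    unfolding slab_energy_def
    by (subst Bochner_Integration.integral_add[OF integrable_mult_right[OF iQs] integrable_mult_right[OF iEs]])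
      simp
  \<comment> \<open>The slice integral of \<open>Q\<close> is the squared distance, at most
    \<open>M^2\<close> on the interval.\<close>
  also have "(LINT z|L. indicator {s<..t} (fst z) * Q z) \<le> M\<^sup>2 * (t - s)"
  proof -
    have "(LINT z|L. indicator {s<..t} (fst z) * Q z) =
        (LINT \<tau>|lborel. indicator {0<..<T} \<tau> * (indicator {s<..t} \<tau> * (r \<tau>)\<^sup>2))"
      using has_bochner_integral_integral_eq[OF integral_L[OF iQs]] by (simp add: SW2_sq(3) Q_def)
    also have "\<dots> \<le> (LINT \<tau>|lborel. M\<^sup>2 * indicator {s..t} \<tau>)"
    proof (rule integral_mono)
      show "integrable lborel (\<lambda>\<tau>. indicator {0<..<T} \<tau> * (indicator {s<..t} \<tau> * (r \<tau>)\<^sup>2))"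
        using integral_L[OF iQs] by (simp add: SW2_sq(3) Q_def has_bochner_integral_iff)
      show "integrable lborel (\<lambda>\<tau>. M\<^sup>2 * indicator {s..t} \<tau>)"
        using st by (intro integrable_mult_right integrable_real_indicator) auto
      show "indicator {0<..<T} \<tau> * (indicator {s<..t} \<tau> * (r \<tau>)\<^sup>2) \<le> M\<^sup>2 * indicator {s..t} \<tau>" for \<tau>
        using M(2)[of \<tau>] by (auto simp: indicator_def)
    qed
    also have "\<dots> = M\<^sup>2 * (t - s)" using st by simp
    finally show ?thesis .
  qed
  finally have "\<bar>(r t)\<^sup>2 - (r s)\<^sup>2\<bar> \<le> l * (M\<^sup>2 * (t - s)) + (1 / l) * slab_energy s t"
    using l by simp
  also have "\<dots> = M * ((t - s) / \<eta> + \<eta> * slab_energy s t)"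
    using M(1) \<eta> by (simp add: l_def power2_eq_square distrib_left)
  finally show ?thesis .
qed

lemma SW2_sq_bounded: obtains M where "0 < M" "\<And>t. 0 \<le> t \<Longrightarrow> t < T \<Longrightarrow> (r t)\<^sup>2 \<le> M\<^sup>2"
proof -
  define C where "C = 2 * (2 * (LINT x|K 0. (norm x)\<^sup>2) + 4 * (LINT z|L. (norm (u z))\<^sup>2) + (LINT y|\<nu>. (norm y)\<^sup>2))"
  have C: "0 \<le> C" unfolding C_def
    by (intro mult_nonneg_nonneg add_nonneg_nonneg Bochner_Integration.integral_nonneg) auto
  have "(r t)\<^sup>2 \<le> C" if t: "0 \<le> t" "t < T" for t
  proof -
    have "(r t)\<^sup>2 \<le> (LINT \<theta>|\<sigma>. C)"
      unfolding SW2_sq(2)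
    proof (rule integral_mono_AE[OF SW2_sq(1)])
      show "AE \<theta> in \<sigma>. (W2 (proj_measure \<theta> (K t)) (proj_measure \<theta> \<nu>))\<^sup>2 \<le> C"
        using AE_\<sigma>
      proof eventually_elim
        case (elim \<theta>)
        then have \<theta>: "\<theta> \<noteq> 0" by auto
        show ?case
          using transport_sq(3)[OF \<theta>, of t] gap_sq_K(2)[OF \<theta>, of t] second_moment_bound[OF t] elim
          by (simp add: C_def)
      qed
    qed simp
    then show ?thesis using \<sigma>.prob_space by simp
  qed
  moreover have "C \<le> (C + 1)\<^sup>2" using C by (simp add: power2_eq_square algebra_simps)
  ultimately show ?thesis using that[of "C + 1"] C by (meson add_nonneg_pos order_trans zero_less_one)
qed

text \<open>The increment bound with one global \<open>M\<close> makes the square continuous.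
  Continuity is wanted so that the distance attains its maximum in the next estimate.\<close>

lemma continuous_on_SW2: "continuous_on {0..<T} r"
proof -
  obtain M where M: "0 < M" "\<And>t. 0 \<le> t \<Longrightarrow> t < T \<Longrightarrow> (r t)\<^sup>2 \<le> M\<^sup>2"
    by (rule SW2_sq_bounded) blast
  define E where "E = slab_energy 0 T + 1"
  have E: "0 < E" using slab_energy_nonneg[of 0 T] by (simp add: E_def)
  have "continuous_on {0..<T} (\<lambda>t. (r t)\<^sup>2)"
    unfolding continuous_on_iff
  proof (intro ballI allI impI)
    fix x e assume x: "x \<in> {0..<T}" and e: "(0::real) < e"
    \<comment> \<open>Then \<open>M \<eta> E\<close> is half of \<open>e\<close>; the length of the
      interval accounts for the other half.\<close>
    define \<eta> where "\<eta> = e / (2 * M * E)"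
    have \<eta>: "0 < \<eta>" using e M E by (simp add: \<eta>_def)
    have step: "\<bar>(r t)\<^sup>2 - (r s)\<^sup>2\<bar> < e" if st: "0 \<le> s" "s \<le> t" "t < T" "t - s < \<eta> * e / (2 * M)" for s t
    proof -
      have "slab_energy s t < E" using slab_energy_mono[of 0 s t T] st by (simp add: E_def)
      then have "\<eta> * slab_energy s t < \<eta> * E" using \<eta> by simp
      moreover have "(t - s) / \<eta> < e / (2 * M)" using st(4) \<eta> by (simp add: divide_less_eq mult.commute)
      ultimately have "(t - s) / \<eta> + \<eta> * slab_energy s t < e / (2 * M) + \<eta> * E"
        by linarith
      then have "M * ((t - s) / \<eta> + \<eta> * slab_energy s t) < M * (e / (2 * M) + \<eta> * E)"
        using M(1) by (rule mult_strict_left_mono)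
      also have "\<dots> = e" using M E by (simp add: \<eta>_def field_simps)
      finally show ?thesis
        using SW2_sq_increment_le[OF st(1-3) M(1) _ \<eta>] M(2) st by fastforce
    qed
    show "\<exists>d>0. \<forall>x'\<in>{0..<T}. dist x' x < d \<longrightarrow> dist ((r x')\<^sup>2) ((r x)\<^sup>2) < e"
    proof (intro exI conjI ballI impI)
      show "0 < \<eta> * e / (2 * M)" using \<eta> e M by simp
      fix x' assume x': "x' \<in> {0..<T}" "dist x' x < \<eta> * e / (2 * M)"
      then show "dist ((r x')\<^sup>2) ((r x)\<^sup>2) < e"
        using step[of x x'] step[of x' x] x
        by (cases "x \<le> x'") (auto simp: dist_real_def abs_minus_commute)
    qed
  qed
  from continuous_on_real_sqrt[OF this] show ?thesis by (simp add: r_nonneg)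
qed

text \<open>Comparing with the maximum \<open>M\<close> of \<open>r\<close> on the interval removes the factor \<open>r\<close> from the bound on
  the increments of \<open>r\<^sup>2\<close>, which is what allows \<open>r\<close> to vanish.\<close>

lemma SW2_increment_le:
  assumes st: "0 \<le> s" "s \<le> t" "t < T" and \<eta>: "0 < \<eta>"
  shows "\<bar>r t - r s\<bar> \<le> (t - s) / \<eta> + \<eta> * slab_energy s t"
proof -
  have "continuous_on {s..t} r" by (rule continuous_on_subset[OF continuous_on_SW2]) (use st in auto)
  then obtain m where m: "m \<in> {s..t}" "\<And>\<tau>. \<tau> \<in> {s..t} \<Longrightarrow> r \<tau> \<le> r m"
    using continuous_attains_sup[OF compact_Icc, of s t r] st by auto
  \<comment> \<open>Both end values lie between 0 and \<open>r m\<close>, so their difference is at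
    most the larger of the two rises to the maximum.\<close>
  have core: "r m - r a \<le> (t - s) / \<eta> + \<eta> * slab_energy s t" if a: "a \<in> {s, t}" for a
  proof (cases "r m = r a")
    case True
    then show ?thesis using st \<eta> slab_energy_nonneg[of s t] by simp
  next
    case False
    have ra: "r a \<le> r m" using m(2)[of a] a st by auto
    with False have M: "0 < r m" using r_nonneg[of a] by linarith
    have sq: "(r \<tau>)\<^sup>2 \<le> (r m)\<^sup>2" if "\<tau> \<in> {s..t}" for \<tau>
      using m(2)[OF that] r_nonneg by (intro power_mono)
    define p q where "p = min a m" and "q = max a m"
    have pq: "0 \<le> p" "p \<le> q" "q < T" "s \<le> p" "q \<le> t" using a m(1) st by (auto simp: p_def q_def)
    have "(r m)\<^sup>2 - (r a)\<^sup>2 \<le> \<bar>(r q)\<^sup>2 - (r p)\<^sup>2\<bar>"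
      by (auto simp: p_def q_def min_def max_def)
    also have "\<dots> \<le> r m * ((q - p) / \<eta> + \<eta> * slab_energy p q)"
      by (rule SW2_sq_increment_le[OF pq(1-3) M _ \<eta>]) (use sq pq in auto)
    also have "\<dots> \<le> r m * ((t - s) / \<eta> + \<eta> * slab_energy s t)"
      using M \<eta> pq by (intro mult_left_mono add_mono divide_right_mono slab_energy_mono) auto
    finally have "(r m)\<^sup>2 - (r a)\<^sup>2 \<le> r m * ((t - s) / \<eta> + \<eta> * slab_energy s t)" .
    \<comment> \<open>This uses \<open>r a \<le> r m\<close>; afterwards the positive factor
      \<open>r m\<close> cancels.\<close>
    moreover have "r m * (r m - r a) \<le> (r m)\<^sup>2 - (r a)\<^sup>2"
    proof -
      have "0 \<le> r a * (r m - r a)" using ra r_nonneg by simp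
      then show ?thesis by (simp add: power2_eq_square algebra_simps)
    qed
    ultimately have "r m * (r m - r a) \<le> r m * ((t - s) / \<eta> + \<eta> * slab_energy s t)" by linarith
    then show ?thesis using M by simp
  qed
  show ?thesis using core[of s] core[of t] m(2)[of s] m(2)[of t] st by (auto simp: abs_le_iff)
qed

text \<open>The bound on one increment is additive in length and energy, and disjoint intervals
  carry at most the total energy. So \<open>\<eta>\<close> is fixed first, to make the energy part
  smaller than \<open>e / 2\<close>, and the total length is then kept below
  \<open>\<eta> * e / 2\<close>.\<close>

lemma abs_continuous_on_SW2:
  assumes ab: "0 \<le> a" "b < T"
  shows "abs_continuous_on {a..b} r"
  unfolding abs_continuous_on_def
proof (intro allI impI)
  fix e :: real assume e: "0 < e"
  define E where "E = (LINT z|L. (norm (u z))\<^sup>2) + 1"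
  have E: "0 < E" unfolding E_def by (intro add_nonneg_pos Bochner_Integration.integral_nonneg) auto
  define \<eta> where "\<eta> = e / (2 * E)"
  have \<eta>: "0 < \<eta>" using e E by (simp add: \<eta>_def)
  have "(\<Sum>(c, d)\<in>S. \<bar>r d - r c\<bar>) < e"
    if S: "finite S" "\<forall>(c, d)\<in>S. c \<le> d \<and> {c..d} \<subseteq> {a..b}"
      "pairwise (\<lambda>(a, b) (c, d). {a<..<b} \<inter> {c<..<d} = {}) S" "(\<Sum>(c, d)\<in>S. d - c) < \<eta> * e / 2" for S
  proof -
    have S2: "0 \<le> fst p" "fst p \<le> snd p" "snd p < T" if "p \<in> S" for p
      using S(2) that ab by (fastforce split: prod.splits)+
    \<comment> \<open>Disjointness is given for the open intervals. If two half-open ones shared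
      \<open>\<tau>\<close>, a point slightly to its left would lie in both open ones.\<close>
    have one: "(\<Sum>p\<in>S. indicator {fst p<..snd p} \<tau>) \<le> (1::real)" for \<tau>
    proof (cases "\<exists>p\<in>S. \<tau> \<in> {fst p<..snd p}")
      case True
      then obtain p where p: "p \<in> S" "\<tau> \<in> {fst p<..snd p}" by blast
      have "indicator {fst q<..snd q} \<tau> = (0::real)" if q: "q \<in> S" "q \<noteq> p" for q
      proof (rule ccontr)
        assume "indicator {fst q<..snd q} \<tau> \<noteq> (0::real)"
        then have q\<tau>: "\<tau> \<in> {fst q<..snd q}" by (auto simp: indicator_def split: if_splits)
        have "{fst q<..<snd q} \<inter> {fst p<..<snd p} = {}"
          using pairwiseD[OF S(3) q(1) p(1) q(2)] by (simp add: case_prod_beta)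
        moreover obtain y where "max (fst p) (fst q) < y" "y < \<tau>"
          using dense[of "max (fst p) (fst q)" \<tau>] p(2) q\<tau> by auto
        then have "y \<in> {fst q<..<snd q} \<inter> {fst p<..<snd p}" using p(2) q\<tau> by auto
        ultimately show False by blast
      qed
      then have "(\<Sum>q\<in>S. indicator {fst q<..snd q} \<tau>) = (\<Sum>q\<in>S. if q = p then (1::real) else 0)"
        using p(2) by (intro sum.cong) auto
      then show ?thesis using S(1) p(1) by simp
    next
      case False
      then have "(\<Sum>p\<in>S. indicator {fst p<..snd p} \<tau>) = (0::real)"
        by (intro sum.neutral) (auto simp: indicator_def)
      then show ?thesis by simp
    qed
    have "(\<Sum>p\<in>S. slab_energy (fst p) (snd p)) =
        (LINT z|L. (\<Sum>p\<in>S. indicator {fst p<..snd p} (fst z) * (norm (u z))\<^sup>2))"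
      unfolding slab_energy_def
      by (rule Bochner_Integration.integral_sum[symmetric]) (intro integrable_time_slab energy)
    also have "\<dots> \<le> (LINT z|L. (norm (u z))\<^sup>2)"
    proof (rule integral_mono)
      show "integrable L (\<lambda>z. \<Sum>p\<in>S. indicator {fst p<..snd p} (fst z) * (norm (u z))\<^sup>2)"
        by (intro Bochner_Integration.integrable_sum integrable_time_slab energy)
      show "(\<Sum>p\<in>S. indicator {fst p<..snd p} (fst z) * (norm (u z))\<^sup>2) \<le> (norm (u z))\<^sup>2" for z
        using mult_right_mono[OF one, of "(norm (u z))\<^sup>2" "fst z"] by (simp add: sum_distrib_right)
    qed (rule energy)
    also have "\<dots> < E" by (simp add: E_def)
    finally have En: "(\<Sum>p\<in>S. slab_energy (fst p) (snd p)) < E" .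
    have "(\<Sum>p\<in>S. \<bar>r (snd p) - r (fst p)\<bar>) \<le> (\<Sum>p\<in>S. (snd p - fst p) / \<eta> + \<eta> * slab_energy (fst p) (snd p))"
      by (intro sum_mono SW2_increment_le S2 \<eta>)
    also have "\<dots> = (\<Sum>p\<in>S. snd p - fst p) / \<eta> + \<eta> * (\<Sum>p\<in>S. slab_energy (fst p) (snd p))"
      by (simp add: sum.distrib sum_distrib_left sum_divide_distrib)
    also have "\<dots> < (e / 2) + \<eta> * E"
    proof (rule add_strict_mono)
      show "(\<Sum>p\<in>S. snd p - fst p) / \<eta> < e / 2"
        using S(4) \<eta> by (simp add: divide_less_eq case_prod_beta mult.commute)
      show "\<eta> * (\<Sum>p\<in>S. slab_energy (fst p) (snd p)) < \<eta> * E" using En \<eta> by simp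
    qed
    also have "\<dots> = e" using E by (simp add: \<eta>_def)
    finally show ?thesis by (simp add: case_prod_beta)
  qed
  moreover have "0 < \<eta> * e / 2" using \<eta> e by simp
  ultimately show "\<exists>\<delta>>0. \<forall>D. finite D \<and> (\<forall>(c, d)\<in>D. c \<le> d \<and> {c..d} \<subseteq> {a..b}) \<and>
      pairwise (\<lambda>(a, b) (c, d). {a<..<b} \<inter> {c<..<d} = {}) D \<and> (\<Sum>(c, d)\<in>D. d - c) < \<delta> \<longrightarrow>
      (\<Sum>(c, d)\<in>D. \<bar>r d - r c\<bar>) < e"
    by blast
qed

end

section \<open>Narrowly continuous curves of densities\<close>

text \<open>Open sets generate the Borel sets, and the measure of an open set is a limit of
  integrals of bounded continuous functions built from the distance to its complement; these
  integrals are continuous on [0,1). The constant extension makes the kernel total.\<close>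

lemma narrow_kernel:
  fixes \<rho> :: "real \<Rightarrow> 'a::euclidean_space measure"
  assumes \<rho>: "\<And>t. t \<in> {0..<1} \<Longrightarrow> prob_space (\<rho> t)" "\<And>t. t \<in> {0..<1} \<Longrightarrow> sets (\<rho> t) = sets borel"
    and narrow: "narrowly_continuous_on {0..<1} \<rho>"
  shows "(\<lambda>t. if t \<in> {0..<1} then \<rho> t else \<rho> 0) \<in> borel \<rightarrow>\<^sub>M prob_algebra borel"
    (is "?K \<in> _")
proof (rule measurable_prob_algebra_generated[OF sets_borel])
  have K: "prob_space (?K t)" "sets (?K t) = sets borel" for t using \<rho> by auto
  show "Int_stable {S :: 'a set. open S}" by (auto intro!: Int_stableI)
  show "prob_space (?K t)" "sets (?K t) = sets borel" for t by (rule K)+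
  fix U :: "'a set" assume "U \<in> {S. open S}"
  then have U: "open U" by simp
  have em: "emeasure (?K t) U = ennreal (measure (?K t) U)" for t
    using finite_measure.emeasure_eq_measure[OF prob_space.finite_measure[OF K(1)]] by blast
  have "(\<lambda>t. measure (?K t) U) \<in> borel_measurable borel"
  \<comment> \<open>The distance to the empty set is 0 by convention, so the whole space is treated
    apart.\<close>
  proof (cases "U = UNIV")
    case True
    have "measure (?K t) U = 1" for t
      using prob_space.prob_space[OF K(1)[of t]] sets_eq_imp_space_eq[OF K(2)[of t]] True by simp
    then show ?thesis by simp
  next
    case False
    define f where "f n x = min 1 (real n * infdist x (- U))" for n x
    have cf: "continuous_on UNIV (f n)" for n
      unfolding f_def by (intro continuous_intros)
    have f01: "0 \<le> f n x" "f n x \<le> 1" for n x by (auto simp: f_def infdist_nonneg)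
    have [measurable]: "f n \<in> borel_measurable borel" for n by (rule borel_measurable_continuous_onI[OF cf])
    have lim: "(\<lambda>n. f n x) \<longlonglongrightarrow> indicator U x" for x
    proof (cases "x \<in> U")
      case True
      then have "0 < infdist x (- U)" using U False by (intro infdist_pos_not_in_closed) auto
      then obtain N where N: "1 < real N * infdist x (- U)" using reals_Archimedean3 by blast
      have "f n x = 1" if "N \<le> n" for n
      proof -
        have "real N * infdist x (- U) \<le> real n * infdist x (- U)"
          using that by (intro mult_right_mono infdist_nonneg) simp
        then show ?thesis using N by (simp add: f_def)
      qed
      then have "eventually (\<lambda>n. f n x = 1) sequentially" by (auto simp: eventually_sequentially)
      then show ?thesis using True by (simp add: tendsto_eventually)
    next
      case False
      then have "f n x = 0" for n by (simp add: f_def)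
      then show ?thesis using False by simp
    qed
    show ?thesis
    proof (rule borel_measurable_LIMSEQ_real)
      fix t
      define M where "M = ?K t"
      interpret prob_space M unfolding M_def by (rule K(1))
      have sets_M [measurable_cong]: "sets M = sets borel" unfolding M_def by (rule K(2))
      have "(indicator U :: 'a \<Rightarrow> real) \<in> borel_measurable M"
        using U sets_M by (intro borel_measurable_indicator) simp
      then have "(\<lambda>n. LINT x|M. f n x) \<longlonglongrightarrow> (LINT x|M. indicator U x)"
        by (rule integral_dominated_convergence[where w="\<lambda>_. 1"]) (use lim f01 in auto)
      then show "(\<lambda>n. LINT x|?K t. f n x) \<longlonglongrightarrow> measure (?K t) U"
        unfolding M_def[symmetric] using U sets_M sets_eq_imp_space_eq[OF sets_M] by simp
    next
      fix n
      have "bounded (range (f n))" using f01 by (auto simp: bounded_iff intro!: exI[of _ 1])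
      then have "continuous_on {0..<1} (\<lambda>t. LINT x|\<rho> t. f n x)"
        using narrow cf by (simp add: narrowly_continuous_on_def)
      then have [measurable]: "(\<lambda>t. indicator {0..<1} t *\<^sub>R (LINT x|\<rho> t. f n x)) \<in> borel_measurable borel"
        by (rule borel_measurable_continuous_on_indicator[rotated]) simp
      have "(\<lambda>t. LINT x|?K t. f n x) = (\<lambda>t. indicator {0..<1} t *\<^sub>R (LINT x|\<rho> t. f n x) +
          (1 - indicator {0..<1} t) * (LINT x|\<rho> 0. f n x))"
        by (auto simp: indicator_def)
      also have "\<dots> \<in> borel_measurable borel" by measurable
      finally show "(\<lambda>t. LINT x|?K t. f n x) \<in> borel_measurable borel" .
    qed
  qed
  then show "(\<lambda>t. emeasure (?K t) U) \<in> borel_measurable borel" unfolding em by measurable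
qed simp_all

lemma abs_continuous_on_eq:
  assumes ac: "abs_continuous_on I f" and eq: "\<And>x. x \<in> I \<Longrightarrow> f x = g x"
  shows "abs_continuous_on I g"
  unfolding abs_continuous_on_def
proof (intro allI impI)
  fix e :: real assume "0 < e"
  then obtain d where d: "0 < d" "\<And>D. finite D \<and> (\<forall>(a,b)\<in>D. a \<le> b \<and> {a..b} \<subseteq> I) \<and>
      pairwise (\<lambda>(a,b) (c,d). {a<..<b} \<inter> {c<..<d} = {}) D \<and> (\<Sum>(a,b)\<in>D. b - a) < d \<Longrightarrow>
      (\<Sum>(a,b)\<in>D. \<bar>f b - f a\<bar>) < e"
    using ac unfolding abs_continuous_on_def by blast
  have sum_eq: "(\<Sum>(a,b)\<in>D. \<bar>g b - g a\<bar>) = (\<Sum>(a,b)\<in>D. \<bar>f b - f a\<bar>)"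
    if D: "\<forall>(a,b)\<in>D. a \<le> b \<and> {a..b} \<subseteq> I" for D
  proof (intro sum.cong refl, clarify)
    fix a b assume "(a, b) \<in> D"
    then have "a \<le> b" "{a..b} \<subseteq> I" using D by auto
    then have "a \<in> I" "b \<in> I" by auto
    then show "\<bar>g b - g a\<bar> = \<bar>f b - f a\<bar>" using eq by simp
  qed
  show "\<exists>d>0. \<forall>D. finite D \<and> (\<forall>(a,b)\<in>D. a \<le> b \<and> {a..b} \<subseteq> I) \<and>
      pairwise (\<lambda>(a,b) (c,d). {a<..<b} \<inter> {c<..<d} = {}) D \<and> (\<Sum>(a,b)\<in>D. b - a) < d \<longrightarrow>
      (\<Sum>(a,b)\<in>D. \<bar>g b - g a\<bar>) < e"
  proof (intro exI[of _ d] conjI allI impI)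
    fix D assume D: "finite D \<and> (\<forall>(a,b)\<in>D. a \<le> b \<and> {a..b} \<subseteq> I) \<and>
      pairwise (\<lambda>(a,b) (c,d). {a<..<b} \<inter> {c<..<d} = {}) D \<and> (\<Sum>(a,b)\<in>D. b - a) < d"
    then have "(\<Sum>(a,b)\<in>D. \<bar>g b - g a\<bar>) = (\<Sum>(a,b)\<in>D. \<bar>f b - f a\<bar>)" by (intro sum_eq) simp
    also have "\<dots> < e" by (rule d(2)[OF D])
    finally show "(\<Sum>(a,b)\<in>D. \<bar>g b - g a\<bar>) < e" .
  qed (rule d(1))
qed

lemma gradient_eq:
  assumes "(f has_derivative (\<lambda>h. G \<bullet> h)) (at x)"
  shows "gradient f x = G"
  unfolding gradient_def frechet_derivative_at[OF assms, symmetric] by (rule euclidean_representation)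



text \<open>The product of the two factors is smooth and supported in \<open>{c..d}\<close> times a
  ball, hence an admissible test function, and its derivatives factorise.\<close>

lemma weak_continuity_equation_product:
  fixes p :: "real \<Rightarrow> 'a::euclidean_space \<Rightarrow> real"
  assumes ce: "weak_continuity_equation p v"
    and \<alpha>: "smooth \<alpha>" "\<And>t. (\<alpha> has_real_derivative \<alpha>' t) (at t)" "0 < c" "d < 1" "\<And>t. \<alpha> t \<noteq> 0 \<Longrightarrow> t \<in> {c..d}"
    and \<phi>: "smooth \<phi>" "\<And>x. (\<phi> has_derivative (\<lambda>h. G x \<bullet> h)) (at x)" "\<And>x. \<phi> x \<noteq> 0 \<Longrightarrow> norm x \<le> R"
  shows "(LINT t:{0<..<1}|lborel. (LINT x|lborel. (\<alpha>' t * \<phi> x + \<alpha> t * (G x \<bullet> v t x)) * p t x)) = 0"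
proof -
  define \<zeta> where "\<zeta> z = \<alpha> (fst z) * \<phi> (snd z)" for z
  have sm: "smooth \<zeta>" unfolding \<zeta>_def[abs_def]
    by (intro smooth_mult smooth_compose_linear[OF \<alpha>(1) bounded_linear_fst]
        smooth_compose_linear[OF \<phi>(1) bounded_linear_snd])
  have sub: "closure {z. \<zeta> z \<noteq> 0} \<subseteq> {c..d} \<times> cball 0 R"
  proof (rule closure_minimal)
    show "{z. \<zeta> z \<noteq> 0} \<subseteq> {c..d} \<times> cball 0 R" using \<alpha>(5) \<phi>(3) by (force simp: \<zeta>_def)
    show "closed ({c..d} \<times> cball 0 R :: (real \<times> 'a) set)" by (intro closed_Times) auto
  qed
  have cpt: "compact (closure {z. \<zeta> z \<noteq> 0})"
  proof (rule compact_closure[THEN iffD2], rule bounded_subset)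
    show "bounded ({c..d} \<times> cball 0 R :: (real \<times> 'a) set)" by (intro bounded_Times) auto
    show "{z. \<zeta> z \<noteq> 0} \<subseteq> {c..d} \<times> cball 0 R" by (rule order_trans[OF closure_subset sub])
  qed
  have "{c..d} \<times> cball 0 R \<subseteq> {0<..<1} \<times> (UNIV :: 'a set)" using \<alpha>(3,4) by auto
  with sub have "closure {z. \<zeta> z \<noteq> 0} \<subseteq> {0<..<1} \<times> UNIV" by (rule order_trans)
  with sm cpt have "\<zeta> \<in> test_functions ({0<..<1} \<times> UNIV)"
    unfolding test_functions_def mem_Collect_eq smooth_def by (intro conjI)
  then have "(LINT t:{0<..<1}|lborel. (LINT x|lborel.
      (deriv (\<lambda>s. \<zeta> (s, x)) t + gradient (\<lambda>y. \<zeta> (t, y)) x \<bullet> v t x) * p t x)) = 0"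
    using ce by (simp only: weak_continuity_equation_def)
  moreover have "deriv (\<lambda>s. \<zeta> (s, x)) t = \<alpha>' t * \<phi> x" for t x
    unfolding \<zeta>_def fst_conv snd_conv by (rule DERIV_imp_deriv) (rule DERIV_cmult_right[OF \<alpha>(2)])
  moreover have "gradient (\<lambda>y. \<zeta> (t, y)) x = \<alpha> t *\<^sub>R G x" for t x
    unfolding \<zeta>_def fst_conv snd_conv
    by (rule gradient_eq) (rule has_derivative_eq_rhs[OF has_derivative_mult_right[OF \<phi>(2)]], simp)
  ultimately show ?thesis by simp
qed

text \<open>Finiteness of the energy is known only up to times before 1, so the argument runs on a
  slab (0,T) for each T < 1 and the results are glued. Integrability of the flux belongs to the
  claim because the integral of a function that is not integrable is 0 by default.\<close>

theorem proposition1: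
  fixes \<rho> :: "real \<Rightarrow> (real^'n) measure"
    and p :: "real \<Rightarrow> real^'n \<Rightarrow> real"
    and v :: "real \<Rightarrow> real^'n \<Rightarrow> real^'n"
    and \<rho>\<^sub>1 :: "(real^'n) measure"
  assumes target: "\<rho>\<^sub>1 \<in> P2"
    and curve: "\<And>t. t \<in> {0..<1} \<Longrightarrow> \<rho> t \<in> P2"
    and narrow: "narrowly_continuous_on {0..<1} \<rho>"
    and density_measurable: "\<And>t. t \<in> {0..<1} \<Longrightarrow> p t \<in> borel_measurable borel"
    and density_nonneg: "\<And>t x. t \<in> {0..<1} \<Longrightarrow> 0 \<le> p t x"
    and density: "\<And>t. t \<in> {0..<1} \<Longrightarrow> \<rho> t = density lborel (\<lambda>x. ennreal (p t x))"
    and velocity_measurable: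
      "(\<lambda>(t, x). v t x) \<in> borel_measurable (restrict_space borel ({0<..<1} \<times> UNIV))"
    and continuity_equation: "weak_continuity_equation p v"
    and finite_energy: "\<And>tbar. tbar \<in> {0<..<1} \<Longrightarrow>
      (\<integral>\<^sup>+t\<in>{0<..<tbar}. (\<integral>\<^sup>+x. ennreal ((norm (v t x))\<^sup>2) \<partial>\<rho> t) \<partial>lborel) < \<infinity>"
  shows "locally_abs_continuous_on {0..<1} (\<lambda>t. SW2 (\<rho> t) \<rho>\<^sub>1) \<and>
    (AE t in lborel. t \<in> {0<..<1} \<longrightarrow>
      integrable (\<rho> t) (\<lambda>x. sliced_discrepancy (\<rho> t) \<rho>\<^sub>1 x \<bullet> v t x) \<and>
      ((\<lambda>s. (SW2 (\<rho> s) \<rho>\<^sub>1)\<^sup>2) has_real_derivative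
        2 * (LINT x|\<rho> t. sliced_discrepancy (\<rho> t) \<rho>\<^sub>1 x \<bullet> v t x)) (at t))"
proof -
  define K where "K t = (if t \<in> {0..<1} then \<rho> t else \<rho> 0)" for t
  \<comment> \<open>The velocity is extended by 0 in time, so as to be Borel on the whole
    product.\<close>
  define u where "u z = indicator ({0<..<1} \<times> UNIV) z *\<^sub>R v (fst z) (snd z)" for z
  have K\<rho>: "K t = \<rho> t" if "t \<in> {0..<1}" for t using that by (simp add: K_def)
  have uv: "u (t, x) = v t x" if "t \<in> {0<..<1}" for t x using that by (simp add: u_def)
  have kernel: "K \<in> borel \<rightarrow>\<^sub>M prob_algebra borel"
    unfolding K_def[abs_def] by (rule narrow_kernel[OF _ _ narrow]) (use curve in \<open>auto simp: P2_def\<close>)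
  interpret borel_kernel K by unfold_locales (rule kernel)
  have u [measurable]: "u \<in> borel_measurable (borel \<Otimes>\<^sub>M borel)"
  proof -
    have "open ({0<..<1::real} \<times> (UNIV :: (real^'n) set))" by (intro open_Times) auto
    then have "{0<..<1::real} \<times> (UNIV :: (real^'n) set) \<in> sets borel" by simp
    then show ?thesis
      using velocity_measurable unfolding borel_prod u_def[abs_def]
      by (subst (asm) borel_measurable_restrict_space_iff) (simp_all add: case_prod_unfold)
  qed
  have sliced: "sliced_curve K u T \<rho>\<^sub>1" if T: "0 < T" "T < 1" for T
  proof unfold_locales
    show "0 < T" "T < 1" "\<rho>\<^sub>1 \<in> P2" by fact+
    show "K t \<in> P2" for t using curve by (simp add: K_def)
    show "A \<in> null_sets (K t)" if "A \<in> null_sets lborel" for t A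
    proof -
      have "A \<in> null_sets (density lborel (\<lambda>x. ennreal (p s x)))" if s: "s \<in> {0..<1}" for s
        using \<open>A \<in> null_sets lborel\<close> density_measurable[OF s] AE_not_in[OF \<open>A \<in> null_sets lborel\<close>]
        by (subst null_sets_density_iff) (auto elim!: eventually_mono)
      then show ?thesis using density by (simp add: K_def)
    qed
    show "narrowly_continuous_on {0..<1} K"
    proof -
      have "continuous_on {0..<1} (\<lambda>t. LINT x|K t. f x) \<longleftrightarrow> continuous_on {0..<1} (\<lambda>t. LINT x|\<rho> t. f x)"
        for f :: "real^'n \<Rightarrow> real" by (rule continuous_on_cong) (auto simp: K\<rho>)
      then show ?thesis using narrow by (simp only: narrowly_continuous_on_def)
    qed
    show "u \<in> borel_measurable (borel \<Otimes>\<^sub>M borel)" by (rule u)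
    show "integrable (spacetime T K) (\<lambda>z. (norm (u z))\<^sup>2)"
    proof (rule integrableI_bounded)
      have "(\<integral>\<^sup>+z. ennreal (norm ((norm (u z))\<^sup>2)) \<partial>spacetime T K) =
          (\<integral>\<^sup>+t. indicator {0<..<T} t * (\<integral>\<^sup>+x. ennreal ((norm (u (t, x)))\<^sup>2) \<partial>K t) \<partial>lborel)"
        by (subst nn_integral_spacetime) simp_all
      also have "\<dots> = (\<integral>\<^sup>+t\<in>{0<..<T}. (\<integral>\<^sup>+x. ennreal ((norm (v t x))\<^sup>2) \<partial>\<rho> t) \<partial>lborel)"
        using T by (intro nn_integral_cong) (auto simp: indicator_def K\<rho> uv)
      also have "\<dots> < \<infinity>" using finite_energy T by simp
      finally show "(\<integral>\<^sup>+z. ennreal (norm ((norm (u z))\<^sup>2)) \<partial>spacetime T K) < \<infinity>" .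
    qed measurable
    fix \<alpha> \<alpha>' \<phi> G and c d R :: real
    assume \<alpha>: "smooth \<alpha>" "\<And>t. (\<alpha> has_real_derivative \<alpha>' t) (at t)" "0 < c" "d < T" "\<And>t. \<alpha> t \<noteq> 0 \<Longrightarrow> t \<in> {c..d}"
      and \<phi>: "smooth \<phi>" "\<And>x. (\<phi> has_derivative (\<lambda>h. G x \<bullet> h)) (at x)" "\<And>x :: real^'n. \<phi> x \<noteq> 0 \<Longrightarrow> norm x \<le> R"
    define f where "f z = \<alpha>' (fst z) * \<phi> (snd z) + \<alpha> (fst z) * (G (snd z) \<bullet> u z)" for z
    show "(LINT z|spacetime T K. \<alpha>' (fst z) * \<phi> (snd z) + \<alpha> (fst z) * (G (snd z) \<bullet> u z)) = 0"
      unfolding f_def[symmetric]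
    \<comment> \<open>Outside the integrable case the integral is 0 by default, so integrability of
      the test expression need not be established here.\<close>
    proof (cases "integrable (spacetime T K) f")
      case False
      then show "integral\<^sup>L (spacetime T K) f = 0" by (rule not_integrable_integral_eq)
    next
      case True
      have [measurable]: "\<phi> \<in> borel_measurable borel"
        by (rule borel_measurable_continuous_onI[OF smooth_imp_continuous[OF \<phi>(1)]])
      have [measurable]: "G \<in> borel_measurable borel"
      proof -
        obtain G' where G': "\<And>x. (\<phi> has_derivative (\<lambda>h. G' x \<bullet> h)) (at x)" "continuous_on UNIV G'"
          using smooth_gradientE[OF \<phi>(1)] by blast
        have "G = G'" using gradient_eq[OF \<phi>(2)] gradient_eq[OF G'(1)] by fastforce
        then show ?thesis using G'(2) by (simp add: borel_measurable_continuous_onI)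
      qed
      \<comment> \<open>The time factor dies out before \<open>T\<close>, so integrating over the
        slab or over (0,1) gives the same value.\<close>
      have zero: "\<alpha> t = 0 \<and> \<alpha>' t = 0" if t: "T \<le> t" for t
      proof -
        have "t \<in> {d<..}" using t \<alpha>(4) by simp
        moreover have "\<alpha> s = 0" if "s \<in> {d<..}" for s using that \<alpha>(5)[of s] by fastforce
        ultimately have "((\<lambda>s. 0) has_real_derivative \<alpha>' t) (at t)"
          using has_field_derivative_transform_within_open[OF \<alpha>(2), of "{d<..}" t "\<lambda>s. 0"] by auto
        then have "\<alpha>' t = 0" by (rule DERIV_unique) simp
        then show ?thesis using \<open>t \<in> {d<..}\<close> \<alpha>(5)[of t] by fastforce
      qed
      have inner: "(LINT x|lborel. (\<alpha>' t * \<phi> x + \<alpha> t * (G x \<bullet> v t x)) * p t x) = (LINT x|K t. f (t, x))"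
        if t: "t \<in> {0<..<1}" for t
      proof -
        have t': "t \<in> {0..<1}" using t by auto
        have e: "\<alpha>' t * \<phi> x + \<alpha> t * (G x \<bullet> v t x) = f (t, x)" for x
          by (simp add: f_def uv[OF t])
        have "(\<lambda>x. f (t, x)) \<in> borel_measurable lborel" unfolding f_def fst_conv snd_conv by measurable
        then have "(LINT x|K t. f (t, x)) = (LINT x|lborel. p t x *\<^sub>R f (t, x))"
          unfolding K\<rho>[OF t'] density[OF t']
          by (rule integral_density) (use density_measurable[OF t'] density_nonneg[OF t'] in auto)
        then show ?thesis unfolding e by (simp add: mult.commute)
      qed
      have "integral\<^sup>L (spacetime T K) f = (LINT t|lborel. indicator {0<..<T} t * (LINT x|K t. f (t, x)))"
        by (rule has_bochner_integral_integral_eq[OF has_bochner_integral_spacetime[OF True], symmetric])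
      also have "\<dots> = (LINT t:{0<..<1}|lborel. (LINT x|lborel. (\<alpha>' t * \<phi> x + \<alpha> t * (G x \<bullet> v t x)) * p t x))"
        unfolding set_lebesgue_integral_def
      proof (intro Bochner_Integration.integral_cong refl)
        fix t
        show "indicator {0<..<T} t * (LINT x|K t. f (t, x)) =
          indicator {0<..<1} t *\<^sub>R (LINT x|lborel. (\<alpha>' t * \<phi> x + \<alpha> t * (G x \<bullet> v t x)) * p t x)"
        proof (cases "t \<in> {0<..<1}")
          case True
          then show ?thesis using zero[of t] inner[OF True] by (auto simp: indicator_def f_def)
        next
          case False
          then show ?thesis using T by (auto simp: indicator_def)
        qed
      qed
      also have "\<dots> = 0"
        by (rule weak_continuity_equation_product[OF continuity_equation \<alpha>(1,2,3) _ \<alpha>(5) \<phi>]) (use \<alpha>(4) T in auto)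
      finally show "integral\<^sup>L (spacetime T K) f = 0" .
    qed
  qed
  show ?thesis
  proof
    show "locally_abs_continuous_on {0..<1} (\<lambda>t. SW2 (\<rho> t) \<rho>\<^sub>1)"
      unfolding locally_abs_continuous_on_def
    proof (intro allI impI)
      fix a b :: real assume ab: "{a..b} \<subseteq> {0..<1}"
      \<comment> \<open>When \<open>{a..b}\<close> is empty its end points are uncontrolled; it is
        rewritten as the empty \<open>{1/2..0}\<close>, whose end points admit a slab.\<close>
      define a' b' where "a' = (if a \<le> b then a else 1/2)" and "b' = (if a \<le> b then b else 0)"
      have eq: "{a..b} = {a'..b'}" by (auto simp: a'_def b'_def)
      have ab': "0 \<le> a'" "0 \<le> b'" "b' < 1" using ab by (auto simp: a'_def b'_def)
      interpret sliced_curve K u "(1 + b') / 2" \<rho>\<^sub>1 by (rule sliced) (use ab' in auto)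
      have "abs_continuous_on {a'..b'} (\<lambda>t. SW2 (K t) \<rho>\<^sub>1)"
        by (rule abs_continuous_on_SW2) (use ab' in auto)
      then show "abs_continuous_on {a..b} (\<lambda>t. SW2 (\<rho> t) \<rho>\<^sub>1)"
        unfolding eq by (rule abs_continuous_on_eq) (use ab eq K\<rho> in auto)
    qed
    \<comment> \<open>Countably many slabs exhaust (0,1), so one null set of times serves them
      all.\<close>
    have "AE t in lborel. \<forall>n::nat. t \<in> {0<..<1 - 1 / (real n + 2)} \<longrightarrow>
        integrable (K t) (\<lambda>x. sliced_discrepancy (K t) \<rho>\<^sub>1 x \<bullet> u (t, x)) \<and>
        ((\<lambda>s. (SW2 (K s) \<rho>\<^sub>1)\<^sup>2) has_real_derivative
          2 * (LINT x|K t. sliced_discrepancy (K t) \<rho>\<^sub>1 x \<bullet> u (t, x))) (at t)"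
      unfolding AE_all_countable
    proof
      fix n :: nat
      interpret sliced_curve K u "1 - 1 / (real n + 2)" \<rho>\<^sub>1
        by (rule sliced) (simp_all add: divide_less_eq)
      show "AE t in lborel. t \<in> {0<..<1 - 1 / (real n + 2)} \<longrightarrow>
        integrable (K t) (\<lambda>x. sliced_discrepancy (K t) \<rho>\<^sub>1 x \<bullet> u (t, x)) \<and>
        ((\<lambda>s. (SW2 (K s) \<rho>\<^sub>1)\<^sup>2) has_real_derivative
          2 * (LINT x|K t. sliced_discrepancy (K t) \<rho>\<^sub>1 x \<bullet> u (t, x))) (at t)"
        by (rule AE_deriv_SW2_sq)
    qed
    then show "AE t in lborel. t \<in> {0<..<1} \<longrightarrow>
      integrable (\<rho> t) (\<lambda>x. sliced_discrepancy (\<rho> t) \<rho>\<^sub>1 x \<bullet> v t x) \<and>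
      ((\<lambda>s. (SW2 (\<rho> s) \<rho>\<^sub>1)\<^sup>2) has_real_derivative
        2 * (LINT x|\<rho> t. sliced_discrepancy (\<rho> t) \<rho>\<^sub>1 x \<bullet> v t x)) (at t)"
    proof eventually_elim
      case (elim t)
      show ?case
      proof
        assume t: "t \<in> {0<..<1}"
        obtain n :: nat where n: "inverse (real (Suc n)) < 1 - t"
          using reals_Archimedean[of "1 - t"] t by auto
        have "1 / (real n + 2) \<le> inverse (real (Suc n))" by (simp add: inverse_eq_divide frac_le)
        then have "t \<in> {0<..<1 - 1 / (real n + 2)}" using t n by auto
        from elim[rule_format, OF this] have
          i: "integrable (\<rho> t) (\<lambda>x. sliced_discrepancy (\<rho> t) \<rho>\<^sub>1 x \<bullet> v t x)" and
          d: "((\<lambda>s. (SW2 (K s) \<rho>\<^sub>1)\<^sup>2) has_real_derivative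
            2 * (LINT x|\<rho> t. sliced_discrepancy (\<rho> t) \<rho>\<^sub>1 x \<bullet> v t x)) (at t)"
          using t by (simp_all add: K\<rho> uv)
        from d have "((\<lambda>s. (SW2 (\<rho> s) \<rho>\<^sub>1)\<^sup>2) has_real_derivative
            2 * (LINT x|\<rho> t. sliced_discrepancy (\<rho> t) \<rho>\<^sub>1 x \<bullet> v t x)) (at t)"
          by (rule has_field_derivative_transform_within_open[where S="{0<..<1}"]) (use t K\<rho> in auto)
        with i show "integrable (\<rho> t) (\<lambda>x. sliced_discrepancy (\<rho> t) \<rho>\<^sub>1 x \<bullet> v t x) \<and>
          ((\<lambda>s. (SW2 (\<rho> s) \<rho>\<^sub>1)\<^sup>2) has_real_derivative
            2 * (LINT x|\<rho> t. sliced_discrepancy (\<rho> t) \<rho>\<^sub>1 x \<bullet> v t x)) (at t)" ..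
      qed
    qed
  qed
qed

end
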